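(* Let $s,L>0$ be fixed, let all communication constraints be equal, $B^{(1)}=\dots=B^{(m)}=B>0$, and assume $\log_2 n\le m=O(n^{\frac{2s}{1+2s}}/\log^2 n)$ ($m$ and $B$ may depend on $n$). Write $$R_n=\inf_{\hat f\in\mathcal F_{dist}(B,\dots,B;B^s_{\infty,\infty}(L))}\ \sup_{f_0\in B^s_{\infty,\infty}(L)}\mathbb E_{f_0,T}\|\hat f-f_0\|_\infty .$$ Then: (ib) if $B\ge\big(n/(\log_2 n)^{3+4s}\big)^{1/(1+2s)}$, then $R_n\gtrsim(n/\log_2 n)^{-\frac{s}{1+2s}}$; (iib) if $(n\log_2(n)/m^{2+2s})^{1/(1+2s)}\le B<\big(n/(\log_2 n)^{3+4s}\big)^{1/(1+2s)}$, then $$R_n\gtrsim\Big(\frac{n^{\frac1{1+2s}}}{B(\log_2 n)^{\frac{3+4s}{1+2s}}}\Big)^{\frac{s}{2+2s}}\Big(\frac{n}{\log_2 n}\Big)^{-\frac{s}{1+2s}};$$ (iiib) if $(n\log_2(n)/m^{2+2s})^{1/(1+2s)}>B$, then $$R_n\gtrsim\Big(\frac{n\log_2 n}{m}\Big)^{-\frac{s}{1+2s}} .$$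
   Context: Model. The total sample size is $n$ and there are $m=m_n$ local machines with $n/m\in\mathbb N$. Machine $i\in\{1,\dots,m\}$ observes pairs $(T^{(i)}_\ell,X^{(i)}_\ell)$, $\ell=1,\dots,n/m$, with $X^{(i)}_\ell=f_0(T^{(i)}_\ell)+\sigma\varepsilon^{(i)}_\ell$, where the $T^{(i)}_\ell$ are iid uniform on $(0,1)$, the $\varepsilon^{(i)}_\ell$ are iid $N(0,1)$, independent of the design, $\sigma>0$ is fixed and $f_0\in L_2[0,1]$ is unknown and common to all machines. $\mathbb E_{f_0,T}$ is expectation under the joint law of all data. Distributed estimators. Machine $i$ sends to a central machine a finite binary string $Y^{(i)}$ which is a measurable function of its local data; $l(Y)$ denotes the length of a string $Y$. For $\mathcal F\subset L_2[0,1]$, $\mathcal F_{dist}(B^{(1)},\dots,B^{(m)};\mathcal F)$ is the class of estimators $\hat f$ that are measurable functions of $(Y^{(1)},\dots,Y^{(m)})$ for such strings satisfying $\mathbb E_{f_0,T}[l(Y^{(i)})]\le B^{(i)}$ for all $f_0\in\mathcal F$ and all $i$. Besov balls. $\psi_{jk}$ ($j\ge 0$, $0\le k\le 2^j-1$) is a Cohen–Daubechies–Vial compactly supported orthonormal wavelet basis of $L_2[0,1]$ with $N>s$ vanishing moments (coarsest-level scaling functions included in the indexing), $f_{jk}=\langle f,\psi_{jk}\rangle$, $\|f\|_{B^s_{\infty,\infty}}=\sup_{j,k}2^{j(s+1/2)}|f_{jk}|$ and $B^s_{\infty,\infty}(L)=\{f\in L_2[0,1]:\|f\|_{B^s_{\infty,\infty}}<L\}$.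 Notation. For positive sequences, $a_n\lesssim b_n$ (equivalently $b_n\gtrsim a_n$) means $a_n\le Cb_n$ for all sufficiently large $n$ with a constant $C>0$ not depending on $n$ (it may depend on fixed quantities such as $s,L,\sigma$, the wavelet basis and the implied constant in the condition on $m$). *)

theory Defs
  imports "HOL-Probability.Probability"
begin

section \<open>The space \<open>L\<^sub>2[0,1]\<close>\<close>

text \<open>Elements of \<open>L\<^sub>2[0,1]\<close> are represented by Borel functions on the whole line; nothing below
  depends on the values outside \<open>[0,1]\<close> or on null sets. For this reason the sup norm is the
  essential supremum. It is allowed to be infinite.\<close>

definition L2_01 :: "(real \<Rightarrow> real) set" where
  "L2_01 = {f \<in> borel_measurable borel. set_integrable lborel {0..1} (\<lambda>x. (f x)\<^sup>2)}"

definition inner_01 :: "(real \<Rightarrow> real) \<Rightarrow> (real \<Rightarrow> real) \<Rightarrow> real" where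
  "inner_01 f g = (LINT x:{0..1}|lborel. f x * g x)"

definition sup_norm_01 :: "(real \<Rightarrow> real) \<Rightarrow> ennreal" where
  "sup_norm_01 f = esssup (restrict_space lborel {0..1}) (\<lambda>x. ennreal \<bar>f x\<bar>)"

section \<open>Cohen--Daubechies--Vial wavelets\<close>

text \<open>Daubechies father and mother wavelets with \<open>N\<close> vanishing moments, shifted so that both are
  supported in \<open>[1 - N, N]\<close>. For \<open>N \<ge> 2\<close> the father wavelet is continuous and for \<open>N = 1\<close> it is the
  indicator of \<open>[0,1)\<close>; boundedness and the pointwise refinement equation single out such a
  representative of the \<open>L\<^sub>2\<close> class. The filter is not assumed to be the extremal phase one.\<close>

definition daubechies_pair :: "nat \<Rightarrow> (real \<Rightarrow> real) \<Rightarrow> (real \<Rightarrow> real) \<Rightarrow> bool" where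
  "daubechies_pair N \<phi> w \<longleftrightarrow>
     \<phi> \<in> borel_measurable borel \<and> bounded (range \<phi>) \<and>
     (\<forall>x. x \<notin> {1 - real N..real N} \<longrightarrow> \<phi> x = 0) \<and>
     (LINT x|lborel. \<phi> x) = 1 \<and>
     (\<forall>k::int. (LINT x|lborel. \<phi> x * \<phi> (x - of_int k)) = (if k = 0 then 1 else 0)) \<and>
     (\<exists>h::int \<Rightarrow> real.
        (\<forall>x. \<phi> x = sqrt 2 * (\<Sum>n\<in>{1 - int N..int N}. h n * \<phi> (2 * x - of_int n))) \<and>
        (\<forall>x. w x = sqrt 2 *
               (\<Sum>n\<in>{1 - int N..int N}. ((- 1) powi n) * h (1 - n) * \<phi> (2 * x - of_int n)))) \<and>
     (\<forall>l<N. (LINT x|lborel. x ^ l * w x) = 0)"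

text \<open>The edge functions on the half line \<open>[0,\<infinity>)\<close>. The functions \<open>edge_pre N \<phi> i\<close> complement the interior
  translates \<open>\<phi>(\<cdot> - m)\<close>, \<open>m \<ge> N\<close>, so that together they reproduce polynomials of degree less than \<open>N\<close>;
  the edge scaling functions \<open>\<phi>e k\<close> are obtained from them by Gram--Schmidt in the order
  \<open>i = N - 1, \<dots>, 0\<close>. The edge wavelets \<open>we k\<close> are an orthonormal basis of what is left of the next finer
  space after removing the coarse space and the interior wavelets. Both families have staggered
  supports \<open>[0, N + k]\<close>.\<close>

definition edge_pre :: "nat \<Rightarrow> (real \<Rightarrow> real) \<Rightarrow> nat \<Rightarrow> real \<Rightarrow> real" where
  "edge_pre N \<phi> i x =
     indicator {0..} x * (\<Sum>n\<in>{i..2 * N - 2}. real (n choose i) * \<phi> (x + real n - real N + 1))"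

definition orthonormal_halfline :: "nat \<Rightarrow> (nat \<Rightarrow> real \<Rightarrow> real) \<Rightarrow> bool" where
  "orthonormal_halfline N e \<longleftrightarrow>
     (\<forall>k<N. \<forall>l<N. (LINT x:{0..}|lborel. e k x * e l x) = (if k = l then 1 else 0))"

definition edge_system ::
  "nat \<Rightarrow> (real \<Rightarrow> real) \<Rightarrow> (real \<Rightarrow> real) \<Rightarrow> (nat \<Rightarrow> real \<Rightarrow> real) \<Rightarrow> (nat \<Rightarrow> real \<Rightarrow> real) \<Rightarrow> bool"
where
  "edge_system N \<phi> w \<phi>e we \<longleftrightarrow>
     (\<forall>k<N. \<exists>a. \<forall>x. \<phi>e k x = (\<Sum>i\<in>{N - 1 - k..N - 1}. a i * edge_pre N \<phi> i x)) \<and>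
     orthonormal_halfline N \<phi>e \<and>
     (\<forall>k<N. \<exists>a b. \<forall>x. we k x = indicator {0..} x *
        ((\<Sum>l<N. a l * \<phi>e l (2 * x)) + (\<Sum>m\<in>{N..N + 2 * k}. b m * \<phi> (2 * x - real m)))) \<and>
     orthonormal_halfline N we \<and>
     (\<forall>k<N. \<forall>l<N. (LINT x:{0..}|lborel. we k x * \<phi>e l x) = 0) \<and>
     (\<forall>k<N. \<forall>m\<ge>N. (LINT x:{0..}|lborel. we k x * \<phi> (x - real m)) = 0 \<and>
                    (LINT x:{0..}|lborel. we k x * w (x - real m)) = 0)"

text \<open>The \<open>2 ^ j\<close> functions of level \<open>j\<close> on \<open>[0,1]\<close>: \<open>N\<close> at the left edge, dilated translates of \<open>g\<close> in the
  interior, and \<open>N\<close> at the right edge, where \<open>gr\<close> lives on the reflected half line.\<close>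

definition level_fun ::
  "nat \<Rightarrow> (real \<Rightarrow> real) \<Rightarrow> (nat \<Rightarrow> real \<Rightarrow> real) \<Rightarrow> (nat \<Rightarrow> real \<Rightarrow> real) \<Rightarrow> nat \<Rightarrow> nat \<Rightarrow> real \<Rightarrow> real"
where
  "level_fun N g gl gr j k x = 2 powr (real j / 2) *
     (if k < N then gl k (2 ^ j * x)
      else if k < 2 ^ j - N then g (2 ^ j * x - real k)
      else gr (2 ^ j - 1 - k) (2 ^ j * (1 - x)))"

text \<open>The coarsest resolution is \<open>J\<close>, with \<open>2 ^ J \<ge> 2 * N\<close> as the construction requires. The \<open>2 ^ J\<close>
  scaling functions of that resolution are included in the double indexing as \<open>\<psi> j0 k\<close>, under an
  arbitrary label \<open>j0 < J\<close>. (They cannot be distributed injectively over the \<open>2 ^ J - 1\<close> pairs with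
  \<open>j < J\<close>, \<open>k < 2 ^ j\<close>.)\<close>

definition wavelet_indices :: "nat \<Rightarrow> nat \<Rightarrow> (nat \<times> nat) set" where
  "wavelet_indices j0 J = {(j, k). j = j0 \<and> k < 2 ^ J} \<union> {(j, k). J \<le> j \<and> k < 2 ^ j}"

definition orthonormal_basis_01 :: "('i \<Rightarrow> real \<Rightarrow> real) \<Rightarrow> 'i set \<Rightarrow> bool" where
  "orthonormal_basis_01 e I \<longleftrightarrow>
     (\<forall>a\<in>I. \<forall>b\<in>I. inner_01 (e a) (e b) = (if a = b then 1 else 0)) \<and>
     (\<forall>f\<in>L2_01. (\<forall>a\<in>I. inner_01 f (e a) = 0) \<longrightarrow> (AE x\<in>{0..1} in lborel. f x = 0))"

text \<open>The last conjunct is the theorem of Cohen, Daubechies and Vial about the functions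
  constructed; it is listed because being an orthonormal basis is part of the notion.\<close>

definition cdv_basis :: "nat \<Rightarrow> nat \<Rightarrow> nat \<Rightarrow> (nat \<Rightarrow> nat \<Rightarrow> real \<Rightarrow> real) \<Rightarrow> bool" where
  "cdv_basis N j0 J \<psi> \<longleftrightarrow>
     0 < N \<and> 2 * N \<le> 2 ^ J \<and> j0 < J \<and>
     (\<exists>\<phi> w \<phi>l wl \<phi>r wr.
        daubechies_pair N \<phi> w \<and>
        edge_system N \<phi> w \<phi>l wl \<and>
        edge_system N (\<lambda>x. \<phi> (1 - x)) (\<lambda>x. w (1 - x)) \<phi>r wr \<and>
        (\<forall>k<2 ^ J. \<psi> j0 k = level_fun N \<phi> \<phi>l \<phi>r J k) \<and>
        (\<forall>j\<ge>J. \<forall>k<2 ^ j. \<psi> j k = level_fun N w wl wr j k)) \<and>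
     orthonormal_basis_01 (\<lambda>(j, k). \<psi> j k) (wavelet_indices j0 J)"

definition besov_norm ::
  "nat \<Rightarrow> nat \<Rightarrow> (nat \<Rightarrow> nat \<Rightarrow> real \<Rightarrow> real) \<Rightarrow> real \<Rightarrow> (real \<Rightarrow> real) \<Rightarrow> ennreal"
where
  "besov_norm j0 J \<psi> s f =
     (SUP (j, k)\<in>wavelet_indices j0 J. ennreal (2 powr (real j * (s + 1 / 2)) * \<bar>inner_01 f (\<psi> j k)\<bar>))"

definition besov_ball ::
  "nat \<Rightarrow> nat \<Rightarrow> (nat \<Rightarrow> nat \<Rightarrow> real \<Rightarrow> real) \<Rightarrow> real \<Rightarrow> real \<Rightarrow> (real \<Rightarrow> real) set"
where
  "besov_ball j0 J \<psi> s L = {f \<in> L2_01. besov_norm j0 J \<psi> s f < ennreal L}"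

section \<open>The distributed regression model\<close>

definition obs_law :: "real \<Rightarrow> (real \<Rightarrow> real) \<Rightarrow> (real \<times> real) measure" where
  "obs_law \<sigma> f =
     distr (uniform_measure lborel {0<..<1} \<Otimes>\<^sub>M density lborel std_normal_density) borel
       (\<lambda>(t, e). (t, f t + \<sigma> * e))"

text \<open>The data set \<open>D\<close> of all machines is a curried family, \<open>D i l = (T, X)\<close> being the \<open>l\<close>-th observation
  of machine \<open>i\<close>.\<close>

definition joint_law ::
  "real \<Rightarrow> nat \<Rightarrow> nat \<Rightarrow> (real \<Rightarrow> real) \<Rightarrow> (nat \<Rightarrow> nat \<Rightarrow> real \<times> real) measure"
where
  "joint_law \<sigma> n m f = (\<Pi>\<^sub>M i\<in>{1..m}. \<Pi>\<^sub>M l\<in>{1..n div m}. obs_law \<sigma> f)"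

text \<open>\<open>Y i\<close> encodes the local data of machine \<open>i\<close>, and \<open>g\<close> is the aggregation on the central machine;
  only \<open>m dvd n\<close> is meant, so that \<open>n div m\<close> is the local sample size.\<close>

definition dist_estimators ::
  "real \<Rightarrow> nat \<Rightarrow> nat \<Rightarrow> (nat \<Rightarrow> real) \<Rightarrow> (real \<Rightarrow> real) set
     \<Rightarrow> ((nat \<Rightarrow> nat \<Rightarrow> real \<times> real) \<Rightarrow> real \<Rightarrow> real) set"
where
  "dist_estimators \<sigma> n m B F =
     {fhat. \<exists>(Y :: nat \<Rightarrow> (nat \<Rightarrow> real \<times> real) \<Rightarrow> bool list) (g :: (nat \<Rightarrow> bool list) \<Rightarrow> real \<Rightarrow> real).
        (\<forall>i\<in>{1..m}. Y i \<in> (\<Pi>\<^sub>M l\<in>{1..n div m}. borel) \<rightarrow>\<^sub>M count_space UNIV) \<and>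
        (\<lambda>(y, x). g y x) \<in> borel_measurable ((\<Pi>\<^sub>M i\<in>{1..m}. count_space UNIV) \<Otimes>\<^sub>M borel) \<and>
        (\<forall>f\<in>F. \<forall>i\<in>{1..m}.
           (\<integral>\<^sup>+ D. of_nat (length (Y i (D i))) \<partial>joint_law \<sigma> n m f) \<le> ennreal (B i)) \<and>
        fhat = (\<lambda>D. g (\<lambda>i\<in>{1..m}. Y i (D i)))}"

definition minimax_risk ::
  "real \<Rightarrow> nat \<Rightarrow> nat \<Rightarrow> (nat \<Rightarrow> real) \<Rightarrow> (real \<Rightarrow> real) set \<Rightarrow> ennreal"
where
  "minimax_risk \<sigma> n m B F =
     (INF fhat\<in>dist_estimators \<sigma> n m B F.
        SUP f\<in>F. \<integral>\<^sup>+ D. sup_norm_01 (\<lambda>x. fhat D x - f x) \<partial>joint_law \<sigma> n m f)"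

end

theory Submission
  imports Defs "HOL-Real_Asymp.Real_Asymp"
begin

text \<open>The null function is tested against disjoint wavelet bumps \<open>f\<^sub>q = d \<psi>\<^sub>j\<^sub>k\<close> of one level \<open>j\<close>, with
  \<open>d\<close> proportional to \<open>2 ^ (- j (s + 1/2))\<close>; their sup norm is of order \<open>D ^ (- s)\<close> for \<open>D = 2 ^ j\<close>. Without
  communication constraint the uniform mixture of the alternatives is close to the null as long as
  \<open>n d\<^sup>2\<close> is a small multiple of \<open>log D\<close>.

  For the other two regimes, let a message \<open>y\<close> have probability \<open>p\<close> under the null. Given the design, the
  likelihood ratios of the different bumps are independent functions of Gaussian variables whose
  variance is of the order \<open>\<alpha> = (n / m) d\<^sup>2\<close>. When \<open>\<alpha>\<close> is at most a small multiple of \<open>1 / log n\<close>,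
  capping them makes them sub-Gaussian at negligible cost, and then the squares of their centred conditional
  expectations given \<open>y\<close> have a sum over \<open>q\<close> of at most a constant times \<open>\<alpha> log (1 / p)\<close>. Averaging
  over \<open>y\<close> turns \<open>log (1 / p)\<close> into the entropy of the message, which is at most of order \<open>B log n\<close>. Summing
  over the machines shows that for some \<open>q\<close> the chi-squared divergence of all messages is at most of the order
  \<open>n d\<^sup>2 B log n / D\<close>, and Le Cam's two-point bound applies once this is small. Hence \<open>D\<close> can be taken
  of the order of the larger of \<open>(n B log n) ^ (1 / (2 + 2 s))\<close> and \<open>(n log n / m) ^ (1 / (1 + 2 s))\<close>.\<close>

section \<open>Product measures\<close>

text \<open>Given the design, a likelihood ratio is log-normal and has no exponential moments,
  whereas the bound on the squared conditional expectations, a form of Talagrand's level-1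
  inequality, needs them in every direction. This obstacle forces the capping. The capped mass has
  to be summable over the machines, of which there may be up to \<open>n\<close>, so each machine
  may lose about \<open>1 / n\<close>; a Gaussian tail then asks for \<open>\<alpha>\<close> of
  order \<open>1 / log n\<close>. For the same reason the conditional variance has to stay near its
  mean except with probability about \<open>1 / n\<close>, so a bump must cover at least of the
  order of \<open>log n\<close> local design points, that is, \<open>n / (m D)\<close> must be of
  that order. With \<open>D\<close> at most of the order of \<open>n powr (1 / (1 + 2 s))\<close>
  this is what the upper bound on \<open>m\<close> provides; the upper limit for \<open>B\<close> in
  the middle regime and \<open>log n \<le> m\<close> in the last one keep \<open>D\<close> in that
  range. All conditioning on the design is done by Fubini, and all conditioning on messages by
  elementary quotients, as messages are countable.\<close>

lemma PiM_density:
  assumes I: "finite I"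
    and M: "\<And>i. prob_space (M i)"
    and f[measurable]: "\<And>i. f i \<in> borel_measurable (M i)"
    and D: "\<And>i. prob_space (density (M i) (f i))"
  shows "PiM I (\<lambda>i. density (M i) (f i)) = density (PiM I M) (\<lambda>x. \<Prod>i\<in>I. f i (x i))"
proof -
  interpret M: product_prob_space M by (intro product_prob_spaceI M)
  interpret D: product_prob_space "\<lambda>i. density (M i) (f i)" by (intro product_prob_spaceI D)
  have "density (PiM I M) (\<lambda>x. \<Prod>i\<in>I. f i (x i)) = PiM I (\<lambda>i. density (M i) (f i))"
  proof (rule D.PiM_eqI[OF I])
    show "sets (density (PiM I M) (\<lambda>x. \<Prod>i\<in>I. f i (x i))) = sets (PiM I (\<lambda>i. density (M i) (f i)))"
      by (simp cong: sets_PiM_cong)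
    fix A assume A: "\<And>i. i \<in> I \<Longrightarrow> A i \<in> sets (density (M i) (f i))"
    then have A'[measurable]: "\<And>i. i \<in> I \<Longrightarrow> A i \<in> sets (M i)" by simp
    have "emeasure (density (PiM I M) (\<lambda>x. \<Prod>i\<in>I. f i (x i))) (Pi\<^sub>E I A)
        = (\<integral>\<^sup>+x. (\<Prod>i\<in>I. f i (x i)) * indicator (Pi\<^sub>E I A) x \<partial>PiM I M)"
      using I A' by (intro emeasure_density) (auto intro!: sets_PiM_I_finite)
    also have "\<dots> = (\<integral>\<^sup>+x. (\<Prod>i\<in>I. f i (x i) * indicator (A i) (x i)) \<partial>PiM I M)"
    proof (intro nn_integral_cong)
      fix x assume x: "x \<in> space (PiM I M)"
      have "indicator (Pi\<^sub>E I A) x = (\<Prod>i\<in>I. indicator (A i) (x i) :: ennreal)"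
      proof (cases "x \<in> Pi\<^sub>E I A")
        case True
        then show ?thesis by (auto simp: PiE_iff intro!: prod.neutral[symmetric])
      next
        case False
        with x obtain i where "i \<in> I" "x i \<notin> A i" by (auto simp: PiE_iff space_PiM)
        then have "(\<Prod>i\<in>I. indicator (A i) (x i) :: ennreal) = 0"
          using I by (intro prod_zero) (auto intro!: bexI[of _ i])
        with False show ?thesis by simp
      qed
      then show "(\<Prod>i\<in>I. f i (x i)) * indicator (Pi\<^sub>E I A) x = (\<Prod>i\<in>I. f i (x i) * indicator (A i) (x i))"
        by (simp add: prod.distrib)
    qed
    also have "\<dots> = (\<Prod>i\<in>I. \<integral>\<^sup>+x. f i x * indicator (A i) x \<partial>M i)"
      by (rule M.product_nn_integral_prod[OF I]) auto
    also have "\<dots> = (\<Prod>i\<in>I. emeasure (density (M i) (f i)) (A i))"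
      by (intro prod.cong refl emeasure_density[symmetric]) auto
    finally show "emeasure (density (PiM I M) (\<lambda>x. \<Prod>i\<in>I. f i (x i))) (Pi\<^sub>E I A)
        = (\<Prod>i\<in>I. emeasure (density (M i) (f i)) (A i))" .
  qed
  then show ?thesis ..
qed

lemma distr_PiM_map:
  assumes I: "finite I"
    and M: "\<And>i. prob_space (M i)"
    and f[measurable]: "\<And>i. f i \<in> M i \<rightarrow>\<^sub>M N i"
  shows "distr (PiM I M) (PiM I N) (\<lambda>x. \<lambda>i\<in>I. f i (x i)) = PiM I (\<lambda>i. distr (M i) (N i) (f i))"
proof -
  interpret M: product_prob_space M by (intro product_prob_spaceI M)
  interpret D: product_prob_space "\<lambda>i. distr (M i) (N i) (f i)"
    by (intro product_prob_spaceI prob_space.prob_space_distr M f)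
  show ?thesis
  proof (rule D.PiM_eqI[OF I])
    show "sets (distr (PiM I M) (PiM I N) (\<lambda>x. \<lambda>i\<in>I. f i (x i))) = sets (PiM I (\<lambda>i. distr (M i) (N i) (f i)))"
      by (simp cong: sets_PiM_cong)
    fix A assume A: "\<And>i. i \<in> I \<Longrightarrow> A i \<in> sets (distr (M i) (N i) (f i))"
    then have A'[measurable]: "\<And>i. i \<in> I \<Longrightarrow> A i \<in> sets (N i)" by simp
    have "emeasure (distr (PiM I M) (PiM I N) (\<lambda>x. \<lambda>i\<in>I. f i (x i))) (Pi\<^sub>E I A)
        = emeasure (PiM I M) ((\<lambda>x. \<lambda>i\<in>I. f i (x i)) -` Pi\<^sub>E I A \<inter> space (PiM I M))"
      using I A' by (intro emeasure_distr) (auto intro!: sets_PiM_I_finite)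
    also have "(\<lambda>x. \<lambda>i\<in>I. f i (x i)) -` Pi\<^sub>E I A \<inter> space (PiM I M)
        = (\<Pi>\<^sub>E i\<in>I. f i -` A i \<inter> space (M i))"
      by (auto simp: space_PiM PiE_iff)
    also have "emeasure (PiM I M) \<dots> = (\<Prod>i\<in>I. emeasure (M i) (f i -` A i \<inter> space (M i)))"
      using I by (intro M.emeasure_PiM) auto
    also have "\<dots> = (\<Prod>i\<in>I. emeasure (distr (M i) (N i) (f i)) (A i))"
      using A' by (intro prod.cong refl emeasure_distr[symmetric]) auto
    finally show "emeasure (distr (PiM I M) (PiM I N) (\<lambda>x. \<lambda>i\<in>I. f i (x i))) (Pi\<^sub>E I A)
        = (\<Prod>i\<in>I. emeasure (distr (M i) (N i) (f i)) (A i))" .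
  qed
qed

text \<open>An iid sample of pairs is a pair of independent samples. This allows the design to be
  frozen while the noise is integrated out; on rectangles it is Fubini in each coordinate.\<close>

lemma distr_PiM_zip:
  assumes I: "finite I"
    and M: "\<And>i. prob_space (M i)" and N: "\<And>i. prob_space (N i)"
  shows "distr (PiM I M \<Otimes>\<^sub>M PiM I N) (PiM I (\<lambda>i. M i \<Otimes>\<^sub>M N i)) (\<lambda>z. \<lambda>i\<in>I. (fst z i, snd z i))
    = PiM I (\<lambda>i. M i \<Otimes>\<^sub>M N i)"
proof -
  interpret M: product_prob_space M by (intro product_prob_spaceI M)
  interpret N: product_prob_space N by (intro product_prob_spaceI N)
  interpret MN: product_prob_space "\<lambda>i. M i \<Otimes>\<^sub>M N i"
    by (intro product_prob_spaceI prob_space_pair M N)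
  have PN: "prob_space (PiM I N)" by (rule prob_space_PiM) (simp add: N)
  have z[measurable]: "(\<lambda>z. \<lambda>i\<in>I. (fst z i, snd z i)) \<in> PiM I M \<Otimes>\<^sub>M PiM I N \<rightarrow>\<^sub>M PiM I (\<lambda>i. M i \<Otimes>\<^sub>M N i)"
    by measurable
  show ?thesis
  proof (rule MN.PiM_eqI[OF I])
    show "sets (distr (PiM I M \<Otimes>\<^sub>M PiM I N) (PiM I (\<lambda>i. M i \<Otimes>\<^sub>M N i)) (\<lambda>z. \<lambda>i\<in>I. (fst z i, snd z i)))
        = sets (PiM I (\<lambda>i. M i \<Otimes>\<^sub>M N i))" by simp
    fix A assume A[measurable]: "\<And>i. i \<in> I \<Longrightarrow> A i \<in> sets (M i \<Otimes>\<^sub>M N i)"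
    have PA[measurable]: "Pi\<^sub>E I A \<in> sets (PiM I (\<lambda>i. M i \<Otimes>\<^sub>M N i))"
      using I A by (auto intro!: sets_PiM_I_finite)
    let ?g = "\<lambda>z. \<Prod>i\<in>I. indicator (A i) (fst z i, snd z i) :: ennreal"
    have g[measurable]: "?g \<in> borel_measurable (PiM I M \<Otimes>\<^sub>M PiM I N)"
      by (intro borel_measurable_prod_ennreal) measurable
    have "emeasure (distr (PiM I M \<Otimes>\<^sub>M PiM I N) (PiM I (\<lambda>i. M i \<Otimes>\<^sub>M N i)) (\<lambda>z. \<lambda>i\<in>I. (fst z i, snd z i))) (Pi\<^sub>E I A)
       = (\<integral>\<^sup>+z. indicator (Pi\<^sub>E I A) (\<lambda>i\<in>I. (fst z i, snd z i)) \<partial>(PiM I M \<Otimes>\<^sub>M PiM I N))"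
      by (subst nn_integral_indicator[symmetric], simp, subst nn_integral_distr) simp_all
    also have "\<dots> = (\<integral>\<^sup>+z. ?g z \<partial>(PiM I M \<Otimes>\<^sub>M PiM I N))"
    proof (intro nn_integral_cong)
      fix z
      show "indicator (Pi\<^sub>E I A) (\<lambda>i\<in>I. (fst z i, snd z i)) = ?g z"
      proof (cases "\<forall>i\<in>I. (fst z i, snd z i) \<in> A i")
        case True
        then show ?thesis by (auto simp: PiE_iff indicator_def)
      next
        case False
        then obtain i where i: "i \<in> I" "(fst z i, snd z i) \<notin> A i" by auto
        then have "?g z = 0" using I by (intro prod_zero) (auto intro!: bexI[of _ i])
        with i show ?thesis by (auto simp: PiE_iff indicator_def)
      qed
    qed
    also have "\<dots> = (\<integral>\<^sup>+t. \<integral>\<^sup>+e. ?g (t, e) \<partial>PiM I N \<partial>PiM I M)"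
      by (rule sigma_finite_measure.nn_integral_fst[OF prob_space_imp_sigma_finite[OF PN], symmetric]) measurable
    also have "\<dots> = (\<integral>\<^sup>+t. (\<Prod>i\<in>I. \<integral>\<^sup>+e. indicator (A i) (t i, e) \<partial>N i) \<partial>PiM I M)"
    proof (intro nn_integral_cong)
      fix t assume t: "t \<in> space (PiM I M)"
      have "(\<integral>\<^sup>+e. (\<Prod>i\<in>I. indicator (A i) (t i, e i)) \<partial>PiM I N) = (\<Prod>i\<in>I. \<integral>\<^sup>+e. indicator (A i) (t i, e) \<partial>N i)"
      proof (rule N.product_nn_integral_prod[OF I])
        fix i assume i: "i \<in> I"
        then have "t i \<in> space (M i)" using t by (auto simp: space_PiM PiE_iff)
        with A[OF i] show "(\<lambda>e. indicator (A i) (t i, e)) \<in> borel_measurable (N i)"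
          by measurable
      qed
      then show "(\<integral>\<^sup>+e. ?g (t, e) \<partial>PiM I N) = (\<Prod>i\<in>I. \<integral>\<^sup>+e. indicator (A i) (t i, e) \<partial>N i)" by simp
    qed
    also have "\<dots> = (\<Prod>i\<in>I. \<integral>\<^sup>+t. \<integral>\<^sup>+e. indicator (A i) (t, e) \<partial>N i \<partial>M i)"
      by (rule M.product_nn_integral_prod[OF I]) measurable
    also have "\<dots> = (\<Prod>i\<in>I. emeasure (M i \<Otimes>\<^sub>M N i) (A i))"
      using A by (intro prod.cong refl) (simp add: sigma_finite_measure.emeasure_pair_measure[OF prob_space_imp_sigma_finite[OF N]])
    finally show "emeasure (distr (PiM I M \<Otimes>\<^sub>M PiM I N) (PiM I (\<lambda>i. M i \<Otimes>\<^sub>M N i)) (\<lambda>z. \<lambda>i\<in>I. (fst z i, snd z i))) (Pi\<^sub>E I A)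
      = (\<Prod>i\<in>I. emeasure (M i \<Otimes>\<^sub>M N i) (A i))" .
  qed
qed

text \<open>Serves for Jensen's inequality in the form \<open>1 + x \<le> exp x\<close>: the affine
  minorant is integrable but changes sign, while the integral of the exponential may be
  infinite.\<close>

lemma ennreal_integral_le_nn_integral:
  fixes f :: "'a \<Rightarrow> real"
  assumes f: "integrable M f"
  shows "ennreal (\<integral>x. f x \<partial>M) \<le> (\<integral>\<^sup>+x. ennreal (f x) \<partial>M)"
proof -
  have "(\<integral>x. f x \<partial>M) \<le> (\<integral>x. max (f x) 0 \<partial>M)"
    using f by (intro integral_mono) auto
  then have "ennreal (\<integral>x. f x \<partial>M) \<le> ennreal (\<integral>x. max (f x) 0 \<partial>M)" by (rule ennreal_leI)
  also have "\<dots> = (\<integral>\<^sup>+x. ennreal (max (f x) 0) \<partial>M)"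
    using f by (intro nn_integral_eq_integral[symmetric]) auto
  also have "\<dots> = (\<integral>\<^sup>+x. ennreal (f x) \<partial>M)"
    by (intro nn_integral_cong) (simp add: max_def ennreal_neg)
  finally show ?thesis .
qed

text \<open>Both sides are twice \<open>cosh\<close>, which is even and increasing on the
  nonnegative half line.\<close>

lemma exp_sum_uminus_mono:
  fixes x y :: real
  assumes "\<bar>x\<bar> \<le> \<bar>y\<bar>"
  shows "exp x + exp (- x) \<le> exp y + exp (- y)"
proof -
  have "cosh \<bar>x\<bar> \<le> cosh \<bar>y\<bar>" using assms by (subst cosh_real_nonneg_le_iff) auto
  then show ?thesis by (cases "x \<ge> 0"; cases "y \<ge> 0") (simp_all add: cosh_def)
qed

text \<open>Symmetrisation: with an independent copy \<open>S'\<close>, the moment generating function of the centred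
  variable is at most that of \<open>h(S) - h(S')\<close>, whose even part is dominated by that of \<open>c(S - S')\<close>.\<close>

lemma (in prob_space) subgaussian_lipschitz:
  fixes S :: "'a \<Rightarrow> real" and h :: "real \<Rightarrow> real"
  assumes S[measurable]: "S \<in> borel_measurable M"
    and sub: "\<And>u. (\<integral>\<^sup>+\<omega>. exp (u * S \<omega>) \<partial>M) \<le> ennreal (exp (u\<^sup>2 * A / 2))"
    and h[measurable]: "h \<in> borel_measurable borel"
    and lip: "\<And>x y. \<bar>h x - h y\<bar> \<le> c * \<bar>x - y\<bar>"
    and bdd: "\<And>x. \<bar>h x\<bar> \<le> K"
  shows "(\<integral>\<^sup>+\<omega>. exp (b * (h (S \<omega>) - (\<integral>\<omega>. h (S \<omega>) \<partial>M))) \<partial>M) \<le> ennreal (exp (c\<^sup>2 * b\<^sup>2 * A))"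
proof -
  define m where "m = (\<integral>\<omega>. h (S \<omega>) \<partial>M)"
  have c0: "0 \<le> c" using lip[of 1 0] by (metis abs_ge_zero abs_one diff_0_right mult.right_neutral order_trans)
  have int: "integrable M (\<lambda>\<omega>. h (S \<omega>))"
    by (rule integrable_const_bound[where B=K]) (auto simp: bdd)
  let ?E = "\<lambda>f. \<integral>\<^sup>+\<omega>. ennreal (exp (f \<omega>)) \<partial>M"
  define x y where "x = ?E (\<lambda>\<omega>. b * h (S \<omega>))" and "y = ?E (\<lambda>\<omega>. - b * h (S \<omega>))"
  have dbl: "?E f * ?E g = (\<integral>\<^sup>+\<omega>. \<integral>\<^sup>+\<omega>'. ennreal (exp (f \<omega> + g \<omega>')) \<partial>M \<partial>M)"
    if [measurable]: "f \<in> borel_measurable M" "g \<in> borel_measurable M" for f g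
    by (simp add: exp_add ennreal_mult nn_integral_cmult nn_integral_multc)
  have two: "x * y + y * x \<le> ?E (\<lambda>\<omega>. (b*c) * S \<omega>) * ?E (\<lambda>\<omega>. - (b*c) * S \<omega>)
        + ?E (\<lambda>\<omega>. - (b*c) * S \<omega>) * ?E (\<lambda>\<omega>. (b*c) * S \<omega>)"
  proof -
    have "x * y + y * x = (\<integral>\<^sup>+\<omega>. \<integral>\<^sup>+\<omega>'. ennreal (exp (b * h (S \<omega>) + - b * h (S \<omega>'))) + ennreal (exp (- b * h (S \<omega>) + b * h (S \<omega>'))) \<partial>M \<partial>M)"
      unfolding x_def y_def by (subst (1 2) dbl) (simp_all add: nn_integral_add)
    also have "\<dots> \<le> (\<integral>\<^sup>+\<omega>. \<integral>\<^sup>+\<omega>'. ennreal (exp ((b*c) * S \<omega> + - (b*c) * S \<omega>')) + ennreal (exp (- (b*c) * S \<omega> + (b*c) * S \<omega>')) \<partial>M \<partial>M)"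
    proof (intro nn_integral_mono)
      fix \<omega> \<omega>'
      have "\<bar>b * (h (S \<omega>) - h (S \<omega>'))\<bar> \<le> \<bar>(b * c) * (S \<omega> - S \<omega>')\<bar>"
        using mult_left_mono[OF lip[of "S \<omega>" "S \<omega>'"], of "\<bar>b\<bar>"] c0 by (simp add: abs_mult mult.assoc)
      from exp_sum_uminus_mono[OF this]
      show "ennreal (exp (b * h (S \<omega>) + - b * h (S \<omega>'))) + ennreal (exp (- b * h (S \<omega>) + b * h (S \<omega>')))
        \<le> ennreal (exp ((b*c) * S \<omega> + - (b*c) * S \<omega>')) + ennreal (exp (- (b*c) * S \<omega> + (b*c) * S \<omega>'))"
        by (simp add: ennreal_plus[symmetric] algebra_simps del: ennreal_plus)
    qed
    also have "\<dots> = ?E (\<lambda>\<omega>. (b*c) * S \<omega>) * ?E (\<lambda>\<omega>. - (b*c) * S \<omega>)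
        + ?E (\<lambda>\<omega>. - (b*c) * S \<omega>) * ?E (\<lambda>\<omega>. (b*c) * S \<omega>)"
      by (subst (1 2) dbl) (simp_all add: nn_integral_add)
    finally show ?thesis .
  qed
  \<comment> \<open>Each of the two independent factors costs
    \<open>(b * c)\<^sup>2 * A / 2\<close>, so symmetrisation doubles the variance proxy.\<close>
  have e: "?E (\<lambda>\<omega>. (b*c) * S \<omega>) * ?E (\<lambda>\<omega>. - (b*c) * S \<omega>) \<le> ennreal (exp (c\<^sup>2 * b\<^sup>2 * A))"
  proof -
    have "?E (\<lambda>\<omega>. (b*c) * S \<omega>) * ?E (\<lambda>\<omega>. - (b*c) * S \<omega>)
      \<le> ennreal (exp ((b*c)\<^sup>2 * A / 2)) * ennreal (exp ((- (b*c))\<^sup>2 * A / 2))"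
      by (intro mult_mono sub) auto
    also have "\<dots> = ennreal (exp (c\<^sup>2 * b\<^sup>2 * A))"
      by (simp add: ennreal_mult[symmetric] exp_add[symmetric] power_mult_distrib mult.commute)
    finally show ?thesis .
  qed
  have "2 * (x * y) \<le> 2 * ennreal (exp (c\<^sup>2 * b\<^sup>2 * A))"
    using order_trans[OF two add_mono[OF e e[unfolded mult.commute[of "?E (\<lambda>\<omega>. (b*c) * S \<omega>)"]]]]
    by (simp add: mult_2 mult_2_right mult.commute[of y x])
  then have xy: "x * y \<le> ennreal (exp (c\<^sup>2 * b\<^sup>2 * A))"
    by (subst (asm) ennreal_mult_le_mult_iff) auto
  \<comment> \<open>Jensen for the independent copy: its centred exponential moment is at least
    \<open>1\<close>, so multiplying by it can only increase the centred moment of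
    \<open>h (S \<omega>)\<close>, and the factors \<open>exp (b * m)\<close> cancel.\<close>
  have y1: "1 \<le> y * ennreal (exp (b * m))"
  proof -
    have "ennreal 1 = ennreal (\<integral>\<omega>. 1 + - b * (h (S \<omega>) - m) \<partial>M)"
      using int by (simp add: prob_space m_def)
    also have "\<dots> \<le> (\<integral>\<^sup>+\<omega>. ennreal (1 + - b * (h (S \<omega>) - m)) \<partial>M)"
      using int by (intro ennreal_integral_le_nn_integral) (auto simp: algebra_simps)
    also have "\<dots> \<le> (\<integral>\<^sup>+\<omega>. ennreal (exp (- b * h (S \<omega>))) * ennreal (exp (b * m)) \<partial>M)"
    proof (intro nn_integral_mono)
      fix \<omega>
      have "1 + - b * (h (S \<omega>) - m) \<le> exp (- b * (h (S \<omega>) - m))" by (rule exp_ge_add_one_self)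
      also have "\<dots> = exp (- b * h (S \<omega>)) * exp (b * m)" by (simp add: exp_add[symmetric] algebra_simps)
      finally show "ennreal (1 + - b * (h (S \<omega>) - m)) \<le> ennreal (exp (- b * h (S \<omega>))) * ennreal (exp (b * m))"
        by (simp add: ennreal_mult[symmetric] ennreal_leI)
    qed
    also have "\<dots> = y * ennreal (exp (b * m))" unfolding y_def by (subst nn_integral_multc) auto
    finally show ?thesis by simp
  qed
  have "(\<integral>\<^sup>+\<omega>. exp (b * (h (S \<omega>) - m)) \<partial>M) = (\<integral>\<^sup>+\<omega>. ennreal (exp (b * h (S \<omega>))) * ennreal (exp (- b * m)) \<partial>M)"
    by (intro nn_integral_cong) (simp add: ennreal_mult[symmetric] exp_add[symmetric] algebra_simps)
  also have "\<dots> = x * ennreal (exp (- b * m))" unfolding x_def by (subst nn_integral_multc) auto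
  also have "\<dots> \<le> x * ennreal (exp (- b * m)) * (y * ennreal (exp (b * m)))"
    using mult_left_mono[OF y1, of "x * ennreal (exp (- b * m))"] by simp
  also have "\<dots> = x * y * ennreal (exp (- b * m) * exp (b * m))"
    by (subst ennreal_mult) (auto simp: ac_simps)
  also have "\<dots> = x * y" by (simp add: exp_add[symmetric])
  finally show ?thesis using xy unfolding m_def by (rule order_trans)
qed

section \<open>Sub-Gaussian variables and entropy\<close>

text \<open>The witness direction is \<open>b = t c\<close> with \<open>c\<close> the vector of conditional expectations: Jensen's
  inequality on \<open>E\<close> bounds \<open>exp (t |c|\<^sup>2)\<close> by \<open>exp (v t\<^sup>2 |c|\<^sup>2) / P(E)\<close>, and \<open>t = 1/(2v)\<close> is optimal.\<close>

lemma (in prob_space) subgaussian_conditional_expectation: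
  fixes X :: "'i \<Rightarrow> 'a \<Rightarrow> real"
  assumes Q: "finite Q" and E[measurable]: "E \<in> events" and pE: "0 < prob E"
    and X[measurable]: "\<And>q. q \<in> Q \<Longrightarrow> X q \<in> borel_measurable M"
    and bdd: "\<And>q \<omega>. q \<in> Q \<Longrightarrow> \<bar>X q \<omega>\<bar> \<le> K"
    and v: "0 < v"
    and mgf: "\<And>b. (\<integral>\<^sup>+\<omega>. exp (\<Sum>q\<in>Q. b q * X q \<omega>) \<partial>M) \<le> ennreal (exp (v * (\<Sum>q\<in>Q. (b q)\<^sup>2)))"
  shows "(\<Sum>q\<in>Q. ((\<integral>\<omega>. X q \<omega> * indicator E \<omega> \<partial>M) / prob E)\<^sup>2) \<le> 4 * v * ln (1 / prob E)"
proof -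
  define p where "p = prob E"
  define c where "c q = (\<integral>\<omega>. X q \<omega> * indicator E \<omega> \<partial>M) / p" for q
  define C where "C = (\<Sum>q\<in>Q. (c q)\<^sup>2)"
  define t where "t = 1 / (2 * v)"
  define Z where "Z \<omega> = (\<Sum>q\<in>Q. t * c q * X q \<omega>)" for \<omega>
  have p: "0 < p" using pE by (simp add: p_def)
  have Z[measurable]: "Z \<in> borel_measurable M" unfolding Z_def by measurable
  have K0: "0 \<le> K" if "q \<in> Q" for q
    using bdd[OF that] abs_ge_zero order_trans by blast
  have intX: "integrable M (\<lambda>\<omega>. X q \<omega> * indicator E \<omega>)" if "q \<in> Q" for q
    by (rule integrable_const_bound[where B=K])
       (use that bdd[OF that] K0[OF that] in \<open>auto simp: indicator_def\<close>)
  have ZE: "(\<lambda>\<omega>. Z \<omega> * indicator E \<omega>) = (\<lambda>\<omega>. \<Sum>q\<in>Q. t * c q * (X q \<omega> * indicator E \<omega>))"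
    by (auto simp: Z_def sum_distrib_right mult.assoc)
  have intZ: "integrable M (\<lambda>\<omega>. Z \<omega> * indicator E \<omega>)"
    unfolding ZE using intX by (intro Bochner_Integration.integrable_sum integrable_mult_right) auto
  have EZ: "(\<integral>\<omega>. Z \<omega> * indicator E \<omega> \<partial>M) = t * C * p"
    unfolding ZE using intX p
    by (simp add: C_def c_def sum_distrib_left sum_distrib_right power2_eq_square mult.assoc)
  \<comment> \<open>\<open>1 + (Z - t * C)\<close> is the tangent of \<open>exp (Z - t * C)\<close>
    at \<open>t * C\<close>, the conditional mean of \<open>Z\<close> on \<open>E\<close>. Its
    integral over \<open>E\<close> is exactly \<open>p\<close>, so the tangent bound is Jensen's
    inequality on \<open>E\<close>.\<close>
  have "(\<integral>\<omega>. Z \<omega> * indicator E \<omega> + (1 - t * C) * indicator E \<omega> \<partial>M) = t * C * p + (1 - t * C) * p"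
    by (subst Bochner_Integration.integral_add) (use intZ in \<open>auto simp: EZ p_def emeasure_eq_measure\<close>)
  then have "(\<integral>\<omega>. Z \<omega> * indicator E \<omega> + (1 - t * C) * indicator E \<omega> \<partial>M) = p"
    by (simp add: algebra_simps)
  then have "ennreal (exp (t * C) * p) = ennreal (\<integral>\<omega>. exp (t * C) * (Z \<omega> * indicator E \<omega> + (1 - t * C) * indicator E \<omega>) \<partial>M)"
    by simp
  also have "\<dots> \<le> (\<integral>\<^sup>+\<omega>. ennreal (exp (t * C) * (Z \<omega> * indicator E \<omega> + (1 - t * C) * indicator E \<omega>)) \<partial>M)"
    by (rule ennreal_integral_le_nn_integral) (use intZ in \<open>simp add: emeasure_eq_measure\<close>)
  also have "\<dots> \<le> (\<integral>\<^sup>+\<omega>. ennreal (exp (Z \<omega>)) \<partial>M)"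
  proof (intro nn_integral_mono ennreal_leI)
    fix \<omega>
    have "exp (t * C) * (Z \<omega> + (1 - t * C)) \<le> exp (t * C) * exp (Z \<omega> - t * C)"
      using exp_ge_add_one_self[of "Z \<omega> - t * C"] by (intro mult_left_mono) (linarith, simp)
    also have "\<dots> = exp (Z \<omega>)" by (simp add: exp_add[symmetric])
    finally show "exp (t * C) * (Z \<omega> * indicator E \<omega> + (1 - t * C) * indicator E \<omega>) \<le> exp (Z \<omega>)"
      by (auto simp: indicator_def)
  qed
  also have "\<dots> \<le> ennreal (exp (v * (\<Sum>q\<in>Q. (t * c q)\<^sup>2)))"
    unfolding Z_def by (rule mgf)
  also have "(\<Sum>q\<in>Q. (t * c q)\<^sup>2) = t\<^sup>2 * C"
    by (simp add: C_def sum_distrib_left power_mult_distrib)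
  finally have "exp (t * C) * p \<le> exp (v * (t\<^sup>2 * C))" by (simp add: ennreal_le_iff)
  then have "ln (exp (t * C) * p) \<le> ln (exp (v * (t\<^sup>2 * C)))"
    using p by (subst ln_le_cancel_iff) auto
  then have "t * C + ln p \<le> v * (t\<^sup>2 * C)" using p by (simp add: ln_mult)
  moreover have "v * (t\<^sup>2 * C) = t * C / 2" using v by (simp add: t_def power2_eq_square field_simps)
  moreover have "ln (1 / p) = - ln p" using p by (simp add: ln_div)
  ultimately have "t * C / 2 \<le> ln (1 / p)" by linarith
  then have "C \<le> 4 * v * ln (1 / p)" using v by (simp add: t_def field_simps)
  then show ?thesis by (simp add: C_def c_def p_def)
qed

section \<open>Entropy of messages of variable length\<close>

text \<open>There are \<open>2 ^ l\<close> strings of length \<open>l\<close>, so the length is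
  geometric with ratio \<open>\<rho>\<close> and the string is uniform given its length.\<close>

lemma nn_integral_length_weights:
  assumes \<rho>: "0 < \<rho>" "\<rho> < (1::real)"
  shows "(\<integral>\<^sup>+ y. ennreal ((1 - \<rho>) * (\<rho> / 2) ^ length y) \<partial>count_space (UNIV :: bool list set)) = 1"
proof -
  let ?c = "count_space (UNIV :: bool list set)"
  have "(\<integral>\<^sup>+ y. ennreal ((1 - \<rho>) * (\<rho> / 2) ^ length y) \<partial>?c)
      = (\<integral>\<^sup>+ y. (\<Sum>l. ennreal ((1 - \<rho>) * (\<rho> / 2) ^ l) * indicator {y. length y = l} y) \<partial>?c)"
  proof (intro nn_integral_cong)
    fix y :: "bool list"
    have "(\<Sum>l. ennreal ((1 - \<rho>) * (\<rho> / 2) ^ l) * indicator {y. length y = l} y)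
       = (\<Sum>l\<in>{length y}. ennreal ((1 - \<rho>) * (\<rho> / 2) ^ l) * indicator {y. length y = l} y)"
      by (rule suminf_finite) auto
    then show "ennreal ((1 - \<rho>) * (\<rho> / 2) ^ length y)
        = (\<Sum>l. ennreal ((1 - \<rho>) * (\<rho> / 2) ^ l) * indicator {y. length y = l} y)" by simp
  qed
  also have "\<dots> = (\<Sum>l. \<integral>\<^sup>+ y. ennreal ((1 - \<rho>) * (\<rho> / 2) ^ l) * indicator {y. length y = l} y \<partial>?c)"
    by (rule nn_integral_suminf) auto
  also have "\<dots> = (\<Sum>l. ennreal ((1 - \<rho>) * \<rho> ^ l))"
  proof (intro suminf_cong)
    fix l
    have fin: "finite {y :: bool list. length y = l}" and card: "card {y :: bool list. length y = l} = 2 ^ l"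
      using finite_lists_length_eq[of "UNIV :: bool set" l] card_lists_length_eq[of "UNIV :: bool set" l]
      by (auto simp: card_UNIV_bool)
    have "(\<integral>\<^sup>+ y. ennreal ((1 - \<rho>) * (\<rho> / 2) ^ l) * indicator {y. length y = l} y \<partial>?c)
      = ennreal ((1 - \<rho>) * (\<rho> / 2) ^ l) * ennreal (2 ^ l)"
      using fin card by (simp add: nn_integral_cmult_indicator ennreal_power[symmetric] ennreal_numeral[symmetric] del: ennreal_numeral)
    also have "\<dots> = ennreal ((1 - \<rho>) * \<rho> ^ l)"
      using \<rho> by (subst ennreal_mult[symmetric]) (auto simp: power_divide)
    finally show "(\<integral>\<^sup>+ y. ennreal ((1 - \<rho>) * (\<rho> / 2) ^ l) * indicator {y. length y = l} y \<partial>?c) = ennreal ((1 - \<rho>) * \<rho> ^ l)" .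
  qed
  also have "\<dots> = ennreal (\<Sum>l. (1 - \<rho>) * \<rho> ^ l)"
    using \<rho> by (intro suminf_ennreal2 summable_mult summable_geometric) auto
  also have "(\<Sum>l. (1 - \<rho>) * \<rho> ^ l) = 1"
    using \<rho> by (subst suminf_mult) (auto simp: suminf_geometric intro!: summable_geometric)
  finally show ?thesis by simp
qed

lemma prob_space_countable_eq_density:
  assumes "prob_space \<nu>" and s: "sets \<nu> = sets (count_space (UNIV :: 'c :: countable set))"
  shows "\<nu> = density (count_space UNIV) (\<lambda>y. ennreal (measure \<nu> {y}))"
proof -
  interpret prob_space \<nu> by fact
  show ?thesis
  proof (rule measure_eqI_countable)
    show "sets \<nu> = Pow UNIV" "sets (density (count_space UNIV) (\<lambda>y. ennreal (measure \<nu> {y}))) = Pow UNIV"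
      using s by auto
    show "countable (UNIV :: 'c set)" by simp
    fix a :: 'c
    show "emeasure \<nu> {a} = emeasure (density (count_space UNIV) (\<lambda>y. ennreal (measure \<nu> {y}))) {a}"
      by (simp add: emeasure_density emeasure_eq_measure nn_integral_count_space_indicator[symmetric] nn_integral_count_space_finite)
  qed
qed

text \<open>The code need not be prefix-free. It is compared with the weights \<open>(1 - 1/n) (1/(2n)) ^ length y\<close>,
  rather than with a multiple of \<open>4 ^ (- length y)\<close>, so that the bound stays small when the expected
  length tends to zero.\<close>

lemma entropy_le_expected_length:
  fixes \<nu> :: "bool list measure"
  assumes \<nu>: "prob_space \<nu>" and s[measurable_cong]: "sets \<nu> = sets (count_space UNIV)"
    and len: "(\<integral>\<^sup>+ y. of_nat (length y) \<partial>\<nu>) \<le> ennreal B" and B: "0 \<le> B" and n: "2 \<le> (n::nat)"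
  shows "(\<integral>\<^sup>+ y. ennreal (ln (1 / measure \<nu> {y})) \<partial>\<nu>) \<le> ennreal (B * ln (2 * real n) + 2 / real n)"
proof -
  interpret prob_space \<nu> by fact
  define \<rho> where "\<rho> = 1 / real n"
  have \<rho>: "0 < \<rho>" "\<rho> < 1" using n by (auto simp: \<rho>_def)
  define w where "w y = (1 - \<rho>) * (\<rho> / 2) ^ length y" for y :: "bool list"
  have w: "0 < w y" for y using \<rho> by (simp add: w_def)
  have dens: "(\<integral>\<^sup>+ y. f y \<partial>\<nu>) = (\<integral>\<^sup>+ y. ennreal (measure \<nu> {y}) * f y \<partial>count_space UNIV)" for f
    by (subst prob_space_countable_eq_density[OF \<nu> s], subst nn_integral_density) auto
  have lnw: "ln (1 / w y) \<le> of_nat (length y) * ln (2 * real n) + 2 / real n" for y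
  proof -
    have "ln (1 / w y) = - ln (1 - \<rho>) - real (length y) * ln (\<rho> / 2)"
      using \<rho> w[of y] by (simp add: w_def ln_div ln_mult ln_realpow)
    also have "ln (\<rho> / 2) = - ln (2 * real n)" using n by (simp add: \<rho>_def ln_div ln_mult)
    also have "- ln (1 - \<rho>) \<le> 2 / real n"
    proof -
      have "- ln (1 - \<rho>) = ln (1 / (1 - \<rho>))" using \<rho> by (simp add: ln_div)
      also have "\<dots> \<le> 1 / (1 - \<rho>) - 1" using \<rho> by (intro ln_le_minus_one) auto
      also have "\<dots> \<le> 2 / real n" using n by (simp add: \<rho>_def field_simps)
      finally show ?thesis .
    qed
    finally show ?thesis by simp
  qed
  \<comment> \<open>Gibbs' inequality against the weights, from
    \<open>ln (w / p) \<le> w / p - 1\<close>. The \<open>1\<close> is kept on the left because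
    subtraction in \<open>ennreal\<close> is truncated. Atoms of probability zero carry the factor
    \<open>measure \<nu> {y}\<close>, so the default values of the divisions there are
    harmless.\<close>
  have "(\<integral>\<^sup>+ y. ennreal (ln (1 / measure \<nu> {y})) \<partial>\<nu>) + 1 = (\<integral>\<^sup>+ y. ennreal (ln (1 / measure \<nu> {y})) + 1 \<partial>\<nu>)"
    by (subst nn_integral_add) (auto simp: emeasure_space_1)
  also have "\<dots> \<le> (\<integral>\<^sup>+ y. ennreal (ln (1 / w y)) + ennreal (w y / measure \<nu> {y}) \<partial>\<nu>)"
    unfolding dens
  proof (intro nn_integral_mono)
    fix y
    show "ennreal (measure \<nu> {y}) * (ennreal (ln (1 / measure \<nu> {y})) + 1)
      \<le> ennreal (measure \<nu> {y}) * (ennreal (ln (1 / w y)) + ennreal (w y / measure \<nu> {y}))"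
    proof (cases "measure \<nu> {y} = 0")
      case False
      let ?p = "measure \<nu> {y}"
      have p: "0 < ?p" "?p \<le> 1" using False by (simp_all add: zero_less_measure_iff)
      have w1: "w y \<le> 1" unfolding w_def using \<rho> by (intro mult_le_one power_le_one) auto
      have "ln (w y / ?p) \<le> w y / ?p - 1" using w[of y] p by (intro ln_le_minus_one) auto
      then have "ln (1 / ?p) + 1 \<le> ln (1 / w y) + w y / ?p"
        using w[of y] p by (simp add: ln_div)
      moreover have "0 \<le> ln (1 / ?p)" "0 \<le> ln (1 / w y)" using p w[of y] w1 by simp_all
      ultimately have "ennreal (ln (1 / ?p)) + 1 \<le> ennreal (ln (1 / w y)) + ennreal (w y / ?p)"
        using p w[of y] ennreal_leI[of "ln (1 / ?p) + 1" "ln (1 / w y) + w y / ?p"]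
        by (simp add: ennreal_plus less_imp_le)
      then show ?thesis by (intro mult_left_mono) auto
    qed simp
  qed
  also have "\<dots> = (\<integral>\<^sup>+ y. ennreal (ln (1 / w y)) \<partial>\<nu>) + (\<integral>\<^sup>+ y. ennreal (w y / measure \<nu> {y}) \<partial>\<nu>)"
    by (rule nn_integral_add) auto
  also have "\<dots> \<le> ennreal (B * ln (2 * real n) + 2 / real n) + 1"
  proof (rule add_mono)
    have "(\<integral>\<^sup>+ y. ennreal (ln (1 / w y)) \<partial>\<nu>) \<le> (\<integral>\<^sup>+ y. of_nat (length y) * ennreal (ln (2 * real n)) + ennreal (2 / real n) \<partial>\<nu>)"
    proof (intro nn_integral_mono)
      fix y
      have "ennreal (ln (1 / w y)) \<le> ennreal (of_nat (length y) * ln (2 * real n) + 2 / real n)"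
        by (intro ennreal_leI lnw)
      also have "\<dots> = of_nat (length y) * ennreal (ln (2 * real n)) + ennreal (2 / real n)"
        using n by (subst ennreal_plus) (auto simp: ennreal_mult ennreal_of_nat_eq_real_of_nat)
      finally show "ennreal (ln (1 / w y)) \<le> of_nat (length y) * ennreal (ln (2 * real n)) + ennreal (2 / real n)" .
    qed
    also have "\<dots> = (\<integral>\<^sup>+ y. of_nat (length y) \<partial>\<nu>) * ennreal (ln (2 * real n)) + ennreal (2 / real n)"
      by (subst nn_integral_add) (auto simp: nn_integral_multc emeasure_space_1)
    also have "\<dots> \<le> ennreal B * ennreal (ln (2 * real n)) + ennreal (2 / real n)"
      by (intro add_mono mult_right_mono len) auto
    also have "\<dots> = ennreal (B * ln (2 * real n) + 2 / real n)"
      using B n by (subst ennreal_plus) (auto simp: ennreal_mult)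
    finally show "(\<integral>\<^sup>+ y. ennreal (ln (1 / w y)) \<partial>\<nu>) \<le> ennreal (B * ln (2 * real n) + 2 / real n)" .
    have "(\<integral>\<^sup>+ y. ennreal (w y / measure \<nu> {y}) \<partial>\<nu>) \<le> (\<integral>\<^sup>+ y. ennreal (w y) \<partial>count_space UNIV)"
      unfolding dens
    proof (intro nn_integral_mono)
      fix y
      show "ennreal (measure \<nu> {y}) * ennreal (w y / measure \<nu> {y}) \<le> ennreal (w y)"
        using w[of y] by (subst ennreal_mult[symmetric]) (auto simp: less_imp_le)
    qed
    also have "\<dots> = 1" unfolding w_def by (rule nn_integral_length_weights[OF \<rho>])
    finally show "(\<integral>\<^sup>+ y. ennreal (w y / measure \<nu> {y}) \<partial>\<nu>) \<le> 1" .
  qed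
  finally show ?thesis
    by (simp add: add.commute[of _ 1] ennreal_add_left_cancel_le)
qed

section \<open>The likelihood ratio\<close>

text \<open>The simplifier would turn the index sets \<open>{1..m}\<close> into \<open>{Suc 0..m}\<close>.\<close>

declare One_nat_def[simp del]

abbreviation design_law :: "real measure" where
  "design_law \<equiv> uniform_measure lborel {0<..<1}"

abbreviation noise_law :: "real measure" where
  "noise_law \<equiv> density lborel (\<lambda>x. ennreal (std_normal_density x))"

abbreviation local_law :: "real \<Rightarrow> nat \<Rightarrow> (real \<Rightarrow> real) \<Rightarrow> (nat \<Rightarrow> real \<times> real) measure" where
  "local_law \<sigma> p f \<equiv> \<Pi>\<^sub>M l\<in>{1..p}. obs_law \<sigma> f"

lemma prob_space_design_law: "prob_space design_law"
  by (rule prob_space_uniform_measure) auto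

lemma prob_space_noise_law: "prob_space noise_law"
  by (rule prob_space_normal_density) simp

lemma nn_integral_design_law:
  assumes [measurable]: "g \<in> borel_measurable borel"
  shows "(\<integral>\<^sup>+x. g x \<partial>design_law) = (\<integral>\<^sup>+x\<in>{0..1}. g x \<partial>lborel)"
proof -
  have "AE x in lborel. x \<noteq> 0 \<and> x \<noteq> (1::real)"
    by (intro AE_conjI AE_lborel_singleton)
  then have ae: "AE x in lborel. g x * indicator {0<..<1} x = g x * indicator {0..1} x"
    by eventually_elim (auto simp: indicator_def)
  show ?thesis
    by (simp add: nn_integral_uniform_measure nn_integral_cong_AE[OF ae] divide_ennreal_def)
qed

lemma nn_integral_noise_law_exp: "(\<integral>\<^sup>+x. exp (u * x) \<partial>noise_law) = ennreal (exp (u\<^sup>2 / 2))"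
proof -
  interpret N: prob_space "density lborel (\<lambda>x. ennreal (normal_density u 1 x))"
    by (rule prob_space_normal_density) simp
  have "(\<integral>\<^sup>+x. exp (u * x) \<partial>noise_law) = (\<integral>\<^sup>+x. ennreal (exp (u\<^sup>2 / 2)) * ennreal (normal_density u 1 x) \<partial>lborel)"
    by (subst nn_integral_density)
       (auto intro!: nn_integral_cong simp: ennreal_mult[symmetric] normal_density_def exp_add[symmetric]
          power2_eq_square field_simps)
  also have "\<dots> = ennreal (exp (u\<^sup>2 / 2)) * (\<integral>\<^sup>+x. ennreal (normal_density u 1 x) \<partial>lborel)"
    by (rule nn_integral_cmult) auto
  also have "(\<integral>\<^sup>+x. ennreal (normal_density u 1 x) \<partial>lborel) = 1"
    using N.emeasure_space_1 by (simp add: emeasure_density)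
  finally show ?thesis by simp
qed

text \<open>The Cameron-Martin formula in dimension one, by completing the square. With
  \<open>a = f t / \<sigma>\<close> it is the source of the formula for
  \<open>obs_lr\<close>.\<close>

lemma nn_integral_noise_law_shift:
  assumes [measurable]: "g \<in> borel_measurable borel"
  shows "(\<integral>\<^sup>+x. g (x + a) \<partial>noise_law) = (\<integral>\<^sup>+x. ennreal (exp (a * x - a\<^sup>2 / 2)) * g x \<partial>noise_law)"
proof -
  have sq: "- x\<^sup>2 / 2 + (a * x - a\<^sup>2 / 2) = - (x - a)\<^sup>2 / 2" for x :: real
    by (simp add: power2_eq_square field_simps)
  have dens: "std_normal_density x * exp (a * x - a\<^sup>2 / 2) = std_normal_density (x - a)" for x
    by (simp only: std_normal_density_def mult.assoc exp_add[symmetric] sq)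
  have "(\<integral>\<^sup>+x. ennreal (exp (a * x - a\<^sup>2 / 2)) * g x \<partial>noise_law)
      = (\<integral>\<^sup>+x. ennreal (std_normal_density (x - a)) * g x \<partial>lborel)"
    by (subst nn_integral_density)
       (simp_all add: mult.assoc[symmetric] ennreal_mult[symmetric] dens del: std_normal_density_def)
  also have "\<dots> = (\<integral>\<^sup>+x. ennreal (std_normal_density x) * g (x + a) \<partial>lborel)"
    by (subst nn_integral_real_affine[where c=1 and t=a]) (auto simp: add.commute)
  also have "\<dots> = (\<integral>\<^sup>+x. g (x + a) \<partial>noise_law)"
    by (subst nn_integral_density) auto
  finally show ?thesis ..
qed

lemma measurable_obs_map[measurable]:
  assumes [measurable]: "f \<in> borel_measurable borel"
  shows "(\<lambda>(t, e). (t, f t + \<sigma> * e)) \<in> design_law \<Otimes>\<^sub>M noise_law \<rightarrow>\<^sub>M (borel :: (real \<times> real) measure)"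
  unfolding borel_prod[symmetric] by measurable

lemma sets_obs_law[simp, measurable_cong]: "sets (obs_law \<sigma> f) = sets borel"
  by (simp add: obs_law_def)

lemma prob_space_obs_law:
  assumes "f \<in> borel_measurable borel"
  shows "prob_space (obs_law \<sigma> f)"
  unfolding obs_law_def
  by (intro prob_space.prob_space_distr prob_space_pair prob_space_design_law prob_space_noise_law
        measurable_obs_map assms)

lemma nn_integral_obs_law:
  assumes f[measurable]: "f \<in> borel_measurable borel" and g[measurable]: "g \<in> borel_measurable borel"
  shows "(\<integral>\<^sup>+z. g z \<partial>obs_law \<sigma> f) = (\<integral>\<^sup>+t. \<integral>\<^sup>+e. g (t, f t + \<sigma> * e) \<partial>noise_law \<partial>design_law)"
proof -
  have g': "g \<in> borel_measurable (borel \<Otimes>\<^sub>M borel)" unfolding borel_prod by (rule g)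
  note [measurable] = g'
  have "(\<integral>\<^sup>+z. g z \<partial>obs_law \<sigma> f) = (\<integral>\<^sup>+z. g (case z of (t, e) \<Rightarrow> (t, f t + \<sigma> * e)) \<partial>(design_law \<Otimes>\<^sub>M noise_law))"
    unfolding obs_law_def by (rule nn_integral_distr) measurable
  also have "\<dots> = (\<integral>\<^sup>+t. \<integral>\<^sup>+e. g (case (t, e) of (t, e) \<Rightarrow> (t, f t + \<sigma> * e)) \<partial>noise_law \<partial>design_law)"
    by (rule sigma_finite_measure.nn_integral_fst[OF prob_space_imp_sigma_finite[OF prob_space_noise_law], symmetric])
       measurable
  finally show ?thesis by simp
qed

text \<open>Density at \<open>snd z\<close> of the normal law with mean \<open>f (fst z)\<close> and
  variance \<open>\<sigma>\<^sup>2\<close> relative to the one with mean zero; the law of the design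
  is common to both and cancels.\<close>

definition obs_lr :: "real \<Rightarrow> (real \<Rightarrow> real) \<Rightarrow> real \<times> real \<Rightarrow> real" where
  "obs_lr \<sigma> f z = exp (f (fst z) * snd z / \<sigma>\<^sup>2 - (f (fst z))\<^sup>2 / (2 * \<sigma>\<^sup>2))"

lemma measurable_obs_lr[measurable]:
  assumes [measurable]: "f \<in> borel_measurable borel"
  shows "obs_lr \<sigma> f \<in> borel_measurable borel"
proof -
  have "obs_lr \<sigma> f \<in> borel_measurable (borel \<Otimes>\<^sub>M borel)"
    unfolding obs_lr_def by measurable
  then show ?thesis unfolding borel_prod .
qed

lemma obs_law_density:
  assumes \<sigma>: "0 < \<sigma>" and f[measurable]: "f \<in> borel_measurable borel"
  shows "obs_law \<sigma> f = density (obs_law \<sigma> (\<lambda>_. 0)) (\<lambda>z. ennreal (obs_lr \<sigma> f z))"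
proof (rule measure_eqI)
  fix C assume C: "C \<in> sets (obs_law \<sigma> f)"
  then have C[measurable]: "C \<in> sets borel" by simp
  then have [measurable]: "C \<in> sets (borel \<Otimes>\<^sub>M borel)" unfolding borel_prod .
  have "emeasure (obs_law \<sigma> f) C = (\<integral>\<^sup>+z. indicator C z \<partial>obs_law \<sigma> f)" by simp
  also have "\<dots> = (\<integral>\<^sup>+t. \<integral>\<^sup>+e. indicator C (t, f t + \<sigma> * e) \<partial>noise_law \<partial>design_law)"
    by (rule nn_integral_obs_law) auto
  also have "\<dots> = (\<integral>\<^sup>+t. \<integral>\<^sup>+e. ennreal (obs_lr \<sigma> f (t, 0 + \<sigma> * e)) * indicator C (t, 0 + \<sigma> * e) \<partial>noise_law \<partial>design_law)"
  proof (rule nn_integral_cong)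
    fix t
    have [measurable]: "(\<lambda>e. indicator C (t, \<sigma> * e) :: ennreal) \<in> borel_measurable borel"
      by measurable
    have "(\<integral>\<^sup>+e. indicator C (t, f t + \<sigma> * e) \<partial>noise_law) = (\<integral>\<^sup>+e. indicator C (t, \<sigma> * (e + f t / \<sigma>)) \<partial>noise_law)"
      using \<sigma> by (simp add: algebra_simps)
    also have "\<dots> = (\<integral>\<^sup>+e. ennreal (exp (f t / \<sigma> * e - (f t / \<sigma>)\<^sup>2 / 2)) * indicator C (t, \<sigma> * e) \<partial>noise_law)"
      by (rule nn_integral_noise_law_shift) measurable
    also have "\<dots> = (\<integral>\<^sup>+e. ennreal (obs_lr \<sigma> f (t, 0 + \<sigma> * e)) * indicator C (t, 0 + \<sigma> * e) \<partial>noise_law)"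
      using \<sigma> by (simp add: obs_lr_def power2_eq_square mult.commute mult.left_commute)
    finally show "(\<integral>\<^sup>+e. indicator C (t, f t + \<sigma> * e) \<partial>noise_law)
      = (\<integral>\<^sup>+e. ennreal (obs_lr \<sigma> f (t, 0 + \<sigma> * e)) * indicator C (t, 0 + \<sigma> * e) \<partial>noise_law)" .
  qed
  also have "\<dots> = (\<integral>\<^sup>+z. ennreal (obs_lr \<sigma> f z) * indicator C z \<partial>obs_law \<sigma> (\<lambda>_. 0))"
    by (rule nn_integral_obs_law[symmetric]) auto
  also have "\<dots> = emeasure (density (obs_law \<sigma> (\<lambda>_. 0)) (\<lambda>z. ennreal (obs_lr \<sigma> f z))) C"
    by (rule emeasure_density[symmetric]) auto
  finally show "emeasure (obs_law \<sigma> f) C = emeasure (density (obs_law \<sigma> (\<lambda>_. 0)) (\<lambda>z. ennreal (obs_lr \<sigma> f z))) C" .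
qed simp

definition local_lr :: "real \<Rightarrow> nat \<Rightarrow> (real \<Rightarrow> real) \<Rightarrow> (nat \<Rightarrow> real \<times> real) \<Rightarrow> real" where
  "local_lr \<sigma> p f d = (\<Prod>l\<in>{1..p}. obs_lr \<sigma> f (d l))"

lemma local_lr_nonneg: "0 \<le> local_lr \<sigma> p f d"
  by (auto simp: local_lr_def obs_lr_def intro!: prod_nonneg)

lemma measurable_local_lr[measurable]:
  assumes [measurable]: "f \<in> borel_measurable borel"
  shows "local_lr \<sigma> p f \<in> borel_measurable (\<Pi>\<^sub>M l\<in>{1..p}. borel)"
  unfolding local_lr_def by measurable

lemma sets_local_law[measurable_cong]: "sets (local_law \<sigma> p f) = sets (\<Pi>\<^sub>M l\<in>{1..p}. borel)"
  by (rule sets_PiM_cong) auto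

lemma prob_space_local_law:
  "f \<in> borel_measurable borel \<Longrightarrow> prob_space (local_law \<sigma> p f)"
  by (intro prob_space_PiM prob_space_obs_law)

lemma local_law_density:
  assumes \<sigma>: "0 < \<sigma>" and f[measurable]: "f \<in> borel_measurable borel"
  shows "local_law \<sigma> p f = density (local_law \<sigma> p (\<lambda>_. 0)) (\<lambda>d. ennreal (local_lr \<sigma> p f d))"
proof -
  have "local_law \<sigma> p f = PiM {1..p} (\<lambda>_. density (obs_law \<sigma> (\<lambda>_. 0)) (\<lambda>z. ennreal (obs_lr \<sigma> f z)))"
    by (subst obs_law_density[OF assms]) simp
  also have "\<dots> = density (local_law \<sigma> p (\<lambda>_. 0)) (\<lambda>d. \<Prod>l\<in>{1..p}. ennreal (obs_lr \<sigma> f (d l)))"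
    by (rule PiM_density) (auto simp: prob_space_obs_law obs_law_density[OF assms, symmetric])
  also have "(\<lambda>d. \<Prod>l\<in>{1..p}. ennreal (obs_lr \<sigma> f (d l))) = (\<lambda>d. ennreal (local_lr \<sigma> p f d))"
    unfolding local_lr_def by (intro ext prod_ennreal) (simp add: obs_lr_def)
  finally show ?thesis .
qed

lemma joint_law_density:
  assumes \<sigma>: "0 < \<sigma>" and f[measurable]: "f \<in> borel_measurable borel"
  shows "joint_law \<sigma> n m f = density (joint_law \<sigma> n m (\<lambda>_. 0)) (\<lambda>D. ennreal (\<Prod>i\<in>{1..m}. local_lr \<sigma> (n div m) f (D i)))"
proof -
  let ?p = "n div m"
  have "joint_law \<sigma> n m f = PiM {1..m} (\<lambda>_. density (local_law \<sigma> ?p (\<lambda>_. 0)) (\<lambda>d. ennreal (local_lr \<sigma> ?p f d)))"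
    unfolding joint_law_def by (subst local_law_density[OF assms]) simp
  also have "\<dots> = density (joint_law \<sigma> n m (\<lambda>_. 0)) (\<lambda>D. \<Prod>i\<in>{1..m}. ennreal (local_lr \<sigma> ?p f (D i)))"
    unfolding joint_law_def
    by (rule PiM_density)
       (simp_all add: prob_space_local_law local_law_density[OF assms, symmetric] measurable_local_lr)
  also have "(\<lambda>D. \<Prod>i\<in>{1..m}. ennreal (local_lr \<sigma> ?p f (D i))) = (\<lambda>D. ennreal (\<Prod>i\<in>{1..m}. local_lr \<sigma> ?p f (D i)))"
    by (intro ext prod_ennreal) (simp add: local_lr_nonneg)
  finally show ?thesis .
qed

section \<open>Integrating out the noise for a fixed design\<close>

text \<open>Under the null the response is \<open>\<sigma> * e\<close>, so null data are a design
  sample together with an independent noise sample. What is said below about the conditional law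
  given the design is a statement about the inner integral.\<close>

lemma nn_integral_local_law:
  assumes F[measurable]: "F \<in> borel_measurable (\<Pi>\<^sub>M l\<in>{1..p}. borel)"
  shows "(\<integral>\<^sup>+d. F d \<partial>local_law \<sigma> p (\<lambda>_. 0))
    = (\<integral>\<^sup>+t. \<integral>\<^sup>+e. F (\<lambda>l\<in>{1..p}. (t l, \<sigma> * e l)) \<partial>PiM {1..p} (\<lambda>_. noise_law) \<partial>PiM {1..p} (\<lambda>_. design_law))"
proof -
  let ?I = "{1..p}" and ?T = "PiM {1..p} (\<lambda>_. design_law)" and ?E = "PiM {1..p} (\<lambda>_. noise_law)"
  let ?h = "\<lambda>z :: real \<times> real. (fst z, \<sigma> * snd z)"
  have h[measurable]: "?h \<in> design_law \<Otimes>\<^sub>M noise_law \<rightarrow>\<^sub>M borel"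
    unfolding borel_prod[symmetric] by measurable
  have z[measurable]: "(\<lambda>z. \<lambda>l\<in>?I. (fst z l, snd z l)) \<in> ?T \<Otimes>\<^sub>M ?E \<rightarrow>\<^sub>M PiM ?I (\<lambda>_. design_law \<Otimes>\<^sub>M noise_law)"
    by measurable
  have hh[measurable]: "(\<lambda>x. \<lambda>l\<in>?I. ?h (x l)) \<in> PiM ?I (\<lambda>_. design_law \<Otimes>\<^sub>M noise_law) \<rightarrow>\<^sub>M (\<Pi>\<^sub>M l\<in>?I. borel)"
    by measurable
  have PE: "prob_space ?E" by (intro prob_space_PiM prob_space_noise_law)
  have "obs_law \<sigma> (\<lambda>_. 0) = distr (design_law \<Otimes>\<^sub>M noise_law) borel ?h"
    unfolding obs_law_def by (intro distr_cong) auto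
  then have "local_law \<sigma> p (\<lambda>_. 0) = distr (PiM ?I (\<lambda>_. design_law \<Otimes>\<^sub>M noise_law)) (\<Pi>\<^sub>M l\<in>?I. borel) (\<lambda>x. \<lambda>l\<in>?I. ?h (x l))"
    by (simp add: distr_PiM_map[symmetric] prob_space_pair prob_space_design_law prob_space_noise_law)
  also have "PiM ?I (\<lambda>_. design_law \<Otimes>\<^sub>M noise_law)
      = distr (?T \<Otimes>\<^sub>M ?E) (PiM ?I (\<lambda>_. design_law \<Otimes>\<^sub>M noise_law)) (\<lambda>z. \<lambda>l\<in>?I. (fst z l, snd z l))"
    by (rule distr_PiM_zip[symmetric]) (auto simp: prob_space_design_law prob_space_noise_law)
  finally have "(\<integral>\<^sup>+d. F d \<partial>local_law \<sigma> p (\<lambda>_. 0))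
      = (\<integral>\<^sup>+d. F d \<partial>distr (distr (?T \<Otimes>\<^sub>M ?E) (PiM ?I (\<lambda>_. design_law \<Otimes>\<^sub>M noise_law))
           (\<lambda>z. \<lambda>l\<in>?I. (fst z l, snd z l))) (\<Pi>\<^sub>M l\<in>?I. borel) (\<lambda>x. \<lambda>l\<in>?I. ?h (x l)))"
    by (rule arg_cong)
  also have "\<dots> = (\<integral>\<^sup>+x. F (\<lambda>l\<in>?I. ?h (x l)) \<partial>distr (?T \<Otimes>\<^sub>M ?E) (PiM ?I (\<lambda>_. design_law \<Otimes>\<^sub>M noise_law))
           (\<lambda>z. \<lambda>l\<in>?I. (fst z l, snd z l)))"
    by (rule nn_integral_distr) (use hh F in simp_all)
  also have "\<dots> = (\<integral>\<^sup>+z. F (\<lambda>l\<in>?I. ?h ((\<lambda>l\<in>?I. (fst z l, snd z l)) l)) \<partial>(?T \<Otimes>\<^sub>M ?E))"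
    by (rule nn_integral_distr[OF z]) (use measurable_compose[OF hh F] in simp)
  also have "\<dots> = (\<integral>\<^sup>+z. F (\<lambda>l\<in>?I. (fst z l, \<sigma> * snd z l)) \<partial>(?T \<Otimes>\<^sub>M ?E))"
    by (intro nn_integral_cong arg_cong[where f=F]) auto
  also have "\<dots> = (\<integral>\<^sup>+t. \<integral>\<^sup>+e. F (\<lambda>l\<in>?I. (fst (t, e) l, \<sigma> * snd (t, e) l)) \<partial>?E \<partial>?T)"
  proof (rule sigma_finite_measure.nn_integral_fst[OF prob_space_imp_sigma_finite[OF PE], symmetric])
    have "(\<lambda>z. \<lambda>l\<in>?I. (fst z l, \<sigma> * snd z l)) \<in> ?T \<Otimes>\<^sub>M ?E \<rightarrow>\<^sub>M (\<Pi>\<^sub>M l\<in>?I. borel)"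
      unfolding borel_prod[symmetric] by measurable
    from measurable_compose[OF this F]
    show "(\<lambda>z. F (\<lambda>l\<in>?I. (fst z l, \<sigma> * snd z l))) \<in> borel_measurable (?T \<Otimes>\<^sub>M ?E)" .
  qed
  finally show ?thesis by simp
qed

lemma nn_integral_PiM_noise_exp:
  fixes c :: "nat \<Rightarrow> real"
  shows   "(\<integral>\<^sup>+e. exp (u * (\<Sum>l\<in>{1..p}. c l * e l)) \<partial>PiM {1..p} (\<lambda>_. noise_law))
    = ennreal (exp (u\<^sup>2 * (\<Sum>l\<in>{1..p}. (c l)\<^sup>2) / 2))"
proof -
  interpret product_prob_space "\<lambda>_::nat. noise_law" by (intro product_prob_spaceI prob_space_noise_law)
  have "exp (u * (\<Sum>l\<in>{1..p}. c l * e l)) = (\<Prod>l\<in>{1..p}. exp ((u * c l) * e l))" for e :: "nat \<Rightarrow> real"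
    by (subst exp_sum[symmetric]) (simp_all add: sum_distrib_left mult.assoc)
  then have "(\<integral>\<^sup>+e. exp (u * (\<Sum>l\<in>{1..p}. c l * e l)) \<partial>PiM {1..p} (\<lambda>_. noise_law))
    = (\<integral>\<^sup>+e. (\<Prod>l\<in>{1..p}. ennreal (exp ((u * c l) * e l))) \<partial>PiM {1..p} (\<lambda>_. noise_law))"
    by (simp add: prod_ennreal)
  also have "\<dots> = (\<Prod>l\<in>{1..p}. \<integral>\<^sup>+e. ennreal (exp ((u * c l) * e)) \<partial>noise_law)"
    by (rule product_nn_integral_prod) auto
  also have "\<dots> = (\<Prod>l\<in>{1..p}. ennreal (exp ((u * c l)\<^sup>2 / 2)))"
    by (simp only: nn_integral_noise_law_exp)
  also have "\<dots> = ennreal (exp (u\<^sup>2 * (\<Sum>l\<in>{1..p}. (c l)\<^sup>2) / 2))"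
    by (simp add: prod_ennreal exp_sum[symmetric] power_mult_distrib sum_distrib_left sum_divide_distrib)
  finally show ?thesis .
qed

text \<open>For \<open>c q l = f q (t l) / \<sigma>\<close> the linear forms are the scores of the
  bumps given the design. Disjoint bumps meet disjoint sets \<open>K q\<close> of design points, and
  functions of disjoint blocks of independent coordinates are independent. Disjointness is phrased
  through vanishing products, the form in which the bumps supply it.\<close>

lemma nn_integral_PiM_disjoint_blocks:
  fixes c :: "'q \<Rightarrow> nat \<Rightarrow> real" and F :: "'q \<Rightarrow> real \<Rightarrow> ennreal"
  assumes N: "prob_space N" and sN[measurable_cong]: "sets N = sets borel" and p: "0 < p" and Q: "finite Q"
    and disj: "\<And>q q' l. q \<in> Q \<Longrightarrow> q' \<in> Q \<Longrightarrow> q \<noteq> q' \<Longrightarrow> c q l * c q' l = 0"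
    and F[measurable]: "\<And>q. q \<in> Q \<Longrightarrow> F q \<in> borel_measurable borel"
  shows "(\<integral>\<^sup>+e. (\<Prod>q\<in>Q. F q (\<Sum>l\<in>{1..p}. c q l * e l)) \<partial>PiM {1..p} (\<lambda>_. N))
    = (\<Prod>q\<in>Q. \<integral>\<^sup>+e. F q (\<Sum>l\<in>{1..p}. c q l * e l) \<partial>PiM {1..p} (\<lambda>_. N))"
proof -
  let ?P = "PiM {1..p} (\<lambda>_. N)"
  interpret P: prob_space ?P by (intro prob_space_PiM N)
  define K where "K q = {l\<in>{1..p}. c q l \<noteq> 0}" for q
  \<comment> \<open>The criterion for independence by which the coordinates are treated asks for a
    nonempty index set; here \<open>0 < p\<close> enters.\<close>
  have ne: "{1..p} \<noteq> {}" using p by auto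
  have "P.indep_vars (\<lambda>_. N) (\<lambda>l e. e l) {1..p}"
  proof (subst P.indep_vars_iff_distr_eq_PiM'[OF ne])
    have "distr ?P ?P (\<lambda>x. \<lambda>i\<in>{1..p}. x i) = distr ?P ?P (\<lambda>x. x)"
      by (intro distr_cong) (auto simp: space_PiM PiE_iff extensional_restrict)
    also have "\<dots> = ?P" by simp
    also have "\<dots> = PiM {1..p} (\<lambda>i. distr ?P N (\<lambda>x. x i))"
      by (intro PiM_cong refl distr_PiM_component[symmetric]) (auto simp: N)
    finally show "distr ?P ?P (\<lambda>x. \<lambda>i\<in>{1..p}. x i) = PiM {1..p} (\<lambda>i. distr ?P N (\<lambda>x. x i))" .
  qed auto
  then have "P.indep_vars (\<lambda>q. PiM (K q) (\<lambda>_. N)) (\<lambda>q e. restrict (\<lambda>i. e i) (K q)) Q"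
  proof (rule P.indep_vars_restrict)
    show "disjoint_family_on K Q"
      unfolding disjoint_family_on_def
    proof (intro ballI impI)
      fix q q' assume "q \<in> Q" "q' \<in> Q" "q \<noteq> q'"
      from disj[OF this] show "K q \<inter> K q' = {}" by (auto simp: K_def)
    qed
  qed (auto simp: K_def)
  then have "P.indep_vars (\<lambda>_. borel) (\<lambda>q e. F q (\<Sum>l\<in>K q. c q l * (restrict (\<lambda>i. e i) (K q)) l)) Q"
    by (rule P.indep_vars_compose2) measurable
  then have "(\<integral>\<^sup>+e. (\<Prod>q\<in>Q. F q (\<Sum>l\<in>K q. c q l * (restrict (\<lambda>i. e i) (K q)) l)) \<partial>?P)
      = (\<Prod>q\<in>Q. \<integral>\<^sup>+e. F q (\<Sum>l\<in>K q. c q l * (restrict (\<lambda>i. e i) (K q)) l) \<partial>?P)"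
    by (intro P.indep_vars_nn_integral Q) auto
  moreover have "(\<Sum>l\<in>K q. c q l * (restrict (\<lambda>i. e i) (K q)) l) = (\<Sum>l\<in>{1..p}. c q l * e l)" for q and e :: "nat \<Rightarrow> real"
    by (rule sum.mono_neutral_cong_left) (auto simp: K_def)
  ultimately show ?thesis by simp
qed

section \<open>Capped likelihood ratios\<close>

text \<open>The variance of the score under the null, given the design; the log likelihood ratio is
  the score minus half of this variance.\<close>

definition design_energy :: "real \<Rightarrow> nat \<Rightarrow> (real \<Rightarrow> real) \<Rightarrow> (nat \<Rightarrow> real) \<Rightarrow> real" where
  "design_energy \<sigma> p f t = (\<Sum>l\<in>{1..p}. (f (t l) / \<sigma>)\<^sup>2)"

text \<open>Restricted, so that it is literally a point of the product space of designs, as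
  \<open>design_zip\<close> requires.\<close>

definition design :: "nat \<Rightarrow> (nat \<Rightarrow> real \<times> real) \<Rightarrow> nat \<Rightarrow> real" where
  "design p d = (\<lambda>l\<in>{1..p}. fst (d l))"

definition score :: "real \<Rightarrow> nat \<Rightarrow> (real \<Rightarrow> real) \<Rightarrow> (nat \<Rightarrow> real \<times> real) \<Rightarrow> real" where
  "score \<sigma> p f d = (\<Sum>l\<in>{1..p}. f (fst (d l)) * snd (d l) / \<sigma>\<^sup>2)"

text \<open>Only the score is capped. For nonnegative \<open>A\<close> the exponent stays at most
  \<open>1\<close>, so the values and the Lipschitz constant in \<open>x\<close> are both at most
  \<open>exp 1\<close>.\<close>

definition capped_lr :: "real \<Rightarrow> real \<Rightarrow> real" where
  "capped_lr A x = exp (min x 1 - A / 2)"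

definition capped_mean :: "real \<Rightarrow> nat \<Rightarrow> (real \<Rightarrow> real) \<Rightarrow> (nat \<Rightarrow> real) \<Rightarrow> real" where
  "capped_mean \<sigma> p f t =
     (\<integral>e. capped_lr (design_energy \<sigma> p f t) (\<Sum>l\<in>{1..p}. f (t l) / \<sigma> * e l) \<partial>PiM {1..p} (\<lambda>_. noise_law))"

text \<open>The density \<open>1 + capped_dev\<close> replaces the likelihood ratio \<open>exp (S - A / 2)\<close>. Capping \<open>S\<close> at \<open>1\<close>
  makes it a Lipschitz function of the Gaussian variable \<open>S\<close>, and adding the lost mass back
  uniformly keeps the conditional mean given the design equal to \<open>1\<close>.\<close>

definition capped_dev :: "real \<Rightarrow> nat \<Rightarrow> real \<Rightarrow> (real \<Rightarrow> real) \<Rightarrow> (nat \<Rightarrow> real \<times> real) \<Rightarrow> real" where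
  "capped_dev \<sigma> p a f d =
     (if design_energy \<sigma> p f (design p d) \<le> a
      then capped_lr (design_energy \<sigma> p f (design p d)) (score \<sigma> p f d) - capped_mean \<sigma> p f (design p d)
      else 0)"

lemma local_lr_eq_exp: "local_lr \<sigma> p f d = exp (score \<sigma> p f d - design_energy \<sigma> p f (design p d) / 2)"
  unfolding local_lr_def obs_lr_def score_def design_energy_def design_def
  by (subst exp_sum[symmetric])
     (simp_all add: sum_subtractf sum_divide_distrib power_divide mult.commute)

lemma measurable_design[measurable]: "design p \<in> (\<Pi>\<^sub>M l\<in>{1..p}. borel) \<rightarrow>\<^sub>M (\<Pi>\<^sub>M l\<in>{1..p}. borel)"
  unfolding design_def borel_prod[symmetric] by measurable

lemma measurable_design_energy[measurable]:
  assumes [measurable]: "f \<in> borel_measurable borel"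
  shows "design_energy \<sigma> p f \<in> borel_measurable (\<Pi>\<^sub>M l\<in>{1..p}. borel)"
  unfolding design_energy_def by measurable

lemma measurable_score[measurable]:
  assumes [measurable]: "f \<in> borel_measurable borel"
  shows "score \<sigma> p f \<in> borel_measurable (\<Pi>\<^sub>M l\<in>{1..p}. borel)"
  unfolding score_def borel_prod[symmetric] by measurable

lemma measurable_capped_lr[measurable (raw)]:
  assumes [measurable]: "A \<in> borel_measurable M" "x \<in> borel_measurable M"
  shows "(\<lambda>z. capped_lr (A z) (x z)) \<in> borel_measurable M"
  unfolding capped_lr_def by measurable

lemma prob_space_PiM_noise: "prob_space (PiM I (\<lambda>_. noise_law))"
  by (intro prob_space_PiM prob_space_noise_law)

lemma prob_space_PiM_design: "prob_space (PiM I (\<lambda>_. design_law))"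
  by (intro prob_space_PiM prob_space_design_law)

lemma measurable_capped_mean[measurable]:
  assumes f[measurable]: "f \<in> borel_measurable borel"
  shows "capped_mean \<sigma> p f \<in> borel_measurable (\<Pi>\<^sub>M l\<in>{1..p}. borel)"
proof -
  interpret prob_space "PiM {1..p} (\<lambda>_. noise_law)" by (rule prob_space_PiM_noise)
  have [measurable]: "(\<lambda>x. fst x) \<in> (\<Pi>\<^sub>M l\<in>{1..p}. borel) \<Otimes>\<^sub>M PiM {1..p} (\<lambda>_. noise_law) \<rightarrow>\<^sub>M (\<Pi>\<^sub>M l\<in>{1..p}. borel :: real measure)"
    by measurable
  show ?thesis
    unfolding capped_mean_def by measurable
qed

lemma measurable_capped_dev[measurable]:
  assumes [measurable]: "f \<in> borel_measurable borel"
  shows "capped_dev \<sigma> p a f \<in> borel_measurable (\<Pi>\<^sub>M l\<in>{1..p}. borel)"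
  unfolding capped_dev_def by measurable

lemma design_energy_nonneg: "0 \<le> design_energy \<sigma> p f t"
  unfolding design_energy_def by (intro sum_nonneg) auto

lemma capped_lr_bounds:
  assumes "0 \<le> A"
  shows "0 \<le> capped_lr A x" "capped_lr A x \<le> exp 1"
  using assms by (auto simp: capped_lr_def)

lemma capped_lr_lipschitz:
  assumes "0 \<le> A"
  shows "\<bar>capped_lr A x - capped_lr A y\<bar> \<le> exp 1 * \<bar>x - y\<bar>"
proof -
  have aux: "exp u - exp v \<le> exp 1 * (u - v)" if "v \<le> u" "u \<le> 1" for u v :: real
  proof -
    have "exp u * (1 + (v - u)) \<le> exp u * exp (v - u)"
      by (intro mult_left_mono exp_ge_add_one_self) auto
    also have "\<dots> = exp v" by (simp add: exp_add[symmetric])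
    finally have "exp u - exp v \<le> exp u * (u - v)" by (simp add: algebra_simps)
    also have "\<dots> \<le> exp 1 * (u - v)" using that by (intro mult_right_mono) auto
    finally show ?thesis .
  qed
  have main: "capped_lr A x - capped_lr A y \<le> exp 1 * (x - y)" if "y \<le> x" for x y
  proof -
    have "capped_lr A x - capped_lr A y \<le> exp 1 * (min x 1 - min y 1)"
      using aux[of "min y 1 - A / 2" "min x 1 - A / 2"] that assms by (simp add: capped_lr_def)
    also have "\<dots> \<le> exp 1 * (x - y)" using that by (intro mult_left_mono) auto
    finally show ?thesis .
  qed
  have mono: "capped_lr A y \<le> capped_lr A x" if "y \<le> x" for x y
    using that by (auto simp: capped_lr_def)
  show ?thesis
    using main[of x y] main[of y x] mono[of x y] mono[of y x] by (cases "x \<le> y") (auto simp: abs_if)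
qed

lemma integrable_capped_lr:
  assumes "0 \<le> A"
  shows "integrable (PiM {1..p} (\<lambda>_. noise_law)) (\<lambda>e. capped_lr A (\<Sum>l\<in>{1..p}. c l * e l))"
proof -
  interpret prob_space "PiM {1..p} (\<lambda>_. noise_law)" by (rule prob_space_PiM_noise)
  show ?thesis
    by (rule integrable_const_bound[where B="exp 1"]) (auto simp: capped_lr_bounds[OF assms])
qed

text \<open>Capping only lowers \<open>exp (S - A / 2)\<close>, whose mean over the noise is
  \<open>1\<close>. The upper bound makes the mass that \<open>capped_dev\<close> adds back
  nonnegative.\<close>

lemma capped_mean_bounds: "0 \<le> capped_mean \<sigma> p f t" "capped_mean \<sigma> p f t \<le> 1"
proof -
  let ?P = "PiM {1..p} (\<lambda>_. noise_law)" and ?A = "design_energy \<sigma> p f t"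
  let ?S = "\<lambda>e. \<Sum>l\<in>{1..p}. f (t l) / \<sigma> * e l"
  show "0 \<le> capped_mean \<sigma> p f t"
    unfolding capped_mean_def by (intro integral_nonneg_AE) (auto simp: capped_lr_bounds design_energy_nonneg)
  have "ennreal (capped_mean \<sigma> p f t) \<le> (\<integral>\<^sup>+e. ennreal (capped_lr ?A (?S e)) \<partial>?P)"
    unfolding capped_mean_def
    by (intro ennreal_integral_le_nn_integral integrable_capped_lr design_energy_nonneg)
  also have "\<dots> \<le> (\<integral>\<^sup>+e. ennreal (exp (- ?A / 2)) * ennreal (exp (1 * ?S e)) \<partial>?P)"
    by (intro nn_integral_mono) (auto simp: capped_lr_def ennreal_mult[symmetric] exp_add[symmetric] intro!: ennreal_leI)
  also have "\<dots> = ennreal (exp (- ?A / 2)) * ennreal (exp (1\<^sup>2 * ?A / 2))"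
    by (subst nn_integral_cmult) (simp_all only: nn_integral_PiM_noise_exp design_energy_def, measurable)
  also have "\<dots> = 1" by (simp add: ennreal_mult[symmetric] exp_add[symmetric])
  finally show "capped_mean \<sigma> p f t \<le> 1" by simp
qed

lemma capped_dev_bounds: "\<bar>capped_dev \<sigma> p a f d\<bar> \<le> exp 1" "0 \<le> 1 + capped_dev \<sigma> p a f d"
proof -
  let ?A = "design_energy \<sigma> p f (design p d)"
  have "0 \<le> capped_lr ?A (score \<sigma> p f d)" "capped_lr ?A (score \<sigma> p f d) \<le> exp 1"
    by (auto simp: capped_lr_bounds design_energy_nonneg)
  moreover have "(1::real) \<le> exp 1" by simp
  ultimately show "\<bar>capped_dev \<sigma> p a f d\<bar> \<le> exp 1" "0 \<le> 1 + capped_dev \<sigma> p a f d"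
    using capped_mean_bounds[of \<sigma> p f "design p d"] by (auto simp: capped_dev_def simp del: one_le_exp_iff)
qed

text \<open>On this event the cap is inactive and the mass \<open>1 - capped_mean\<close> added back
  is nonnegative. Domination suffices, since probabilities under an alternative only have to be
  bounded from above.\<close>

lemma local_lr_le_capped:
  assumes "design_energy \<sigma> p f (design p d) \<le> a" "score \<sigma> p f d \<le> 1"
  shows "local_lr \<sigma> p f d \<le> 1 + capped_dev \<sigma> p a f d"
  using assms capped_mean_bounds[of \<sigma> p f "design p d"]
  by (simp add: local_lr_eq_exp capped_dev_def capped_lr_def)

lemma design_zip:
  assumes "t \<in> space (PiM {1..p} (\<lambda>_. design_law))"
  shows "design p (\<lambda>l\<in>{1..p}. (t l, \<sigma> * e l)) = t"
  using assms by (auto simp: design_def space_PiM PiE_iff extensional_def)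

lemma score_zip: "\<sigma> \<noteq> 0 \<Longrightarrow> score \<sigma> p f (\<lambda>l\<in>{1..p}. (t l, \<sigma> * e l)) = (\<Sum>l\<in>{1..p}. f (t l) / \<sigma> * e l)"
  unfolding score_def by (intro sum.cong) (auto simp: power2_eq_square)

text \<open>Centring by \<open>capped_mean\<close> gives mean \<open>1\<close> for each design of
  small energy separately, and a design of large energy gets the constant density
  \<open>1\<close>.\<close>

lemma nn_integral_capped_density:
  assumes \<sigma>: "\<sigma> \<noteq> 0" and f[measurable]: "f \<in> borel_measurable borel"
  shows "(\<integral>\<^sup>+d. ennreal (1 + capped_dev \<sigma> p a f d) \<partial>local_law \<sigma> p (\<lambda>_. 0)) = 1"
proof -
  let ?P = "PiM {1..p} (\<lambda>_. noise_law)" and ?T = "PiM {1..p} (\<lambda>_. design_law)"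
  let ?z = "\<lambda>t e. \<lambda>l\<in>{1..p}. (t l, \<sigma> * e l)"
  interpret P: prob_space ?P by (rule prob_space_PiM_noise)
  interpret T: prob_space ?T by (rule prob_space_PiM_design)
  have "(\<integral>\<^sup>+d. ennreal (1 + capped_dev \<sigma> p a f d) \<partial>local_law \<sigma> p (\<lambda>_. 0))
      = (\<integral>\<^sup>+t. \<integral>\<^sup>+e. ennreal (1 + capped_dev \<sigma> p a f (?z t e)) \<partial>?P \<partial>?T)"
    by (rule nn_integral_local_law) measurable
  also have "\<dots> = (\<integral>\<^sup>+t. 1 \<partial>?T)"
  proof (rule nn_integral_cong)
    fix t assume t: "t \<in> space ?T"
    let ?A = "design_energy \<sigma> p f t"
    let ?h = "\<lambda>e. capped_lr ?A (\<Sum>l\<in>{1..p}. f (t l) / \<sigma> * e l)"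
    have dev: "capped_dev \<sigma> p a f (?z t e) = (if ?A \<le> a then ?h e - capped_mean \<sigma> p f t else 0)" for e
      by (simp add: capped_dev_def design_zip[OF t] score_zip[OF \<sigma>])
    show "(\<integral>\<^sup>+e. ennreal (1 + capped_dev \<sigma> p a f (?z t e)) \<partial>?P) = 1"
    proof (cases "?A \<le> a")
      case True
      have int: "integrable ?P ?h" by (intro integrable_capped_lr design_energy_nonneg)
      have nn: "0 \<le> 1 + (?h e - capped_mean \<sigma> p f t)" for e
        using capped_mean_bounds[of \<sigma> p f t] capped_lr_bounds(1)[OF design_energy_nonneg, of \<sigma> p f t "\<Sum>l\<in>{1..p}. f (t l) / \<sigma> * e l"]
        by linarith
      have "(\<integral>\<^sup>+e. ennreal (1 + capped_dev \<sigma> p a f (?z t e)) \<partial>?P) = (\<integral>\<^sup>+e. ennreal (1 + (?h e - capped_mean \<sigma> p f t)) \<partial>?P)"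
        using True by (simp add: dev)
      also have "\<dots> = ennreal (\<integral>e. 1 + (?h e - capped_mean \<sigma> p f t) \<partial>?P)"
        using int nn by (intro nn_integral_eq_integral) auto
      also have "(\<integral>e. 1 + (?h e - capped_mean \<sigma> p f t) \<partial>?P) = 1"
        using int by (simp add: P.prob_space) (simp add: capped_mean_def)
      finally show ?thesis by (simp only: ennreal_1)
    next
      case False
      then show ?thesis by (simp only: dev if_False) (simp add: P.emeasure_space_1)
    qed
  qed
  also have "\<dots> = 1" by (simp add: T.emeasure_space_1)
  finally show ?thesis .
qed

text \<open>Given the design, the deviations of different bumps are independent, and each is either
  \<open>0\<close> or a centred function, Lipschitz with constant \<open>exp 1\<close>, of a
  Gaussian variable of variance at most \<open>a\<close>. The bound does not depend on the design,
  so it survives the average over the design.\<close>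

lemma nn_integral_exp_capped_dev:
  assumes \<sigma>: "\<sigma> \<noteq> 0" and p: "0 < p" and Q: "finite Q" and a: "0 \<le> a"
    and f[measurable]: "\<And>q. f q \<in> borel_measurable borel"
    and disj: "\<And>q q' x. q \<in> Q \<Longrightarrow> q' \<in> Q \<Longrightarrow> q \<noteq> q' \<Longrightarrow> f q x * f q' x = 0"
  shows "(\<integral>\<^sup>+d. exp (\<Sum>q\<in>Q. b q * capped_dev \<sigma> p a (f q) d) \<partial>local_law \<sigma> p (\<lambda>_. 0))
    \<le> ennreal (exp ((exp 1)\<^sup>2 * a * (\<Sum>q\<in>Q. (b q)\<^sup>2)))"
proof -
  let ?P = "PiM {1..p} (\<lambda>_. noise_law)" and ?T = "PiM {1..p} (\<lambda>_. design_law)"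
  let ?z = "\<lambda>t e. \<lambda>l\<in>{1..p}. (t l, \<sigma> * e l)"
  interpret P: prob_space ?P by (rule prob_space_PiM_noise)
  interpret T: prob_space ?T by (rule prob_space_PiM_design)
  have "(\<integral>\<^sup>+d. exp (\<Sum>q\<in>Q. b q * capped_dev \<sigma> p a (f q) d) \<partial>local_law \<sigma> p (\<lambda>_. 0))
      = (\<integral>\<^sup>+t. \<integral>\<^sup>+e. exp (\<Sum>q\<in>Q. b q * capped_dev \<sigma> p a (f q) (?z t e)) \<partial>?P \<partial>?T)"
    by (rule nn_integral_local_law) measurable
  also have "\<dots> \<le> (\<integral>\<^sup>+t. ennreal (exp ((exp 1)\<^sup>2 * a * (\<Sum>q\<in>Q. (b q)\<^sup>2))) \<partial>?T)"
  proof (rule nn_integral_mono)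
    fix t assume t: "t \<in> space ?T"
    define A where "A q = design_energy \<sigma> p (f q) t" for q
    define S where "S q e = (\<Sum>l\<in>{1..p}. f q (t l) / \<sigma> * e l)" for q and e :: "nat \<Rightarrow> real"
    define g where "g q x = (if A q \<le> a then capped_lr (A q) x - capped_mean \<sigma> p (f q) t else 0)" for q x
    have A0: "0 \<le> A q" for q by (simp add: A_def design_energy_nonneg)
    have [measurable]: "S q \<in> borel_measurable ?P" for q unfolding S_def by measurable
    have [measurable]: "g q \<in> borel_measurable borel" for q unfolding g_def by measurable
    have dev: "capped_dev \<sigma> p a (f q) (?z t e) = g q (S q e)" for q e
      by (simp add: capped_dev_def design_zip[OF t] score_zip[OF \<sigma>] g_def A_def S_def)
    have "(\<integral>\<^sup>+e. exp (\<Sum>q\<in>Q. b q * capped_dev \<sigma> p a (f q) (?z t e)) \<partial>?P)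
        = (\<integral>\<^sup>+e. (\<Prod>q\<in>Q. ennreal (exp (b q * g q (S q e)))) \<partial>?P)"
      by (simp add: dev exp_sum Q prod_ennreal)
    also have "\<dots> = (\<Prod>q\<in>Q. \<integral>\<^sup>+e. ennreal (exp (b q * g q (S q e))) \<partial>?P)"
      unfolding S_def
      by (rule nn_integral_PiM_disjoint_blocks[where F="\<lambda>q x. ennreal (exp (b q * g q x))"])
         (use p Q disj in \<open>auto simp: prob_space_noise_law\<close>)
    also have "\<dots> \<le> (\<Prod>q\<in>Q. ennreal (exp ((exp 1)\<^sup>2 * a * (b q)\<^sup>2)))"
    proof (rule prod_mono_ennreal)
      fix q assume "q \<in> Q"
      show "(\<integral>\<^sup>+e. ennreal (exp (b q * g q (S q e))) \<partial>?P) \<le> ennreal (exp ((exp 1)\<^sup>2 * a * (b q)\<^sup>2))"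
      proof (cases "A q \<le> a")
        case True
        have "(\<integral>\<^sup>+e. ennreal (exp (b q * g q (S q e))) \<partial>?P)
            = (\<integral>\<^sup>+e. ennreal (exp (b q * (capped_lr (A q) (S q e) - (\<integral>e. capped_lr (A q) (S q e) \<partial>?P)))) \<partial>?P)"
          using True by (simp add: g_def capped_mean_def A_def S_def)
        also have "\<dots> \<le> ennreal (exp ((exp 1)\<^sup>2 * (b q)\<^sup>2 * A q))"
        proof (rule P.subgaussian_lipschitz[where S="S q" and h="capped_lr (A q)" and A="A q" and c="exp 1" and K="exp 1"])
          show "(\<integral>\<^sup>+e. ennreal (exp (u * S q e)) \<partial>?P) \<le> ennreal (exp (u\<^sup>2 * A q / 2))" for u
            unfolding S_def by (subst nn_integral_PiM_noise_exp) (simp add: A_def design_energy_def)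
        qed (use capped_lr_lipschitz[OF A0] capped_lr_bounds[OF A0] in auto)
        also have "\<dots> \<le> ennreal (exp ((exp 1)\<^sup>2 * a * (b q)\<^sup>2))"
          using mult_left_mono[OF True, of "(exp 1)\<^sup>2 * (b q)\<^sup>2"]
          by (intro ennreal_leI) (simp add: mult.commute mult.left_commute)
        finally show ?thesis .
      next
        case False
        then show ?thesis using a by (simp add: g_def P.emeasure_space_1)
      qed
    qed
    also have "\<dots> = ennreal (exp ((exp 1)\<^sup>2 * a * (\<Sum>q\<in>Q. (b q)\<^sup>2)))"
      using Q by (simp add: prod_ennreal exp_sum sum_distrib_left)
    finally show "(\<integral>\<^sup>+e. exp (\<Sum>q\<in>Q. b q * capped_dev \<sigma> p a (f q) (?z t e)) \<partial>?P)
      \<le> ennreal (exp ((exp 1)\<^sup>2 * a * (\<Sum>q\<in>Q. (b q)\<^sup>2)))" .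
  qed
  also have "\<dots> = ennreal (exp ((exp 1)\<^sup>2 * a * (\<Sum>q\<in>Q. (b q)\<^sup>2)))"
    by (simp add: T.emeasure_space_1)
  finally show ?thesis .
qed

section \<open>Tails of the design energy and of the score\<close>

text \<open>For \<open>y = (f x)\<^sup>2 / \<beta>\<^sup>2\<close> in the unit interval,
  \<open>exp y \<le> 1 + y + y\<^sup>2 \<le> 1 + 2 * y\<close>, so the moment is controlled by the
  squared norm of \<open>f\<close>.\<close>

lemma nn_integral_exp_square_design_law:
  assumes f[measurable]: "f \<in> borel_measurable borel"
    and \<beta>: "0 < \<beta>" "\<And>x. \<bar>f x\<bar> \<le> \<beta>" and \<delta>: "0 \<le> \<delta>"
    and L2: "(\<integral>\<^sup>+x\<in>{0..1}. ennreal ((f x)\<^sup>2) \<partial>lborel) \<le> ennreal \<delta>"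
  shows "(\<integral>\<^sup>+x. ennreal (exp ((f x)\<^sup>2 / \<beta>\<^sup>2)) \<partial>design_law) \<le> ennreal (exp (2 * \<delta> / \<beta>\<^sup>2))"
proof -
  interpret D: prob_space design_law by (rule prob_space_design_law)
  let ?g = "\<lambda>x. exp ((f x)\<^sup>2 / \<beta>\<^sup>2)"
  have "(\<integral>\<^sup>+x. ennreal (?g x) \<partial>design_law) \<le> (\<integral>\<^sup>+x. 1 + ennreal (2 / \<beta>\<^sup>2) * ennreal ((f x)\<^sup>2) \<partial>design_law)"
  proof (intro nn_integral_mono)
    fix x
    have "(f x)\<^sup>2 \<le> \<beta>\<^sup>2" using \<beta>(2)[of x] by (metis abs_ge_zero power2_abs power_mono)
    then have "(f x)\<^sup>2 / \<beta>\<^sup>2 \<le> 1" using \<beta>(1) by simp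
    then have "?g x \<le> 1 + (f x)\<^sup>2 / \<beta>\<^sup>2 + ((f x)\<^sup>2 / \<beta>\<^sup>2)\<^sup>2" by (intro exp_bound) auto
    also have "((f x)\<^sup>2 / \<beta>\<^sup>2)\<^sup>2 \<le> (f x)\<^sup>2 / \<beta>\<^sup>2"
      using \<open>(f x)\<^sup>2 / \<beta>\<^sup>2 \<le> 1\<close> by (simp only: power2_eq_square[of "_ / _"]) (intro mult_left_le, auto)
    finally have "ennreal (?g x) \<le> ennreal (1 + 2 / \<beta>\<^sup>2 * (f x)\<^sup>2)" by (intro ennreal_leI) simp
    then show "ennreal (?g x) \<le> 1 + ennreal (2 / \<beta>\<^sup>2) * ennreal ((f x)\<^sup>2)"
      by (subst (asm) ennreal_plus) (auto simp: ennreal_mult[symmetric])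
  qed
  also have "\<dots> = 1 + ennreal (2 / \<beta>\<^sup>2) * (\<integral>\<^sup>+x. ennreal ((f x)\<^sup>2) \<partial>design_law)"
    by (subst nn_integral_add) (auto simp: nn_integral_cmult D.emeasure_space_1)
  also have "(\<integral>\<^sup>+x. ennreal ((f x)\<^sup>2) \<partial>design_law) = (\<integral>\<^sup>+x\<in>{0..1}. ennreal ((f x)\<^sup>2) \<partial>lborel)"
    by (rule nn_integral_design_law) auto
  also have "1 + ennreal (2 / \<beta>\<^sup>2) * \<dots> \<le> 1 + ennreal (2 / \<beta>\<^sup>2) * ennreal \<delta>"
    by (intro add_mono mult_left_mono L2) auto
  also have "\<dots> = ennreal (1 + 2 * \<delta> / \<beta>\<^sup>2)"
    using \<delta> by (simp add: ennreal_mult[symmetric])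
  also have "\<dots> \<le> ennreal (exp (2 * \<delta> / \<beta>\<^sup>2))" by (intro ennreal_leI exp_ge_add_one_self)
  finally show ?thesis .
qed

lemma nn_integral_exp_design_energy:
  assumes \<sigma>: "0 < \<sigma>" and f[measurable]: "f \<in> borel_measurable borel"
    and \<beta>: "0 < \<beta>" "\<And>x. \<bar>f x\<bar> \<le> \<beta>" and \<delta>: "0 \<le> \<delta>"
    and L2: "(\<integral>\<^sup>+x\<in>{0..1}. ennreal ((f x)\<^sup>2) \<partial>lborel) \<le> ennreal \<delta>"
  shows "(\<integral>\<^sup>+t. exp (\<sigma>\<^sup>2 / \<beta>\<^sup>2 * design_energy \<sigma> p f t) \<partial>PiM {1..p} (\<lambda>_. design_law))
    \<le> ennreal (exp (2 * real p * \<delta> / \<beta>\<^sup>2))"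
proof -
  interpret product_prob_space "\<lambda>_::nat. design_law" by (intro product_prob_spaceI prob_space_design_law)
  let ?g = "\<lambda>x. exp ((f x)\<^sup>2 / \<beta>\<^sup>2)"
  have eq: "\<sigma>\<^sup>2 / \<beta>\<^sup>2 * design_energy \<sigma> p f t = (\<Sum>l\<in>{1..p}. (f (t l))\<^sup>2 / \<beta>\<^sup>2)" for t
    using \<sigma> by (simp add: design_energy_def sum_distrib_left power_divide)
  have "(\<integral>\<^sup>+t. exp (\<sigma>\<^sup>2 / \<beta>\<^sup>2 * design_energy \<sigma> p f t) \<partial>PiM {1..p} (\<lambda>_. design_law))
    = (\<integral>\<^sup>+t. (\<Prod>l\<in>{1..p}. ennreal (?g (t l))) \<partial>PiM {1..p} (\<lambda>_. design_law))"
    unfolding eq by (simp add: exp_sum prod_ennreal)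
  also have "\<dots> = (\<Prod>l\<in>{1..p}. \<integral>\<^sup>+x. ennreal (?g x) \<partial>design_law)"
    by (rule product_nn_integral_prod) auto
  also have "\<dots> = (\<integral>\<^sup>+x. ennreal (?g x) \<partial>design_law) ^ p" by simp
  also have "\<dots> \<le> ennreal (exp (2 * \<delta> / \<beta>\<^sup>2)) ^ p"
    by (intro power_mono nn_integral_exp_square_design_law[OF f \<beta> \<delta> L2]) auto
  also have "\<dots> = ennreal (exp (2 * real p * \<delta> / \<beta>\<^sup>2))"
    by (simp add: ennreal_power exp_of_nat_mult[symmetric] mult.commute mult.left_commute)
  finally show ?thesis .
qed

text \<open>The integral is the probability of the bad event under \<open>f\<close>. If the energy
  exceeds \<open>a\<close>, the noise integrates out to \<open>1\<close> and a Chernoff bound for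
  the energy is left; \<open>a\<close> is such that \<open>u * a\<close> is twice the exponent of
  the exponential moment. If only the score exceeds \<open>1\<close>, a further exponential tilt of
  the score gives the second term.\<close>

lemma local_lr_tail:
  assumes \<sigma>: "0 < \<sigma>" and f[measurable]: "f \<in> borel_measurable borel"
    and \<beta>: "0 < \<beta>" "\<And>x. \<bar>f x\<bar> \<le> \<beta>" and \<delta>: "0 < \<delta>"
    and L2: "(\<integral>\<^sup>+x\<in>{0..1}. ennreal ((f x)\<^sup>2) \<partial>lborel) \<le> ennreal \<delta>"
    and p: "0 < p" and a: "a = 4 * real p * \<delta> / \<sigma>\<^sup>2"
  shows "(\<integral>\<^sup>+d. ennreal (local_lr \<sigma> p f d) *
        indicator {d. \<not> (design_energy \<sigma> p f (design p d) \<le> a \<and> score \<sigma> p f d \<le> 1)} d \<partial>local_law \<sigma> p (\<lambda>_. 0))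
    \<le> ennreal (exp (- 2 * real p * \<delta> / \<beta>\<^sup>2) + exp (1 / 2 - 3 / (8 * a)))"
proof -
  let ?P = "PiM {1..p} (\<lambda>_. noise_law)" and ?T = "PiM {1..p} (\<lambda>_. design_law)"
  let ?z = "\<lambda>t e. \<lambda>l\<in>{1..p}. (t l, \<sigma> * e l)"
  interpret P: prob_space ?P by (rule prob_space_PiM_noise)
  interpret T: prob_space ?T by (rule prob_space_PiM_design)
  have a0: "0 < a" using p \<delta> \<sigma> by (simp add: a)
  define u where "u = \<sigma>\<^sup>2 / \<beta>\<^sup>2"
  \<comment> \<open>\<open>\<tau>\<close> is the extra tilt in
    \<open>exp x \<le> exp ((1 + \<tau>) * x - \<tau>)\<close> for \<open>1 \<le> x\<close>. The
    optimal tilt is \<open>1 / a - 1\<close>; half of \<open>1 / a\<close> is positive for every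
    \<open>a\<close> and, for small \<open>a\<close>, loses only a constant factor in the
    exponent.\<close>
  define \<tau> where "\<tau> = 1 / (2 * a)"
  define A where "A t = design_energy \<sigma> p f t" for t
  define S where "S t e = (\<Sum>l\<in>{1..p}. f (t l) / \<sigma> * e l)" for t e :: "nat \<Rightarrow> real"
  have [measurable]: "S t \<in> borel_measurable ?P" for t unfolding S_def by measurable
  have [measurable]: "A \<in> borel_measurable ?T" unfolding A_def
    using measurable_design_energy[OF f, of \<sigma> p] by (simp cong: measurable_cong_sets sets_PiM_cong)
  have mgf: "(\<integral>\<^sup>+e. exp (w * S t e) \<partial>?P) = ennreal (exp (w\<^sup>2 * A t / 2))" for w t
    unfolding S_def by (subst nn_integral_PiM_noise_exp) (simp add: A_def design_energy_def)
  have bad: "Measurable.pred (\<Pi>\<^sub>M l\<in>{1..p}. borel) (\<lambda>d. \<not> (design_energy \<sigma> p f (design p d) \<le> a \<and> score \<sigma> p f d \<le> 1))"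
    by measurable
  have "(\<integral>\<^sup>+d. ennreal (local_lr \<sigma> p f d) *
        indicator {d. \<not> (design_energy \<sigma> p f (design p d) \<le> a \<and> score \<sigma> p f d \<le> 1)} d \<partial>local_law \<sigma> p (\<lambda>_. 0))
    = (\<integral>\<^sup>+d. ennreal (local_lr \<sigma> p f d) *
        (if \<not> (design_energy \<sigma> p f (design p d) \<le> a \<and> score \<sigma> p f d \<le> 1) then 1 else 0) \<partial>local_law \<sigma> p (\<lambda>_. 0))"
    by (intro nn_integral_cong) (auto simp: indicator_def)
  also have "\<dots> = (\<integral>\<^sup>+t. \<integral>\<^sup>+e. ennreal (local_lr \<sigma> p f (?z t e)) *
        (if \<not> (design_energy \<sigma> p f (design p (?z t e)) \<le> a \<and> score \<sigma> p f (?z t e) \<le> 1) then 1 else 0) \<partial>?P \<partial>?T)"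
    by (rule nn_integral_local_law) (use bad in measurable)
  also have "\<dots> \<le> (\<integral>\<^sup>+t. ennreal (exp (- u * a)) * ennreal (exp (u * A t)) + ennreal (exp (1 / 2 - 3 / (8 * a))) \<partial>?T)"
  proof (rule nn_integral_mono)
    fix t assume t: "t \<in> space ?T"
    have lr: "local_lr \<sigma> p f (?z t e) = exp (S t e - A t / 2)" for e
      using \<sigma> by (simp add: local_lr_eq_exp design_zip[OF t] score_zip S_def A_def)
    have ev: "design_energy \<sigma> p f (design p (?z t e)) = A t" "score \<sigma> p f (?z t e) = S t e" for e
      using \<sigma> by (simp_all add: design_zip[OF t] score_zip S_def A_def)
    have A0: "0 \<le> A t" by (simp add: A_def design_energy_nonneg)
    show "(\<integral>\<^sup>+e. ennreal (local_lr \<sigma> p f (?z t e)) *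
        (if \<not> (design_energy \<sigma> p f (design p (?z t e)) \<le> a \<and> score \<sigma> p f (?z t e) \<le> 1) then 1 else 0) \<partial>?P)
      \<le> ennreal (exp (- u * a)) * ennreal (exp (u * A t)) + ennreal (exp (1 / 2 - 3 / (8 * a)))"
    proof (cases "A t \<le> a")
      case False
      have "(\<integral>\<^sup>+e. ennreal (local_lr \<sigma> p f (?z t e)) *
          (if \<not> (design_energy \<sigma> p f (design p (?z t e)) \<le> a \<and> score \<sigma> p f (?z t e) \<le> 1) then 1 else 0) \<partial>?P)
        = (\<integral>\<^sup>+e. ennreal (exp (- A t / 2)) * ennreal (exp (1 * S t e)) \<partial>?P)"
        using False by (simp add: lr ev ennreal_mult[symmetric] exp_add[symmetric])
      also have "\<dots> = ennreal (exp (- A t / 2)) * ennreal (exp (1\<^sup>2 * A t / 2))"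
        by (subst nn_integral_cmult) (simp_all only: mgf, measurable)
      also have "\<dots> = ennreal 1" by (simp add: ennreal_mult[symmetric] exp_add[symmetric])
      also have "\<dots> \<le> ennreal (exp (- u * a)) * ennreal (exp (u * A t))"
      proof -
        have "0 \<le> u" by (simp add: u_def)
        then have "0 \<le> - u * a + u * A t" using False mult_left_mono[of a "A t" u] by simp
        then show ?thesis
          by (simp add: ennreal_mult[symmetric] exp_add[symmetric] del: ennreal_1)
      qed
      finally show ?thesis by (simp add: add_increasing2)
    next
      case True
      have \<tau>0: "0 \<le> \<tau>" using a0 by (simp add: \<tau>_def)
      have "(\<integral>\<^sup>+e. ennreal (local_lr \<sigma> p f (?z t e)) *
          (if \<not> (design_energy \<sigma> p f (design p (?z t e)) \<le> a \<and> score \<sigma> p f (?z t e) \<le> 1) then 1 else 0) \<partial>?P)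
        \<le> (\<integral>\<^sup>+e. ennreal (exp (- A t / 2 - \<tau>)) * ennreal (exp ((1 + \<tau>) * S t e)) \<partial>?P)"
      proof (rule nn_integral_mono)
        fix e
        have "exp (S t e - A t / 2) \<le> exp (- A t / 2 - \<tau>) * exp ((1 + \<tau>) * S t e)" if "1 \<le> S t e"
          using mult_left_mono[OF that \<tau>0] by (simp add: exp_add[symmetric] algebra_simps)
        then show "ennreal (local_lr \<sigma> p f (?z t e)) *
          (if \<not> (design_energy \<sigma> p f (design p (?z t e)) \<le> a \<and> score \<sigma> p f (?z t e) \<le> 1) then 1 else 0)
          \<le> ennreal (exp (- A t / 2 - \<tau>)) * ennreal (exp ((1 + \<tau>) * S t e))"
          using True by (auto simp: lr ev ennreal_mult[symmetric] intro!: ennreal_leI)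
      qed
      also have "\<dots> = ennreal (exp (- A t / 2 - \<tau>)) * ennreal (exp ((1 + \<tau>)\<^sup>2 * A t / 2))"
        by (subst nn_integral_cmult) (simp_all only: mgf, measurable)
      also have "\<dots> = ennreal (exp (- A t / 2 - \<tau> + (1 + \<tau>)\<^sup>2 * A t / 2))"
        by (simp add: ennreal_mult[symmetric] exp_add[symmetric])
      also have "- A t / 2 - \<tau> + (1 + \<tau>)\<^sup>2 * A t / 2 = - \<tau> + (\<tau>\<^sup>2 + 2 * \<tau>) * A t / 2"
        by (simp add: power2_eq_square field_simps)
      also have "ennreal (exp (- \<tau> + (\<tau>\<^sup>2 + 2 * \<tau>) * A t / 2)) \<le> ennreal (exp (- \<tau> + (\<tau>\<^sup>2 + 2 * \<tau>) * a / 2))"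
        using mult_left_mono[OF True, of "\<tau>\<^sup>2 + 2 * \<tau>"] \<tau>0
        by (intro ennreal_leI) (simp only: exp_le_cancel_iff, simp)
      also have "- \<tau> + (\<tau>\<^sup>2 + 2 * \<tau>) * a / 2 = 1 / 2 - 3 / (8 * a)"
        using a0 by (simp add: \<tau>_def power2_eq_square field_simps)
      finally show ?thesis by (rule add_increasing[OF zero_le])
    qed
  qed
  also have "\<dots> = ennreal (exp (- u * a)) * (\<integral>\<^sup>+t. ennreal (exp (u * A t)) \<partial>?T) + ennreal (exp (1 / 2 - 3 / (8 * a)))"
    by (subst nn_integral_add) (auto simp: nn_integral_cmult T.emeasure_space_1)
  also have "\<dots> \<le> ennreal (exp (- u * a)) * ennreal (exp (2 * real p * \<delta> / \<beta>\<^sup>2)) + ennreal (exp (1 / 2 - 3 / (8 * a)))"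
    unfolding u_def A_def
    by (intro add_mono mult_left_mono nn_integral_exp_design_energy[OF \<sigma> f \<beta> less_imp_le[OF \<delta>] L2]) auto
  also have "\<dots> = ennreal (exp (- u * a + 2 * real p * \<delta> / \<beta>\<^sup>2) + exp (1 / 2 - 3 / (8 * a)))"
    by (simp add: ennreal_mult[symmetric] exp_add[symmetric])
  also have "- u * a + 2 * real p * \<delta> / \<beta>\<^sup>2 = - 2 * real p * \<delta> / \<beta>\<^sup>2"
    using \<sigma> \<beta>(1) by (simp add: u_def a field_simps)
  finally show ?thesis .
qed

section \<open>Messages of one machine\<close>

text \<open>\<open>G - 1 \<le> \<eta> / 2 + (G - 1)\<^sup>2 / (2 \<eta>)\<close> replaces the Cauchy--Schwarz inequality.\<close>

lemma (in prob_space) density_event_le: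
  fixes G :: "'a \<Rightarrow> real"
  assumes G[measurable]: "G \<in> borel_measurable M" and nn: "\<And>\<omega>. 0 \<le> G \<omega>"
    and one: "(\<integral>\<^sup>+\<omega>. G \<omega> \<partial>M) = 1" and sq: "(\<integral>\<^sup>+\<omega>. (G \<omega>)\<^sup>2 \<partial>M) \<le> ennreal (1 + \<eta>\<^sup>2)"
    and \<eta>: "0 < \<eta>" and A[measurable]: "A \<in> events"
  shows "(\<integral>\<^sup>+\<omega>. ennreal (G \<omega>) * indicator A \<omega> \<partial>M) \<le> emeasure M A + ennreal \<eta>"
proof -
  \<comment> \<open>The identity \<open>(G - 1)\<^sup>2 + 2 * G = G\<^sup>2 + 1\<close> yields the
    variance without a subtraction in \<open>ennreal\<close>.\<close>
  have "(\<integral>\<^sup>+\<omega>. ennreal ((G \<omega> - 1)\<^sup>2) \<partial>M) + 2 = (\<integral>\<^sup>+\<omega>. ennreal ((G \<omega> - 1)\<^sup>2) + 2 * ennreal (G \<omega>) \<partial>M)"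
    by (subst nn_integral_add) (auto simp: nn_integral_cmult one)
  also have "\<dots> = (\<integral>\<^sup>+\<omega>. ennreal ((G \<omega>)\<^sup>2) + 1 \<partial>M)"
  proof (rule nn_integral_cong)
    fix \<omega>
    have "ennreal ((G \<omega> - 1)\<^sup>2) + 2 * ennreal (G \<omega>) = ennreal ((G \<omega> - 1)\<^sup>2 + 2 * G \<omega>)"
      using nn[of \<omega>] by (simp add: ennreal_mult)
    also have "(G \<omega> - 1)\<^sup>2 + 2 * G \<omega> = (G \<omega>)\<^sup>2 + 1" by (simp add: power2_eq_square algebra_simps)
    also have "ennreal \<dots> = ennreal ((G \<omega>)\<^sup>2) + 1" by simp
    finally show "ennreal ((G \<omega> - 1)\<^sup>2) + 2 * ennreal (G \<omega>) = ennreal ((G \<omega>)\<^sup>2) + 1" .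
  qed
  also have "\<dots> = (\<integral>\<^sup>+\<omega>. ennreal ((G \<omega>)\<^sup>2) \<partial>M) + 1"
    by (subst nn_integral_add) (auto simp: emeasure_space_1)
  also have "\<dots> \<le> ennreal (1 + \<eta>\<^sup>2) + 1" by (intro add_mono sq) auto
  also have "\<dots> = ennreal (\<eta>\<^sup>2) + 2" by (simp add: ac_simps)
  finally have var: "(\<integral>\<^sup>+\<omega>. ennreal ((G \<omega> - 1)\<^sup>2) \<partial>M) \<le> ennreal (\<eta>\<^sup>2)"
    by (simp add: add.commute[of _ 2] ennreal_add_left_cancel_le)
  have "(\<integral>\<^sup>+\<omega>. ennreal (G \<omega>) * indicator A \<omega> \<partial>M)
      \<le> (\<integral>\<^sup>+\<omega>. (indicator A \<omega> + ennreal (\<eta> / 2)) + ennreal (1 / (2 * \<eta>)) * ennreal ((G \<omega> - 1)\<^sup>2) \<partial>M)"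
  proof (rule nn_integral_mono)
    fix \<omega>
    have "0 \<le> (G \<omega> - 1 - \<eta>)\<^sup>2" by simp
    then have "G \<omega> - 1 \<le> \<eta> / 2 + 1 / (2 * \<eta>) * (G \<omega> - 1)\<^sup>2"
      using \<eta> by (simp add: power2_eq_square field_simps)
    then have "ennreal (G \<omega>) \<le> ennreal (1 + \<eta> / 2 + 1 / (2 * \<eta>) * (G \<omega> - 1)\<^sup>2)"
      by (intro ennreal_leI) linarith
    also have "\<dots> = (1 + ennreal (\<eta> / 2)) + ennreal (1 / (2 * \<eta>)) * ennreal ((G \<omega> - 1)\<^sup>2)"
      using \<eta> by (subst ennreal_plus; (subst ennreal_plus)?; simp add: ennreal_mult[symmetric])
    finally show "ennreal (G \<omega>) * indicator A \<omega> \<le> (indicator A \<omega> + ennreal (\<eta> / 2)) + ennreal (1 / (2 * \<eta>)) * ennreal ((G \<omega> - 1)\<^sup>2)"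
      by (auto simp: indicator_def)
  qed
  also have "\<dots> = emeasure M A + ennreal (\<eta> / 2) + ennreal (1 / (2 * \<eta>)) * (\<integral>\<^sup>+\<omega>. ennreal ((G \<omega> - 1)\<^sup>2) \<partial>M)"
    by (simp add: nn_integral_add nn_integral_cmult emeasure_space_1)
  also have "\<dots> \<le> emeasure M A + ennreal (\<eta> / 2) + ennreal (1 / (2 * \<eta>)) * ennreal (\<eta>\<^sup>2)"
    by (intro add_mono mult_left_mono var) auto
  also have "ennreal (1 / (2 * \<eta>)) * ennreal (\<eta>\<^sup>2) = ennreal (\<eta> / 2)"
    using \<eta> by (simp add: ennreal_mult[symmetric] power2_eq_square)
  also have "emeasure M A + ennreal (\<eta> / 2) + ennreal (\<eta> / 2) = emeasure M A + ennreal \<eta>"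
    using \<eta> by (simp add: add.assoc ennreal_plus[symmetric] del: ennreal_plus)
  finally show ?thesis .
qed

text \<open>The conditional expectation of \<open>X\<close> given the message. On a message of
  probability zero the division by zero gives \<open>0\<close>, so the density
  \<open>1 + message_dev\<close> takes the value \<open>1\<close> there.\<close>

definition message_dev :: "'a measure \<Rightarrow> ('a \<Rightarrow> 'c) \<Rightarrow> ('a \<Rightarrow> real) \<Rightarrow> 'c \<Rightarrow> real" where
  "message_dev M Y X y =
     (\<integral>\<omega>. X \<omega> * indicator (Y -` {y} \<inter> space M) \<omega> \<partial>M) / measure M (Y -` {y} \<inter> space M)"

context prob_space
begin

context
  fixes Y :: "'a \<Rightarrow> 'c :: countable" and X :: "'a \<Rightarrow> real" and K :: real
  assumes Y[measurable]: "Y \<in> M \<rightarrow>\<^sub>M count_space UNIV"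
    and X[measurable]: "X \<in> borel_measurable M"
    and X_bound: "\<And>\<omega>. \<bar>X \<omega>\<bar> \<le> K" and X_ge: "\<And>\<omega>. 0 \<le> 1 + X \<omega>"
    and X_mean: "(\<integral>\<^sup>+\<omega>. ennreal (1 + X \<omega>) \<partial>M) = 1"
begin

lemma integrable_dev_fibre: "integrable M (\<lambda>\<omega>. X \<omega> * indicator (Y -` {y} \<inter> space M) \<omega>)"
proof -
  have "0 \<le> K" using X_bound abs_ge_zero order_trans by blast
  with X_bound show ?thesis
    by (intro integrable_const_bound[where B=K]) (auto simp: indicator_def)
qed

lemma integrable_fibre_density:
  "integrable M (\<lambda>\<omega>. indicator (Y -` {y} \<inter> space M) \<omega> + X \<omega> * indicator (Y -` {y} \<inter> space M) \<omega> :: real)"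
  using integrable_dev_fibre by (intro Bochner_Integration.integrable_add) (auto simp: emeasure_eq_measure)

lemma dev_fibre_eq:
  "(\<integral>\<omega>. X \<omega> * indicator (Y -` {y} \<inter> space M) \<omega> \<partial>M) = message_dev M Y X y * prob (Y -` {y} \<inter> space M)"
proof (cases "prob (Y -` {y} \<inter> space M) = 0")
  case True
  then have "AE \<omega> in M. \<omega> \<notin> Y -` {y} \<inter> space M"
    by (subst AE_iff_measurable[where N="Y -` {y} \<inter> space M"]) (auto simp: emeasure_eq_measure)
  then have "(\<integral>\<omega>. X \<omega> * indicator (Y -` {y} \<inter> space M) \<omega> \<partial>M) = (\<integral>\<omega>. 0 \<partial>M)"
    by (intro integral_cong_AE) auto
  with True show ?thesis by simp
qed (simp add: message_dev_def)

lemma nn_integral_fibre: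
  "(\<integral>\<^sup>+\<omega>. ennreal (1 + X \<omega>) * indicator (Y -` {y} \<inter> space M) \<omega> \<partial>M)
    = ennreal ((1 + message_dev M Y X y) * prob (Y -` {y} \<inter> space M))"
proof -
  let ?E = "Y -` {y} \<inter> space M"
  have "(\<integral>\<^sup>+\<omega>. ennreal (1 + X \<omega>) * indicator ?E \<omega> \<partial>M) = (\<integral>\<^sup>+\<omega>. ennreal (indicator ?E \<omega> + X \<omega> * indicator ?E \<omega>) \<partial>M)"
    by (intro nn_integral_cong) (auto simp: indicator_def)
  also have "\<dots> = ennreal (\<integral>\<omega>. indicator ?E \<omega> + X \<omega> * indicator ?E \<omega> \<partial>M)"
  proof (rule nn_integral_eq_integral[OF integrable_fibre_density])
    show "AE \<omega> in M. 0 \<le> indicator ?E \<omega> + X \<omega> * indicator ?E \<omega>"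
      using X_ge by (auto simp: indicator_def)
  qed
  also have "(\<integral>\<omega>. indicator ?E \<omega> + X \<omega> * indicator ?E \<omega> \<partial>M) = prob ?E + message_dev M Y X y * prob ?E"
    using integrable_dev_fibre dev_fibre_eq
    by (subst Bochner_Integration.integral_add) (auto simp: emeasure_eq_measure)
  finally show ?thesis by (simp add: algebra_simps)
qed

lemma message_dev_ge: "0 \<le> 1 + message_dev M Y X y"
proof (cases "prob (Y -` {y} \<inter> space M) = 0")
  case False
  let ?E = "Y -` {y} \<inter> space M"
  have p: "0 < prob ?E" using False by (simp add: zero_less_measure_iff)
  have "0 \<le> (\<integral>\<omega>. indicator ?E \<omega> + X \<omega> * indicator ?E \<omega> \<partial>M)"
    using X_ge by (intro integral_nonneg_AE) (auto simp: indicator_def)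
  also have "\<dots> = (1 + message_dev M Y X y) * prob ?E"
    using integrable_dev_fibre dev_fibre_eq
    by (subst Bochner_Integration.integral_add) (auto simp: emeasure_eq_measure algebra_simps)
  finally show ?thesis using p by (simp add: zero_le_mult_iff)
qed (simp add: message_dev_def)

text \<open>Bayes' formula atom by atom: messages are countable, so equality on singletons suffices.
  Thus \<open>1 + message_dev\<close> is the likelihood ratio of the message.\<close>

lemma distr_density_message:
  "distr (density M (\<lambda>\<omega>. ennreal (1 + X \<omega>))) (count_space UNIV) Y
    = density (distr M (count_space UNIV) Y) (\<lambda>y. ennreal (1 + message_dev M Y X y))"
proof (rule measure_eqI_countable[where A=UNIV])
  fix y :: 'c
  have "emeasure (distr (density M (\<lambda>\<omega>. ennreal (1 + X \<omega>))) (count_space UNIV) Y) {y}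
      = (\<integral>\<^sup>+\<omega>. ennreal (1 + X \<omega>) * indicator (Y -` {y} \<inter> space M) \<omega> \<partial>M)"
    by (simp add: emeasure_distr emeasure_density)
  also have "\<dots> = ennreal ((1 + message_dev M Y X y) * prob (Y -` {y} \<inter> space M))"
    by (rule nn_integral_fibre)
  also have "\<dots> = (\<integral>\<^sup>+y'. ennreal (1 + message_dev M Y X y) * indicator {y} y' \<partial>distr M (count_space UNIV) Y)"
    using message_dev_ge by (simp add: nn_integral_cmult_indicator emeasure_distr emeasure_eq_measure ennreal_mult)
  also have "\<dots> = emeasure (density (distr M (count_space UNIV) Y) (\<lambda>y. ennreal (1 + message_dev M Y X y))) {y}"
    by (subst emeasure_density) (auto intro!: nn_integral_cong simp: indicator_def)
  finally show "emeasure (distr (density M (\<lambda>\<omega>. ennreal (1 + X \<omega>))) (count_space UNIV) Y) {y} = \<dots>" .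
qed auto

lemma nn_integral_message_density:
  "(\<integral>\<^sup>+y. ennreal (1 + message_dev M Y X y) \<partial>distr M (count_space UNIV) Y) = 1"
proof -
  have "(\<integral>\<^sup>+y. ennreal (1 + message_dev M Y X y) \<partial>distr M (count_space UNIV) Y)
     = emeasure (distr (density M (\<lambda>\<omega>. ennreal (1 + X \<omega>))) (count_space UNIV) Y) UNIV"
    unfolding distr_density_message by (simp add: emeasure_density)
  also have "\<dots> = (\<integral>\<^sup>+\<omega>. ennreal (1 + X \<omega>) \<partial>M)"
    by (simp add: emeasure_distr emeasure_density cong: nn_integral_cong)
  finally show ?thesis by (simp add: X_mean)
qed

text \<open>\<open>message_dev\<close> has mean zero under the null law of the message, so the
  second moment of the likelihood ratio exceeds \<open>1\<close> by exactly the chi-squared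
  divergence.\<close>

lemma nn_integral_message_density_squared:
  "(\<integral>\<^sup>+y. ennreal ((1 + message_dev M Y X y)\<^sup>2) \<partial>distr M (count_space UNIV) Y)
    = 1 + (\<integral>\<^sup>+y. ennreal ((message_dev M Y X y)\<^sup>2) \<partial>distr M (count_space UNIV) Y)"
proof -
  let ?\<nu> = "distr M (count_space UNIV) Y" and ?c = "message_dev M Y X"
  interpret \<nu>: prob_space ?\<nu> by (rule prob_space_distr) measurable
  have "(\<integral>\<^sup>+y. ennreal ((1 + ?c y)\<^sup>2) \<partial>?\<nu>) + 1 = (\<integral>\<^sup>+y. ennreal ((1 + ?c y)\<^sup>2) + 1 \<partial>?\<nu>)"
    by (subst nn_integral_add) (auto simp: \<nu>.emeasure_space_1[simplified])
  also have "\<dots> = (\<integral>\<^sup>+y. 2 * ennreal (1 + ?c y) + ennreal ((?c y)\<^sup>2) \<partial>?\<nu>)"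
  proof (rule nn_integral_cong)
    fix y
    have "ennreal ((1 + ?c y)\<^sup>2) + 1 = ennreal ((1 + ?c y)\<^sup>2 + 1)" by simp
    also have "(1 + ?c y)\<^sup>2 + 1 = 2 * (1 + ?c y) + (?c y)\<^sup>2" by (simp add: power2_eq_square algebra_simps)
    also have "ennreal \<dots> = ennreal (2 * (1 + ?c y)) + ennreal ((?c y)\<^sup>2)"
      using message_dev_ge[of y] by (intro ennreal_plus) auto
    also have "ennreal (2 * (1 + ?c y)) = 2 * ennreal (1 + ?c y)"
      using message_dev_ge[of y] by (subst ennreal_mult) auto
    finally show "ennreal ((1 + ?c y)\<^sup>2) + 1 = 2 * ennreal (1 + ?c y) + ennreal ((?c y)\<^sup>2)" .
  qed
  also have "\<dots> = 2 * (\<integral>\<^sup>+y. ennreal (1 + ?c y) \<partial>?\<nu>) + (\<integral>\<^sup>+y. ennreal ((?c y)\<^sup>2) \<partial>?\<nu>)"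
    by (simp add: nn_integral_add nn_integral_cmult)
  also have "\<dots> = 1 + (\<integral>\<^sup>+y. ennreal ((?c y)\<^sup>2) \<partial>?\<nu>) + 1"
    unfolding nn_integral_message_density by (simp add: ac_simps flip: one_add_one)
  finally show ?thesis by (simp add: add.commute[of _ 1] ennreal_add_left_cancel)
qed

end

text \<open>The bound on conditional expectations is applied to each fibre of \<open>Y\<close>. The
  right-hand side does not grow with \<open>Q\<close>: however the message is built, the bumps share
  its information, and an average bump gets the fraction \<open>1 / card Q\<close>.\<close>

lemma nn_integral_message_dev_squared_le:
  fixes Y :: "'a \<Rightarrow> bool list" and X :: "'q \<Rightarrow> 'a \<Rightarrow> real"
  assumes Y[measurable]: "Y \<in> M \<rightarrow>\<^sub>M count_space UNIV" and Q: "finite Q"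
    and X[measurable]: "\<And>q. q \<in> Q \<Longrightarrow> X q \<in> borel_measurable M"
    and bdd: "\<And>q \<omega>. q \<in> Q \<Longrightarrow> \<bar>X q \<omega>\<bar> \<le> K"
    and v: "0 < v"
    and mgf: "\<And>b. (\<integral>\<^sup>+\<omega>. exp (\<Sum>q\<in>Q. b q * X q \<omega>) \<partial>M) \<le> ennreal (exp (v * (\<Sum>q\<in>Q. (b q)\<^sup>2)))"
    and len: "(\<integral>\<^sup>+\<omega>. of_nat (length (Y \<omega>)) \<partial>M) \<le> ennreal B" and B: "0 \<le> B" and n: "2 \<le> n"
  shows "(\<Sum>q\<in>Q. \<integral>\<^sup>+y. ennreal ((message_dev M Y (X q) y)\<^sup>2) \<partial>distr M (count_space UNIV) Y)
    \<le> ennreal (4 * v * (B * ln (2 * real n) + 2 / real n))"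
proof -
  let ?\<nu> = "distr M (count_space UNIV) Y"
  interpret \<nu>: prob_space ?\<nu> by (rule prob_space_distr) measurable
  have meas: "measure ?\<nu> {y} = prob (Y -` {y} \<inter> space M)" for y
    by (simp add: measure_distr)
  have "(\<Sum>q\<in>Q. \<integral>\<^sup>+y. ennreal ((message_dev M Y (X q) y)\<^sup>2) \<partial>?\<nu>)
      = (\<integral>\<^sup>+y. (\<Sum>q\<in>Q. ennreal ((message_dev M Y (X q) y)\<^sup>2)) \<partial>?\<nu>)"
    by (rule nn_integral_sum[symmetric]) auto
  also have "\<dots> \<le> (\<integral>\<^sup>+y. ennreal (4 * v) * ennreal (ln (1 / measure ?\<nu> {y})) \<partial>?\<nu>)"
  proof (rule nn_integral_mono)
    fix y
    have "(\<Sum>q\<in>Q. (message_dev M Y (X q) y)\<^sup>2) \<le> 4 * v * ln (1 / prob (Y -` {y} \<inter> space M))"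
    proof (cases "prob (Y -` {y} \<inter> space M) = 0")
      case True
      then show ?thesis by (simp add: message_dev_def)
    next
      case False
      then have "0 < prob (Y -` {y} \<inter> space M)" by (simp add: zero_less_measure_iff)
      then show ?thesis
        unfolding message_dev_def
        by (intro subgaussian_conditional_expectation[OF Q _ _ X bdd v mgf]) auto
    qed
    then show "(\<Sum>q\<in>Q. ennreal ((message_dev M Y (X q) y)\<^sup>2)) \<le> ennreal (4 * v) * ennreal (ln (1 / measure ?\<nu> {y}))"
      using v by (simp add: meas sum_ennreal ennreal_mult'[symmetric] ennreal_leI)
  qed
  also have "\<dots> = ennreal (4 * v) * (\<integral>\<^sup>+y. ennreal (ln (1 / measure ?\<nu> {y})) \<partial>?\<nu>)"
    by (rule nn_integral_cmult) auto
  also have "\<dots> \<le> ennreal (4 * v) * ennreal (B * ln (2 * real n) + 2 / real n)"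
  proof (intro mult_left_mono entropy_le_expected_length)
    show "(\<integral>\<^sup>+y. of_nat (length y) \<partial>?\<nu>) \<le> ennreal B"
      using len by (subst nn_integral_distr) auto
  qed (auto simp: B n \<nu>.prob_space_axioms)
  also have "\<dots> = ennreal (4 * v * (B * ln (2 * real n) + 2 / real n))"
    using v by (simp add: ennreal_mult'[symmetric])
  finally show ?thesis .
qed

end

section \<open>Le Cam's bound for distributed estimators\<close>

text \<open>If the event \<open>ennreal r \<le> h0\<close> has null probability at least
  \<open>1/4\<close>, Markov's inequality at the null suffices. Otherwise its complement has
  probability at least \<open>1/4\<close> under \<open>P1\<close>, and there the separation forces
  \<open>h1\<close> to be at least \<open>r\<close>. Closeness is demanded for this single event
  only, so that the alternative may be chosen depending on it.\<close>

lemma le_cam_two_point: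
  fixes h0 h1 :: "'a \<Rightarrow> ennreal"
  assumes P0: "prob_space P0" and P1: "prob_space P1" and s: "sets P1 = sets P0"
    and h0[measurable]: "h0 \<in> borel_measurable P0" and h1[measurable]: "h1 \<in> borel_measurable P0"
    and sep: "\<And>D. ennreal (2 * r) \<le> h0 D + h1 D" and r: "0 \<le> r"
    and close: "emeasure P1 {D\<in>space P0. ennreal r \<le> h0 D} \<le> emeasure P0 {D\<in>space P0. ennreal r \<le> h0 D} + ennreal (1/2)"
  shows "ennreal (r / 4) \<le> (\<integral>\<^sup>+D. h0 D \<partial>P0) \<or> ennreal (r / 4) \<le> (\<integral>\<^sup>+D. h1 D \<partial>P1)"
proof -
  interpret P0: prob_space P0 by fact
  interpret P1: prob_space P1 by fact
  define E where "E = {D\<in>space P0. ennreal r \<le> h0 D}"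
  have sp: "space P1 = space P0" using s by (rule sets_eq_imp_space_eq)
  have E[measurable]: "E \<in> sets P0" unfolding E_def by measurable
  have E1: "E \<in> sets P1" using E s by simp
  have h1': "h1 \<in> borel_measurable P1" using h1 s by (simp cong: measurable_cong_sets)
  show ?thesis
  proof (cases "1/4 \<le> P0.prob E")
    case True
    have "ennreal (r / 4) \<le> ennreal (r * P0.prob E)" using True r mult_left_mono[OF True r] by (intro ennreal_leI) simp
    also have "\<dots> = (\<integral>\<^sup>+D. ennreal r * indicator E D \<partial>P0)"
      using r by (simp add: nn_integral_cmult_indicator P0.emeasure_eq_measure ennreal_mult)
    also have "\<dots> \<le> (\<integral>\<^sup>+D. h0 D \<partial>P0)"
      by (intro nn_integral_mono) (auto simp: E_def indicator_def)
    finally show ?thesis ..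
  next
    case False
    have "ennreal (P1.prob E) \<le> ennreal (P0.prob E + 1/2)"
      using close unfolding E_def[symmetric] by (simp add: P0.emeasure_eq_measure P1.emeasure_eq_measure)
    then have "P1.prob E \<le> P0.prob E + 1/2" by (subst (asm) ennreal_le_iff) auto
    then have "1/4 \<le> P1.prob (space P1 - E)" using False P1.prob_compl[OF E1] by simp
    then have "ennreal (r / 4) \<le> ennreal (r * P1.prob (space P1 - E))"
      using mult_left_mono[of "1/4" _ r] r by (intro ennreal_leI) fastforce
    also have "\<dots> = (\<integral>\<^sup>+D. ennreal r * indicator (space P1 - E) D \<partial>P1)"
      using r E1 by (simp add: nn_integral_cmult_indicator P1.emeasure_eq_measure ennreal_mult)
    also have "\<dots> \<le> (\<integral>\<^sup>+D. h1 D \<partial>P1)"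
    proof (intro nn_integral_mono)
      fix D
      have "ennreal r \<le> h1 D" if "D \<in> space P1 - E"
      proof (rule ccontr)
        assume "\<not> ennreal r \<le> h1 D"
        moreover have "h0 D < ennreal r" using that by (auto simp: E_def sp)
        ultimately have "h0 D + h1 D < ennreal r + ennreal r" by (intro add_strict_mono) auto
        also have "\<dots> = ennreal (2 * r)" using r by (simp add: ennreal_plus[symmetric] del: ennreal_plus)
        finally show False using sep[of D] by simp
      qed
      then show "ennreal r * indicator (space P1 - E) D \<le> h1 D" by (auto simp: indicator_def)
    qed
    finally show ?thesis ..
  qed
qed

text \<open>The bounds on \<open>g\<close> hold almost everywhere for any \<open>g\<close>, because
  the essential supremum of a nonmeasurable function is \<open>top\<close>. The term
  \<open>g x - 0\<close> matches the loss at the null function.\<close>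

lemma sup_norm_01_triangle:
  assumes [measurable]: "f \<in> borel_measurable borel"
  shows "sup_norm_01 f \<le> sup_norm_01 (\<lambda>x. g x - 0) + sup_norm_01 (\<lambda>x. g x - f x)"
proof -
  let ?M = "restrict_space lborel {0..1::real}"
  have "AE x in ?M. ennreal \<bar>g x - 0\<bar> \<le> sup_norm_01 (\<lambda>x. g x - 0)"
    "AE x in ?M. ennreal \<bar>g x - f x\<bar> \<le> sup_norm_01 (\<lambda>x. g x - f x)"
    unfolding sup_norm_01_def by (rule esssup_AE)+
  then have "AE x in ?M. ennreal \<bar>f x\<bar> \<le> sup_norm_01 (\<lambda>x. g x - 0) + sup_norm_01 (\<lambda>x. g x - f x)"
  proof eventually_elim
    case (elim x)
    have "ennreal \<bar>f x\<bar> \<le> ennreal (\<bar>g x - 0\<bar> + \<bar>g x - f x\<bar>)" by (intro ennreal_leI) auto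
    also have "\<dots> = ennreal \<bar>g x - 0\<bar> + ennreal \<bar>g x - f x\<bar>" by (rule ennreal_plus) auto
    finally show ?case using add_mono[OF elim] by (rule order_trans)
  qed
  moreover have "(\<lambda>x. ennreal \<bar>f x\<bar>) \<in> borel_measurable ?M"
    by (rule measurable_restrict_space1) measurable
  ultimately show ?thesis unfolding sup_norm_01_def[of f] by (intro esssup_I)
qed

abbreviation data_space :: "nat \<Rightarrow> nat \<Rightarrow> (nat \<Rightarrow> nat \<Rightarrow> real \<times> real) measure" where
  "data_space n m \<equiv> \<Pi>\<^sub>M i\<in>{1..m}. \<Pi>\<^sub>M l\<in>{1..n div m}. borel"

definition messages :: "nat \<Rightarrow> (nat \<Rightarrow> (nat \<Rightarrow> real \<times> real) \<Rightarrow> bool list) \<Rightarrow> (nat \<Rightarrow> nat \<Rightarrow> real \<times> real) \<Rightarrow> nat \<Rightarrow> bool list"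
  where "messages m Y D = (\<lambda>i\<in>{1..m}. Y i (D i))"

lemma sets_joint_law[measurable_cong]: "sets (joint_law \<sigma> n m f) = sets (data_space n m)"
  unfolding joint_law_def by (intro sets_PiM_cong refl sets_local_law)

lemma prob_space_joint_law: "f \<in> borel_measurable borel \<Longrightarrow> prob_space (joint_law \<sigma> n m f)"
  unfolding joint_law_def by (intro prob_space_PiM prob_space_obs_law)

lemma sets_PiM_messages:
  fixes m :: nat
  shows "sets (PiM {1..m} (\<lambda>_. count_space (UNIV :: bool list set))) = Pow (PiE {1..m} (\<lambda>_. UNIV))"
  by (subst count_space_PiM_finite) auto

lemma measurable_messages:
  assumes "\<And>i. i \<in> {1..m} \<Longrightarrow> Y i \<in> (\<Pi>\<^sub>M l\<in>{1..n div m}. borel) \<rightarrow>\<^sub>M count_space UNIV"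
  shows "messages m Y \<in> data_space n m \<rightarrow>\<^sub>M PiM {1..m} (\<lambda>_. count_space UNIV)"
  unfolding messages_def
proof (rule measurable_restrict)
  fix i assume i: "i \<in> {1..m}"
  show "(\<lambda>D. Y i (D i)) \<in> data_space n m \<rightarrow>\<^sub>M count_space UNIV"
    by (rule measurable_compose[OF measurable_component_singleton[OF i] assms[OF i]])
qed

text \<open>A product of finitely many countable discrete factors is discrete, so every function of
  the messages is measurable, in particular the sup norm of the error.\<close>

lemma measurable_of_messages:
  fixes h :: "(nat \<Rightarrow> bool list) \<Rightarrow> 'b :: topological_space"
  assumes "\<And>i. i \<in> {1..m} \<Longrightarrow> Y i \<in> (\<Pi>\<^sub>M l\<in>{1..n div m}. borel) \<rightarrow>\<^sub>M count_space UNIV"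
  shows "(\<lambda>D. h (messages m Y D)) \<in> borel_measurable (data_space n m)"
proof (rule measurable_compose[OF measurable_messages[OF assms]])
  show "h \<in> borel_measurable (PiM {1..m} (\<lambda>_. count_space UNIV))"
    by (rule measurableI) (auto simp: sets_PiM_messages space_PiM)
qed auto

text \<open>The event to which Le Cam's bound is applied is determined by the messages, so it is
  enough to compare their laws. In \<open>close\<close> the bump \<open>q\<close> may depend on the
  encoders and on \<open>A\<close>, and the length constraint is exploited at the null
  function.\<close>

lemma minimax_risk_ge:
  assumes F: "(\<lambda>_. 0) \<in> F" "\<And>q. q \<in> Q \<Longrightarrow> f q \<in> F"
    and f: "\<And>q. f q \<in> borel_measurable borel"
    and sep: "\<And>q. q \<in> Q \<Longrightarrow> ennreal (2 * r) \<le> sup_norm_01 (f q)" and r: "0 \<le> r"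
    and close: "\<And>Y A. (\<And>i. i \<in> {1..m} \<Longrightarrow> Y i \<in> (\<Pi>\<^sub>M l\<in>{1..n div m}. borel) \<rightarrow>\<^sub>M count_space UNIV) \<Longrightarrow>
       (\<And>i. i \<in> {1..m} \<Longrightarrow> (\<integral>\<^sup>+ D. of_nat (length (Y i (D i))) \<partial>joint_law \<sigma> n m (\<lambda>_. 0)) \<le> ennreal (B i)) \<Longrightarrow>
       \<exists>q\<in>Q. emeasure (joint_law \<sigma> n m (f q)) {D\<in>space (data_space n m). messages m Y D \<in> A}
         \<le> emeasure (joint_law \<sigma> n m (\<lambda>_. 0)) {D\<in>space (data_space n m). messages m Y D \<in> A} + ennreal (1/2)"
  shows "ennreal (r / 4) \<le> minimax_risk \<sigma> n m B F"
  unfolding minimax_risk_def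
proof (rule INF_greatest)
  fix fhat assume "fhat \<in> dist_estimators \<sigma> n m B F"
  then obtain Y g where Y: "\<And>i. i \<in> {1..m} \<Longrightarrow> Y i \<in> (\<Pi>\<^sub>M l\<in>{1..n div m}. borel) \<rightarrow>\<^sub>M count_space UNIV"
    and len: "\<And>f i. f \<in> F \<Longrightarrow> i \<in> {1..m} \<Longrightarrow>
        (\<integral>\<^sup>+ D. of_nat (length (Y i (D i))) \<partial>joint_law \<sigma> n m f) \<le> ennreal (B i)"
    and fhat: "fhat = (\<lambda>D. g (messages m Y D))"
    unfolding dist_estimators_def messages_def by blast
  let ?P = "joint_law \<sigma> n m" and ?S = "space (data_space n m)"
  define h where "h f y = sup_norm_01 (\<lambda>x. g y x - f x)" for f y
  obtain q where q: "q \<in> Q" and le: "emeasure (?P (f q)) {D\<in>?S. messages m Y D \<in> {y. ennreal r \<le> h (\<lambda>_. 0) y}}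
      \<le> emeasure (?P (\<lambda>_. 0)) {D\<in>?S. messages m Y D \<in> {y. ennreal r \<le> h (\<lambda>_. 0) y}} + ennreal (1/2)"
    using close[of Y "{y. ennreal r \<le> h (\<lambda>_. 0) y}", OF Y len[OF F(1)]] by blast
  have sp: "space (?P f) = ?S" for f by (rule sets_eq_imp_space_eq[OF sets_joint_law])
  have meas: "(\<lambda>D. h f (messages m Y D)) \<in> borel_measurable (?P (\<lambda>_. 0))" for f
    using measurable_of_messages[OF Y, where h="h f"] by (simp cong: measurable_cong_sets add: sets_joint_law)
  have "ennreal (r / 4) \<le> (\<integral>\<^sup>+D. h (\<lambda>_. 0) (messages m Y D) \<partial>?P (\<lambda>_. 0))
      \<or> ennreal (r / 4) \<le> (\<integral>\<^sup>+D. h (f q) (messages m Y D) \<partial>?P (f q))"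
  proof (rule le_cam_two_point)
    show "ennreal (2 * r) \<le> h (\<lambda>_. 0) (messages m Y D) + h (f q) (messages m Y D)" for D
      unfolding h_def by (rule order_trans[OF sep[OF q] sup_norm_01_triangle[OF f]])
  qed (use le r in \<open>simp_all add: meas prob_space_joint_law f sets_joint_law sp\<close>)
  then show "ennreal (r / 4) \<le> (SUP f\<in>F. \<integral>\<^sup>+ D. sup_norm_01 (\<lambda>x. fhat D x - f x) \<partial>?P f)"
    unfolding fhat h_def
    using F(1) F(2)[OF q] by (auto intro: SUP_upper2)
qed

section \<open>Comparing the laws of all messages under the null and under one bump\<close>

lemma joint_law_nn_integral_component:
  assumes f: "f \<in> borel_measurable borel" and i: "i \<in> {1..m}"
    and g[measurable]: "g \<in> borel_measurable (\<Pi>\<^sub>M l\<in>{1..n div m}. borel)"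
  shows "(\<integral>\<^sup>+ D. g (D i) \<partial>joint_law \<sigma> n m f) = (\<integral>\<^sup>+ d. g d \<partial>local_law \<sigma> (n div m) f)"
proof -
  have "local_law \<sigma> (n div m) f = distr (joint_law \<sigma> n m f) (local_law \<sigma> (n div m) f) (\<lambda>D. D i)"
    unfolding joint_law_def using i by (intro distr_PiM_component[symmetric] prob_space_local_law f) auto
  then have "(\<integral>\<^sup>+ d. g d \<partial>local_law \<sigma> (n div m) f) = (\<integral>\<^sup>+ d. g d \<partial>distr (joint_law \<sigma> n m f) (local_law \<sigma> (n div m) f) (\<lambda>D. D i))"
    by simp
  also have "\<dots> = (\<integral>\<^sup>+ D. g (D i) \<partial>joint_law \<sigma> n m f)"
    using i unfolding joint_law_def by (intro nn_integral_distr) measurable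
  finally show ?thesis ..
qed

text \<open>If no machine is bad, each likelihood ratio is dominated by its capped density.
  Otherwise their product is at most the sum over \<open>i\<close> of the product with the bad event
  of machine \<open>i\<close> inserted; the other factors integrate to \<open>1\<close>, so each
  summand costs at most \<open>\<epsilon>\<close>.\<close>

lemma joint_law_capped_le:
  assumes \<sigma>: "0 < \<sigma>" and f[measurable]: "f \<in> borel_measurable borel"
    and tail: "(\<integral>\<^sup>+d. ennreal (local_lr \<sigma> (n div m) f d) *
        indicator {d. \<not> (design_energy \<sigma> (n div m) f (design (n div m) d) \<le> a \<and> score \<sigma> (n div m) f d \<le> 1)} d
        \<partial>local_law \<sigma> (n div m) (\<lambda>_. 0)) \<le> ennreal \<epsilon>"
    and \<epsilon>: "0 \<le> \<epsilon>" and E[measurable]: "E \<in> sets (data_space n m)"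
  shows "emeasure (joint_law \<sigma> n m f) E
    \<le> emeasure (density (joint_law \<sigma> n m (\<lambda>_. 0)) (\<lambda>D. \<Prod>i\<in>{1..m}. ennreal (1 + capped_dev \<sigma> (n div m) a f (D i)))) E
      + ennreal (real m * \<epsilon>)"
proof -
  let ?p = "n div m" and ?J = "joint_law \<sigma> n m (\<lambda>_. 0)"
  let ?\<mu> = "local_law \<sigma> ?p (\<lambda>_. 0)"
  let ?L = "\<lambda>d. ennreal (local_lr \<sigma> ?p f d)" and ?C = "\<lambda>d. ennreal (1 + capped_dev \<sigma> ?p a f d)"
  define bad where "bad = {d. \<not> (design_energy \<sigma> ?p f (design ?p d) \<le> a \<and> score \<sigma> ?p f d \<le> 1)}"
  have pbad: "Measurable.pred (\<Pi>\<^sub>M l\<in>{1..?p}. borel) (\<lambda>d. d \<in> bad)"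
    unfolding bad_def mem_Collect_eq by measurable
  have bad[measurable]: "(\<lambda>d. indicator bad d :: ennreal) \<in> borel_measurable (\<Pi>\<^sub>M l\<in>{1..?p}. borel)"
    using pbad by (simp add: indicator_def[abs_def])
  interpret \<mu>: product_prob_space "\<lambda>_::nat. ?\<mu>"
    by (intro product_prob_spaceI prob_space_local_law) simp
  have one: "(\<integral>\<^sup>+d. ?L d \<partial>?\<mu>) = 1"
  proof -
    interpret A: prob_space "local_law \<sigma> ?p f" by (rule prob_space_local_law[OF f])
    have "(\<integral>\<^sup>+d. ?L d \<partial>?\<mu>) = emeasure (density ?\<mu> ?L) (space (density ?\<mu> ?L))"
      by (subst emeasure_density) (auto cong: nn_integral_cong)
    then show ?thesis unfolding local_law_density[OF \<sigma> f, symmetric] by (simp only: A.emeasure_space_1)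
  qed
  have "emeasure (joint_law \<sigma> n m f) E = (\<integral>\<^sup>+D. (\<Prod>i\<in>{1..m}. ?L (D i)) * indicator E D \<partial>?J)"
    by (subst joint_law_density[OF \<sigma> f], subst emeasure_density)
       (auto simp: prod_ennreal local_lr_nonneg sets_joint_law)
  also have "\<dots> \<le> (\<integral>\<^sup>+D. (\<Prod>i\<in>{1..m}. ?C (D i)) * indicator E D
        + (\<Sum>i\<in>{1..m}. \<Prod>j\<in>{1..m}. ?L (D j) * (if j = i then indicator bad (D j) else 1)) \<partial>?J)"
  proof (rule nn_integral_mono)
    fix D
    show "(\<Prod>i\<in>{1..m}. ?L (D i)) * indicator E D \<le> (\<Prod>i\<in>{1..m}. ?C (D i)) * indicator E D
        + (\<Sum>i\<in>{1..m}. \<Prod>j\<in>{1..m}. ?L (D j) * (if j = i then indicator bad (D j) else 1))"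
    proof (cases "\<exists>i\<in>{1..m}. D i \<in> bad")
      case True
      then obtain i where i: "i \<in> {1..m}" "D i \<in> bad" by auto
      have "(\<Prod>i\<in>{1..m}. ?L (D i)) * indicator E D \<le> (\<Prod>i\<in>{1..m}. ?L (D i))"
        by (auto simp: indicator_def)
      also have "\<dots> = (\<Prod>j\<in>{1..m}. ?L (D j) * (if j = i then indicator bad (D j) else 1))"
        using i by (intro prod.cong) auto
      also have "\<dots> \<le> (\<Sum>i\<in>{1..m}. \<Prod>j\<in>{1..m}. ?L (D j) * (if j = i then indicator bad (D j) else 1))"
        by (rule member_le_sum[OF i(1)]) auto
      finally show ?thesis by (rule add_increasing[OF zero_le])
    next
      case False
      then have "(\<Prod>i\<in>{1..m}. ?L (D i)) \<le> (\<Prod>i\<in>{1..m}. ?C (D i))"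
        by (intro prod_mono_ennreal ennreal_leI local_lr_le_capped) (auto simp: bad_def)
      then show ?thesis by (intro add_increasing2[OF zero_le] mult_right_mono) auto
    qed
  qed
  also have "\<dots> = (\<integral>\<^sup>+D. (\<Prod>i\<in>{1..m}. ?C (D i)) * indicator E D \<partial>?J)
      + (\<Sum>i\<in>{1..m}. \<integral>\<^sup>+D. (\<Prod>j\<in>{1..m}. ?L (D j) * (if j = i then indicator bad (D j) else 1)) \<partial>?J)"
    by (subst nn_integral_add, measurable, subst nn_integral_sum) measurable
  also have "\<dots> \<le> (\<integral>\<^sup>+D. (\<Prod>i\<in>{1..m}. ?C (D i)) * indicator E D \<partial>?J) + (\<Sum>i\<in>{1..m}. ennreal \<epsilon>)"
  proof (intro add_mono order_refl sum_mono)
    fix i assume i: "i \<in> {1..m}"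
    have "(\<integral>\<^sup>+D. (\<Prod>j\<in>{1..m}. ?L (D j) * (if j = i then indicator bad (D j) else 1)) \<partial>?J)
        = (\<Prod>j\<in>{1..m}. \<integral>\<^sup>+d. ?L d * (if j = i then indicator bad d else 1) \<partial>?\<mu>)"
      unfolding joint_law_def by (rule \<mu>.product_nn_integral_prod) auto
    also have "\<dots> = (\<Prod>j\<in>{1..m}. if j = i then \<integral>\<^sup>+d. ?L d * indicator bad d \<partial>?\<mu> else 1)"
      by (intro prod.cong refl) (auto simp: one)
    also have "\<dots> = (\<integral>\<^sup>+d. ?L d * indicator bad d \<partial>?\<mu>)"
      using i by (subst prod.delta) auto
    also have "\<dots> \<le> ennreal \<epsilon>" using tail unfolding bad_def .
    finally show "(\<integral>\<^sup>+D. (\<Prod>j\<in>{1..m}. ?L (D j) * (if j = i then indicator bad (D j) else 1)) \<partial>?J) \<le> ennreal \<epsilon>" .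
  qed
  also have "(\<integral>\<^sup>+D. (\<Prod>i\<in>{1..m}. ?C (D i)) * indicator E D \<partial>?J)
      = emeasure (density ?J (\<lambda>D. \<Prod>i\<in>{1..m}. ?C (D i))) E"
    by (rule emeasure_density[symmetric]) (auto simp: sets_joint_law)
  also have "(\<Sum>i\<in>{1..m}. ennreal \<epsilon>) = ennreal (real m * \<epsilon>)"
    using \<epsilon> by (simp add: ennreal_mult ennreal_of_nat_eq_real_of_nat)
  finally show ?thesis .
qed

text \<open>The messages of different machines are independent, so their chi-squared divergences combine
  multiplicatively.\<close>

lemma capped_message_event_le:
  fixes A :: "(nat \<Rightarrow> bool list) set"
  assumes \<sigma>: "0 < \<sigma>" and f[measurable]: "f \<in> borel_measurable borel"
    and Y: "\<And>i. Y i \<in> (\<Pi>\<^sub>M l\<in>{1..n div m}. borel) \<rightarrow>\<^sub>M count_space (UNIV :: bool list set)"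
    and x: "\<And>i. 0 \<le> x i" "(\<Sum>i\<in>{1..m}. x i) \<le> 1/32"
    and chi: "\<And>i. i \<in> {1..m} \<Longrightarrow> (\<integral>\<^sup>+y. ennreal ((message_dev (local_law \<sigma> (n div m) (\<lambda>_. 0)) (Y i)
        (capped_dev \<sigma> (n div m) a f) y)\<^sup>2) \<partial>distr (local_law \<sigma> (n div m) (\<lambda>_. 0)) (count_space UNIV) (Y i)) \<le> ennreal (x i)"
  defines "E \<equiv> {D\<in>space (data_space n m). messages m Y D \<in> A}"
  shows "emeasure (density (joint_law \<sigma> n m (\<lambda>_. 0)) (\<lambda>D. \<Prod>i\<in>{1..m}. ennreal (1 + capped_dev \<sigma> (n div m) a f (D i)))) E
      \<le> emeasure (joint_law \<sigma> n m (\<lambda>_. 0)) E + ennreal (1/4)"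
proof -
  let ?p = "n div m" and ?J = "joint_law \<sigma> n m (\<lambda>_. 0)"
  define \<mu> where "\<mu> = local_law \<sigma> ?p (\<lambda>_. 0)"
  define X where "X = capped_dev \<sigma> ?p a f"
  define C where "C = (\<lambda>d. ennreal (1 + X d))"
  define \<nu> where "\<nu> i = distr \<mu> (count_space UNIV) (Y i)" for i
  define g where "g i y = 1 + message_dev \<mu> (Y i) X y" for i y
  let ?B = "PiM {1..m} (\<lambda>_. count_space (UNIV :: bool list set))"
  interpret \<mu>: prob_space \<mu> unfolding \<mu>_def by (rule prob_space_local_law) simp
  have s\<mu>[measurable_cong]: "sets \<mu> = sets (\<Pi>\<^sub>M l\<in>{1..?p}. borel)" unfolding \<mu>_def by (rule sets_local_law)
  have J: "?J = PiM {1..m} (\<lambda>_. \<mu>)" by (simp add: joint_law_def \<mu>_def)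
  have X[measurable]: "X \<in> borel_measurable \<mu>" unfolding X_def by measurable
  have C[measurable]: "C \<in> borel_measurable \<mu>" unfolding C_def by measurable
  have Ym[measurable]: "Y i \<in> \<mu> \<rightarrow>\<^sub>M count_space UNIV" for i using Y by (simp cong: measurable_cong_sets add: s\<mu>)
  have Xb: "\<And>d. \<bar>X d\<bar> \<le> exp 1" "\<And>d. 0 \<le> 1 + X d" unfolding X_def by (rule capped_dev_bounds)+
  have X1: "(\<integral>\<^sup>+d. ennreal (1 + X d) \<partial>\<mu>) = 1"
    unfolding X_def \<mu>_def using \<sigma> by (intro nn_integral_capped_density) auto
  have C1: "prob_space (density \<mu> C)"
    by (rule prob_spaceI) (simp add: emeasure_density C_def X1 cong: nn_integral_cong)
  have g0: "0 \<le> g i y" for i y unfolding g_def by (rule \<mu>.message_dev_ge[OF Ym X Xb X1])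
  have g1: "(\<integral>\<^sup>+y. ennreal (g i y) \<partial>\<nu> i) = 1" for i
    unfolding g_def \<nu>_def by (rule \<mu>.nn_integral_message_density[OF Ym X Xb X1])
  have g2: "(\<integral>\<^sup>+y. ennreal ((g i y)\<^sup>2) \<partial>\<nu> i) \<le> ennreal (1 + x i)" if "i \<in> {1..m}" for i
    using add_left_mono[OF chi[OF that], of 1] x(1)[of i]
    unfolding g_def \<nu>_def \<mu>.nn_integral_message_density_squared[OF Ym X Xb X1]
    by (simp add: \<mu>_def X_def)
  have \<nu>: "prob_space (\<nu> i)" for i unfolding \<nu>_def by (rule \<mu>.prob_space_distr) measurable
  have s\<nu>[measurable_cong]: "sets (\<nu> i) = sets (count_space UNIV)" for i by (simp add: \<nu>_def)
  interpret \<nu>: product_prob_space \<nu> by (intro product_prob_spaceI \<nu>)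
  have g\<nu>: "prob_space (density (\<nu> i) (\<lambda>y. ennreal (g i y)))" for i
  proof (rule prob_spaceI)
    show "emeasure (density (\<nu> i) (\<lambda>y. ennreal (g i y))) (space (density (\<nu> i) (\<lambda>y. ennreal (g i y)))) = 1"
      by (subst emeasure_density) (auto simp: g1 cong: nn_integral_cong)
  qed
  \<comment> \<open>\<open>A\<close> is any set of functions; its extensional part has the same
    preimage and is measurable in the discrete product.\<close>
  define A' where "A' = A \<inter> PiE {1..m} (\<lambda>_. UNIV)"
  have A': "A' \<in> sets ?B" by (simp add: A'_def sets_PiM_messages)
  have sN: "sets (PiM {1..m} \<nu>) = sets ?B" by (intro sets_PiM_cong) (auto simp: \<nu>_def)
  have A'N[measurable]: "A' \<in> sets (PiM {1..m} \<nu>)" using A' sN by simp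
  have msg: "messages m Y = (\<lambda>D. \<lambda>i\<in>{1..m}. Y i (D i))" by (simp add: messages_def fun_eq_iff)
  have Mm: "(\<lambda>D. \<lambda>i\<in>{1..m}. Y i (D i)) \<in> PiM {1..m} (\<lambda>_. \<mu>) \<rightarrow>\<^sub>M ?B" by measurable
  have spJ: "space (PiM {1..m} (\<lambda>_. \<mu>)) = space (data_space n m)"
    by (intro sets_eq_imp_space_eq sets_PiM_cong refl s\<mu>)
  have E: "E = (\<lambda>D. \<lambda>i\<in>{1..m}. Y i (D i)) -` A' \<inter> space (PiM {1..m} (\<lambda>_. \<mu>))"
    unfolding E_def spJ by (auto simp: msg A'_def)
  have JE: "emeasure ?J E = emeasure (PiM {1..m} \<nu>) A'"
  proof -
    have "emeasure ?J E = emeasure (distr (PiM {1..m} (\<lambda>_. \<mu>)) ?B (\<lambda>D. \<lambda>i\<in>{1..m}. Y i (D i))) A'"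
      unfolding J E using Mm A' by (rule emeasure_distr[symmetric])
    also have "distr (PiM {1..m} (\<lambda>_. \<mu>)) ?B (\<lambda>D. \<lambda>i\<in>{1..m}. Y i (D i)) = PiM {1..m} \<nu>"
      unfolding \<nu>_def[abs_def] by (rule distr_PiM_map) (auto intro: \<mu>.prob_space_axioms Ym)
    finally show ?thesis .
  qed
  have "emeasure (density ?J (\<lambda>D. \<Prod>i\<in>{1..m}. C (D i))) E = emeasure (PiM {1..m} (\<lambda>_. density \<mu> C)) E"
    unfolding J by (subst PiM_density) (auto intro: \<mu>.prob_space_axioms C1)
  also have "\<dots> = emeasure (distr (PiM {1..m} (\<lambda>_. density \<mu> C)) ?B (\<lambda>D. \<lambda>i\<in>{1..m}. Y i (D i))) A'"
  proof -
    have sd: "sets (PiM {1..m} (\<lambda>_. density \<mu> C)) = sets (PiM {1..m} (\<lambda>_. \<mu>))"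
      by (intro sets_PiM_cong) auto
    have "(\<lambda>D. \<lambda>i\<in>{1..m}. Y i (D i)) \<in> PiM {1..m} (\<lambda>_. density \<mu> C) \<rightarrow>\<^sub>M ?B"
      using Mm by (simp cong: measurable_cong_sets add: sd)
    then show ?thesis
      unfolding E sets_eq_imp_space_eq[OF sd, symmetric] using A' by (rule emeasure_distr[symmetric])
  qed
  also have "distr (PiM {1..m} (\<lambda>_. density \<mu> C)) ?B (\<lambda>D. \<lambda>i\<in>{1..m}. Y i (D i))
      = PiM {1..m} (\<lambda>i. distr (density \<mu> C) (count_space UNIV) (Y i))"
    by (rule distr_PiM_map) (auto intro: C1)
  also have "\<dots> = PiM {1..m} (\<lambda>i. density (\<nu> i) (\<lambda>y. ennreal (g i y)))"
    unfolding C_def \<nu>_def g_def by (simp only: \<mu>.distr_density_message[OF Ym X Xb X1])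
  also have "\<dots> = density (PiM {1..m} \<nu>) (\<lambda>y. \<Prod>i\<in>{1..m}. ennreal (g i (y i)))"
    by (rule PiM_density) (auto simp: \<nu> g\<nu>)
  also have "(\<lambda>y. \<Prod>i\<in>{1..m}. ennreal (g i (y i))) = (\<lambda>y. ennreal (\<Prod>i\<in>{1..m}. g i (y i)))"
    by (intro ext prod_ennreal g0)
  also have "emeasure (density (PiM {1..m} \<nu>) \<dots>) A' = (\<integral>\<^sup>+y. ennreal (\<Prod>i\<in>{1..m}. g i (y i)) * indicator A' y \<partial>PiM {1..m} \<nu>)"
    by (rule emeasure_density) measurable
  also have "\<dots> \<le> emeasure (PiM {1..m} \<nu>) A' + ennreal (1/4)"
  proof (rule prob_space.density_event_le[OF prob_space_PiM[OF \<nu>]])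
    show "(\<integral>\<^sup>+y. ennreal (\<Prod>i\<in>{1..m}. g i (y i)) \<partial>PiM {1..m} \<nu>) = 1"
      by (subst prod_ennreal[symmetric], rule g0, subst \<nu>.product_nn_integral_prod) (auto simp: g1)
    have "(\<integral>\<^sup>+y. ennreal ((\<Prod>i\<in>{1..m}. g i (y i))\<^sup>2) \<partial>PiM {1..m} \<nu>)
        = (\<integral>\<^sup>+y. (\<Prod>i\<in>{1..m}. ennreal ((g i (y i))\<^sup>2)) \<partial>PiM {1..m} \<nu>)"
      by (intro nn_integral_cong) (simp add: prod_ennreal prod_power_distrib)
    also have "\<dots> = (\<Prod>i\<in>{1..m}. \<integral>\<^sup>+y. ennreal ((g i y)\<^sup>2) \<partial>\<nu> i)"
      by (rule \<nu>.product_nn_integral_prod) auto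
    also have "\<dots> \<le> (\<Prod>i\<in>{1..m}. ennreal (exp (x i)))"
    proof (rule prod_mono_ennreal)
      fix i assume "i \<in> {1..m}"
      show "(\<integral>\<^sup>+y. ennreal ((g i y)\<^sup>2) \<partial>\<nu> i) \<le> ennreal (exp (x i))"
        by (rule order_trans[OF g2[OF \<open>i \<in> {1..m}\<close>]]) (intro ennreal_leI exp_ge_add_one_self)
    qed
    also have "\<dots> = ennreal (exp (\<Sum>i\<in>{1..m}. x i))"
      by (simp add: prod_ennreal exp_sum)
    \<comment> \<open>\<open>exp (1/32) \<le> 1 + 1/16\<close>, and
      \<open>1/16 = \<eta>\<^sup>2\<close> for \<open>\<eta> = 1/4\<close>. The other
      \<open>1/4\<close> of the \<open>1/2\<close> in Le Cam's bound is reserved for the capping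
      error.\<close>
    also have "\<dots> \<le> ennreal (1 + (1/4)\<^sup>2)"
    proof (intro ennreal_leI)
      have "exp (\<Sum>i\<in>{1..m}. x i) \<le> exp (1/32)" using x(2) by simp
      also have "exp (1/32 :: real) \<le> 1 + 1/32 + (1/32)\<^sup>2" by (rule exp_bound) auto
      also have "\<dots> \<le> 1 + (1/4)\<^sup>2" by (simp add: power2_eq_square)
      finally show "exp (\<Sum>i\<in>{1..m}. x i) \<le> 1 + (1/4)\<^sup>2" .
    qed
    finally show "(\<integral>\<^sup>+y. ennreal ((\<Prod>i\<in>{1..m}. g i (y i))\<^sup>2) \<partial>PiM {1..m} \<nu>) \<le> ennreal (1 + (1/4)\<^sup>2)" .
  qed (auto intro: prod_nonneg g0)
  finally show ?thesis unfolding JE by (simp add: C_def X_def)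
qed

lemma sets_message_event:
  assumes "\<And>i. i \<in> {1..m} \<Longrightarrow> Y i \<in> (\<Pi>\<^sub>M l\<in>{1..n div m}. borel) \<rightarrow>\<^sub>M count_space UNIV"
  shows "{D\<in>space (data_space n m). messages m Y D \<in> A} \<in> sets (data_space n m)"
proof -
  have "messages m Y -` (A \<inter> PiE {1..m} (\<lambda>_. UNIV)) \<inter> space (data_space n m) \<in> sets (data_space n m)"
    using measurable_messages[OF assms] by (rule measurable_sets) (auto simp: sets_PiM_messages)
  also have "messages m Y -` (A \<inter> PiE {1..m} (\<lambda>_. UNIV)) \<inter> space (data_space n m)
      = {D\<in>space (data_space n m). messages m Y D \<in> A}"
    by (auto simp: messages_def)
  finally show ?thesis .
qed

text \<open>Summed over machines and bumps, the chi-squared divergences are at most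
  \<open>card Q / 32\<close>, so by pigeonhole some bump has at most \<open>1/32\<close> in total.
  The proof selects it from the encoders, without looking at \<open>A\<close>.\<close>

lemma limited_messages_close:
  assumes \<sigma>: "0 < \<sigma>" and n: "2 \<le> n" and p: "0 < n div m" and Q: "finite Q" "Q \<noteq> {}"
    and f[measurable]: "\<And>q. f q \<in> borel_measurable borel"
    and disj: "\<And>q q' x. q \<in> Q \<Longrightarrow> q' \<in> Q \<Longrightarrow> q \<noteq> q' \<Longrightarrow> f q x * f q' x = 0"
    and \<beta>: "0 < \<beta>" "\<And>q x. q \<in> Q \<Longrightarrow> \<bar>f q x\<bar> \<le> \<beta>" and \<delta>: "0 < \<delta>"
    and L2: "\<And>q. q \<in> Q \<Longrightarrow> (\<integral>\<^sup>+x\<in>{0..1}. ennreal ((f q x)\<^sup>2) \<partial>lborel) \<le> ennreal \<delta>"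
    and B: "0 \<le> B" and a: "a = 4 * real (n div m) * \<delta> / \<sigma>\<^sup>2"
    and tail: "real m * (exp (- 2 * real (n div m) * \<delta> / \<beta>\<^sup>2) + exp (1 / 2 - 3 / (8 * a))) \<le> 1 / 4"
    and info: "real m * (4 * ((exp 1)\<^sup>2 * a) * (B * ln (2 * real n) + 2 / real n)) \<le> real (card Q) / 32"
    and Y: "\<And>i. i \<in> {1..m} \<Longrightarrow> Y i \<in> (\<Pi>\<^sub>M l\<in>{1..n div m}. borel) \<rightarrow>\<^sub>M count_space UNIV"
    and len: "\<And>i. i \<in> {1..m} \<Longrightarrow> (\<integral>\<^sup>+ D. of_nat (length (Y i (D i))) \<partial>joint_law \<sigma> n m (\<lambda>_. 0)) \<le> ennreal B"
  shows "\<exists>q\<in>Q. emeasure (joint_law \<sigma> n m (f q)) {D\<in>space (data_space n m). messages m Y D \<in> A}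
         \<le> emeasure (joint_law \<sigma> n m (\<lambda>_. 0)) {D\<in>space (data_space n m). messages m Y D \<in> A} + ennreal (1/2)"
proof -
  let ?p = "n div m"
  define \<mu> where "\<mu> = local_law \<sigma> ?p (\<lambda>_. 0)"
  \<comment> \<open>Outside \<open>{1..m}\<close> a constant message is put in, since the product
    lemmas want encoders that are measurable for every index.\<close>
  define Z where "Z i = (if i \<in> {1..m} then Y i else (\<lambda>_. []))" for i
  have Z: "Z i \<in> (\<Pi>\<^sub>M l\<in>{1..?p}. borel) \<rightarrow>\<^sub>M count_space UNIV" for i
    using Y by (cases "i \<in> {1..m}") (auto simp: Z_def)
  have msg: "messages m Y = messages m Z" by (auto simp: messages_def Z_def fun_eq_iff)
  interpret \<mu>: prob_space \<mu> unfolding \<mu>_def by (rule prob_space_local_law) simp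
  have s\<mu>[measurable_cong]: "sets \<mu> = sets (\<Pi>\<^sub>M l\<in>{1..?p}. borel)" unfolding \<mu>_def by (rule sets_local_law)
  have Zm[measurable]: "Z i \<in> \<mu> \<rightarrow>\<^sub>M count_space UNIV" for i using Z by (simp cong: measurable_cong_sets add: s\<mu>)
  have a0: "0 < a" using p \<delta> \<sigma> by (simp add: a)
  have v: "0 < (exp 1)\<^sup>2 * a" using a0 by simp
  define w where "w q i = (\<integral>\<^sup>+y. ennreal ((message_dev \<mu> (Z i) (capped_dev \<sigma> ?p a (f q)) y)\<^sup>2) \<partial>distr \<mu> (count_space UNIV) (Z i))" for q i
  define H where "H = 4 * ((exp 1)\<^sup>2 * a) * (B * ln (2 * real n) + 2 / real n)"
  have H0: "0 \<le> H" using a0 B n by (simp add: H_def)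
  have wH: "(\<Sum>q\<in>Q. w q i) \<le> ennreal H" if i: "i \<in> {1..m}" for i
    unfolding w_def H_def
  proof (rule \<mu>.nn_integral_message_dev_squared_le[where K="exp 1"])
    show "(\<integral>\<^sup>+\<omega>. of_nat (length (Z i \<omega>)) \<partial>\<mu>) \<le> ennreal B"
    proof -
      have "(\<integral>\<^sup>+\<omega>. of_nat (length (Z i \<omega>)) \<partial>\<mu>) = (\<integral>\<^sup>+ D. of_nat (length (Y i (D i))) \<partial>joint_law \<sigma> n m (\<lambda>_. 0))"
        unfolding \<mu>_def
        using i measurable_compose[OF Z[of i], of "\<lambda>y. of_nat (length y) :: ennreal" borel]
        by (subst joint_law_nn_integral_component[symmetric, where i=i and m=m]) (auto simp: Z_def)
      with len[OF i] show ?thesis by simp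
    qed
    show "(\<integral>\<^sup>+\<omega>. ennreal (exp (\<Sum>q\<in>Q. b q * capped_dev \<sigma> ?p a (f q) \<omega>)) \<partial>\<mu>)
        \<le> ennreal (exp ((exp 1)\<^sup>2 * a * (\<Sum>q\<in>Q. (b q)\<^sup>2)))" for b
      unfolding \<mu>_def using \<sigma> p Q a0 disj by (intro nn_integral_exp_capped_dev) auto
  qed (use Q v B n in \<open>auto intro: capped_dev_bounds\<close>)
  have total: "(\<Sum>q\<in>Q. \<Sum>i\<in>{1..m}. w q i) \<le> ennreal (real (card Q) / 32)"
  proof -
    have "(\<Sum>q\<in>Q. \<Sum>i\<in>{1..m}. w q i) = (\<Sum>i\<in>{1..m}. \<Sum>q\<in>Q. w q i)" by (rule sum.swap)
    also have "\<dots> \<le> (\<Sum>i\<in>{1..m}. ennreal H)" by (intro sum_mono wH)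
    also have "\<dots> = ennreal (real m * H)" using H0 by (simp add: ennreal_mult ennreal_of_nat_eq_real_of_nat)
    also have "\<dots> \<le> ennreal (real (card Q) / 32)" using info by (intro ennreal_leI) (simp add: H_def)
    finally show ?thesis .
  qed
  have fin: "w q i < top" if "q \<in> Q" "i \<in> {1..m}" for q i
  proof -
    have "w q i \<le> (\<Sum>q\<in>Q. w q i)" using that Q by (intro member_le_sum) auto
    also have "\<dots> \<le> ennreal H" using that by (intro wH)
    also have "\<dots> < top" by simp
    finally show ?thesis .
  qed
  \<comment> \<open>The divergences are bounded by \<open>H\<close>, hence finite, and can be turned
    into reals; the value \<open>0\<close> elsewhere makes them nonnegative for all indices.\<close>
  define x where "x q i = (if q \<in> Q \<and> i \<in> {1..m} then enn2real (w q i) else 0)" for q i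
  have xw: "ennreal (x q i) = w q i" if "q \<in> Q" "i \<in> {1..m}" for q i
    using fin[OF that] that by (simp add: x_def)
  have x0: "0 \<le> x q i" for q i by (simp add: x_def)
  have xe: "ennreal (\<Sum>q\<in>Q. \<Sum>i\<in>{1..m}. x q i) = (\<Sum>q\<in>Q. \<Sum>i\<in>{1..m}. w q i)"
  proof -
    have "ennreal (\<Sum>q\<in>Q. \<Sum>i\<in>{1..m}. x q i) = (\<Sum>q\<in>Q. \<Sum>i\<in>{1..m}. ennreal (x q i))"
      using x0 by (simp add: sum_ennreal sum_nonneg)
    also have "\<dots> = (\<Sum>q\<in>Q. \<Sum>i\<in>{1..m}. w q i)" by (intro sum.cong refl xw)
    finally show ?thesis .
  qed
  have xsum: "(\<Sum>q\<in>Q. \<Sum>i\<in>{1..m}. x q i) \<le> real (card Q) / 32"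
    using total unfolding xe[symmetric] by (rule ennreal_le_iff[THEN iffD1, rotated]) simp
  have "\<exists>q\<in>Q. (\<Sum>i\<in>{1..m}. x q i) \<le> 1/32"
  proof (rule ccontr)
    assume "\<not> ?thesis"
    then have "(\<Sum>q\<in>Q. 1/32) < (\<Sum>q\<in>Q. \<Sum>i\<in>{1..m}. x q i)" using Q by (intro sum_strict_mono) auto
    with xsum show False by simp
  qed
  then obtain q where q: "q \<in> Q" "(\<Sum>i\<in>{1..m}. x q i) \<le> 1/32" by blast
  let ?E = "{D\<in>space (data_space n m). messages m Y D \<in> A}"
  define \<epsilon> where "\<epsilon> = exp (- 2 * real ?p * \<delta> / \<beta>\<^sup>2) + exp (1 / 2 - 3 / (8 * a))"
  have E: "?E \<in> sets (data_space n m)"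
    by (rule sets_message_event[OF Y])
  have "emeasure (joint_law \<sigma> n m (f q)) ?E
    \<le> emeasure (density (joint_law \<sigma> n m (\<lambda>_. 0)) (\<lambda>D. \<Prod>i\<in>{1..m}. ennreal (1 + capped_dev \<sigma> ?p a (f q) (D i)))) ?E
      + ennreal (real m * \<epsilon>)"
    unfolding \<epsilon>_def
    by (rule joint_law_capped_le[OF \<sigma> f local_lr_tail[OF \<sigma> f \<beta>(1) \<beta>(2)[OF q(1)] \<delta> L2[OF q(1)] p a] _ E]) simp
  also have "\<dots> \<le> (emeasure (joint_law \<sigma> n m (\<lambda>_. 0)) ?E + ennreal (1/4)) + ennreal (1/4)"
  proof (intro add_mono)
    show "emeasure (density (joint_law \<sigma> n m (\<lambda>_. 0)) (\<lambda>D. \<Prod>i\<in>{1..m}. ennreal (1 + capped_dev \<sigma> ?p a (f q) (D i)))) ?E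
        \<le> emeasure (joint_law \<sigma> n m (\<lambda>_. 0)) ?E + ennreal (1/4)"
      unfolding msg
      by (rule capped_message_event_le[OF \<sigma> f Z x0 q(2)]) (simp add: xw q(1) w_def \<mu>_def)
    show "ennreal (real m * \<epsilon>) \<le> ennreal (1/4)" using tail by (intro ennreal_leI) (simp add: \<epsilon>_def)
  qed
  also have "\<dots> = emeasure (joint_law \<sigma> n m (\<lambda>_. 0)) ?E + ennreal (1/2)"
    by (simp add: add.assoc ennreal_plus[symmetric] del: ennreal_plus)
  finally show ?thesis using q(1) by blast
qed

section \<open>Second moment of the mixture without communication constraint\<close>

lemma nn_integral_obs_lr_mult:
  assumes \<sigma>: "0 < \<sigma>" and f[measurable]: "f \<in> borel_measurable borel" and g[measurable]: "g \<in> borel_measurable borel"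
  shows "(\<integral>\<^sup>+z. ennreal (obs_lr \<sigma> f z * obs_lr \<sigma> g z) \<partial>obs_law \<sigma> (\<lambda>_. 0))
    = (\<integral>\<^sup>+t. ennreal (exp (f t * g t / \<sigma>\<^sup>2)) \<partial>design_law)"
proof -
  have "(\<integral>\<^sup>+z. ennreal (obs_lr \<sigma> f z * obs_lr \<sigma> g z) \<partial>obs_law \<sigma> (\<lambda>_. 0))
      = (\<integral>\<^sup>+t. \<integral>\<^sup>+e. ennreal (obs_lr \<sigma> f (t, 0 + \<sigma> * e) * obs_lr \<sigma> g (t, 0 + \<sigma> * e)) \<partial>noise_law \<partial>design_law)"
    by (rule nn_integral_obs_law) auto
  also have "\<dots> = (\<integral>\<^sup>+t. ennreal (exp (f t * g t / \<sigma>\<^sup>2)) \<partial>design_law)"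
  proof (rule nn_integral_cong)
    fix t
    define u v where "u = f t / \<sigma>" and "v = g t / \<sigma>"
    have "obs_lr \<sigma> f (t, 0 + \<sigma> * e) * obs_lr \<sigma> g (t, 0 + \<sigma> * e)
        = exp (- (u\<^sup>2 + v\<^sup>2) / 2) * exp ((u + v) * e)" for e
      using \<sigma> by (simp add: obs_lr_def exp_add[symmetric] u_def v_def power2_eq_square field_simps)
    then have "(\<integral>\<^sup>+e. ennreal (obs_lr \<sigma> f (t, 0 + \<sigma> * e) * obs_lr \<sigma> g (t, 0 + \<sigma> * e)) \<partial>noise_law)
      = (\<integral>\<^sup>+e. ennreal (exp (- (u\<^sup>2 + v\<^sup>2) / 2)) * ennreal (exp ((u + v) * e)) \<partial>noise_law)"
      by (simp add: ennreal_mult)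
    also have "\<dots> = ennreal (exp (- (u\<^sup>2 + v\<^sup>2) / 2)) * ennreal (exp ((u + v)\<^sup>2 / 2))"
      by (subst nn_integral_cmult) (simp_all only: nn_integral_noise_law_exp, measurable)
    also have "\<dots> = ennreal (exp (- (u\<^sup>2 + v\<^sup>2) / 2 + (u + v)\<^sup>2 / 2))"
      by (simp add: ennreal_mult[symmetric] exp_add[symmetric])
    also have "- (u\<^sup>2 + v\<^sup>2) / 2 + (u + v)\<^sup>2 / 2 = f t * g t / \<sigma>\<^sup>2"
    proof -
      have "- (u\<^sup>2 + v\<^sup>2) / 2 + (u + v)\<^sup>2 / 2 = u * v" by (simp add: power2_eq_square field_simps)
      then show ?thesis by (simp add: u_def v_def power2_eq_square)
    qed
    finally show "(\<integral>\<^sup>+e. ennreal (obs_lr \<sigma> f (t, 0 + \<sigma> * e) * obs_lr \<sigma> g (t, 0 + \<sigma> * e)) \<partial>noise_law)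
       = ennreal (exp (f t * g t / \<sigma>\<^sup>2))" .
  qed
  finally show ?thesis .
qed

text \<open>All \<open>n div m * m\<close> observations are independent, and integrating the noise
  out of one of them leaves only the cross term \<open>f t * g t / \<sigma>\<^sup>2\<close>. The
  factor is \<open>1\<close> for disjoint bumps and an exponential moment of the squared bump for
  \<open>f = g\<close>.\<close>

lemma nn_integral_joint_lr_mult:
  assumes \<sigma>: "0 < \<sigma>" and f[measurable]: "f \<in> borel_measurable borel" and g[measurable]: "g \<in> borel_measurable borel"
  shows "(\<integral>\<^sup>+D. ennreal ((\<Prod>i\<in>{1..m}. local_lr \<sigma> (n div m) f (D i)) * (\<Prod>i\<in>{1..m}. local_lr \<sigma> (n div m) g (D i)))
      \<partial>joint_law \<sigma> n m (\<lambda>_. 0))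
    = (\<integral>\<^sup>+t. ennreal (exp (f t * g t / \<sigma>\<^sup>2)) \<partial>design_law) ^ (n div m * m)"
proof -
  let ?p = "n div m" and ?\<mu> = "local_law \<sigma> (n div m) (\<lambda>_. 0)"
  interpret O: product_prob_space "\<lambda>_::nat. obs_law \<sigma> (\<lambda>_. 0)"
    by (intro product_prob_spaceI prob_space_obs_law) simp
  interpret L: product_prob_space "\<lambda>_::nat. ?\<mu>"
    by (intro product_prob_spaceI prob_space_local_law) simp
  have obs0: "0 \<le> obs_lr \<sigma> h z" for h z by (simp add: obs_lr_def)
  have "(\<integral>\<^sup>+D. ennreal ((\<Prod>i\<in>{1..m}. local_lr \<sigma> ?p f (D i)) * (\<Prod>i\<in>{1..m}. local_lr \<sigma> ?p g (D i))) \<partial>joint_law \<sigma> n m (\<lambda>_. 0))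
    = (\<integral>\<^sup>+D. (\<Prod>i\<in>{1..m}. ennreal (local_lr \<sigma> ?p f (D i) * local_lr \<sigma> ?p g (D i))) \<partial>joint_law \<sigma> n m (\<lambda>_. 0))"
    by (simp add: prod_ennreal local_lr_nonneg prod.distrib)
  also have "\<dots> = (\<Prod>i\<in>{1..m}. \<integral>\<^sup>+d. ennreal (local_lr \<sigma> ?p f d * local_lr \<sigma> ?p g d) \<partial>?\<mu>)"
    unfolding joint_law_def by (rule L.product_nn_integral_prod) auto
  also have "(\<integral>\<^sup>+d. ennreal (local_lr \<sigma> ?p f d * local_lr \<sigma> ?p g d) \<partial>?\<mu>)
      = (\<integral>\<^sup>+d. (\<Prod>l\<in>{1..?p}. ennreal (obs_lr \<sigma> f (d l) * obs_lr \<sigma> g (d l))) \<partial>?\<mu>)"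
    by (simp add: local_lr_def prod_ennreal obs0 prod.distrib)
  also have "\<dots> = (\<Prod>l\<in>{1..?p}. \<integral>\<^sup>+z. ennreal (obs_lr \<sigma> f z * obs_lr \<sigma> g z) \<partial>obs_law \<sigma> (\<lambda>_. 0))"
    by (rule O.product_nn_integral_prod) auto
  finally show ?thesis
    by (simp add: nn_integral_obs_lr_mult[OF assms] power_mult)
qed

text \<open>In the second moment of the mixture of the likelihood ratios the off-diagonal terms are exactly
  \<open>1\<close>.\<close>

lemma mixture_close:
  assumes \<sigma>: "0 < \<sigma>" and Q: "finite Q" "Q \<noteq> {}"
    and f[measurable]: "\<And>q. f q \<in> borel_measurable borel"
    and disj: "\<And>q q' x. q \<in> Q \<Longrightarrow> q' \<in> Q \<Longrightarrow> q \<noteq> q' \<Longrightarrow> f q x * f q' x = 0"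
    and bdd: "\<And>q x. q \<in> Q \<Longrightarrow> \<bar>f q x\<bar> \<le> \<sigma>" and \<delta>: "0 \<le> \<delta>"
    and L2: "\<And>q. q \<in> Q \<Longrightarrow> (\<integral>\<^sup>+x\<in>{0..1}. ennreal ((f q x)\<^sup>2) \<partial>lborel) \<le> ennreal \<delta>"
    and small: "exp (2 * real n * \<delta> / \<sigma>\<^sup>2) \<le> real (card Q) / 4"
    and E: "E \<in> sets (data_space n m)"
  shows "\<exists>q\<in>Q. emeasure (joint_law \<sigma> n m (f q)) E \<le> emeasure (joint_law \<sigma> n m (\<lambda>_. 0)) E + ennreal (1/2)"
proof -
  let ?J = "joint_law \<sigma> n m (\<lambda>_. 0)"
  define L where "L q D = (\<Prod>i\<in>{1..m}. local_lr \<sigma> (n div m) (f q) (D i))" for q D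
  define N where "N = real (card Q)"
  define G where "G D = (\<Sum>q\<in>Q. L q D) / N" for D
  have N: "0 < N" using Q by (simp add: N_def card_gt_0_iff)
  have L0: "0 \<le> L q D" for q D unfolding L_def by (intro prod_nonneg) (auto simp: local_lr_nonneg)
  have G0: "0 \<le> G D" for D unfolding G_def using N L0 by (intro divide_nonneg_pos sum_nonneg) auto
  have Lm[measurable]: "L q \<in> borel_measurable ?J" for q unfolding L_def by measurable
  have Gm[measurable]: "G \<in> borel_measurable ?J" unfolding G_def by measurable
  interpret J: prob_space ?J by (rule prob_space_joint_law) simp
  have EJ[measurable]: "E \<in> sets ?J" using E by (simp add: sets_joint_law)
  have PE: "emeasure (joint_law \<sigma> n m (f q)) F = (\<integral>\<^sup>+D. ennreal (L q D) * indicator F D \<partial>?J)" if "F \<in> sets ?J" for q F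
    unfolding L_def by (subst joint_law_density[OF \<sigma> f]) (use that in \<open>auto intro!: emeasure_density\<close>)
  have L1: "(\<integral>\<^sup>+D. ennreal (L q D) \<partial>?J) = 1" for q
  proof -
    interpret P: prob_space "joint_law \<sigma> n m (f q)" by (rule prob_space_joint_law[OF f])
    have sp: "space (joint_law \<sigma> n m (f q)) = space ?J" by (rule sets_eq_imp_space_eq) (simp add: sets_joint_law)
    have "(\<integral>\<^sup>+D. ennreal (L q D) \<partial>?J) = (\<integral>\<^sup>+D. ennreal (L q D) * indicator (space ?J) D \<partial>?J)"
      by (intro nn_integral_cong) auto
    also have "\<dots> = emeasure (joint_law \<sigma> n m (f q)) (space ?J)" by (rule PE[symmetric]) simp
    finally show ?thesis using P.emeasure_space_1 sp by simp
  qed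
  have avg: "(\<integral>\<^sup>+D. ennreal (G D) * h D \<partial>?J) = ennreal (1 / N) * (\<Sum>q\<in>Q. \<integral>\<^sup>+D. ennreal (L q D) * h D \<partial>?J)"
    if [measurable]: "h \<in> borel_measurable ?J" for h
  proof -
    have "ennreal (G D) * h D = ennreal (1 / N) * (\<Sum>q\<in>Q. ennreal (L q D) * h D)" for D
    proof -
      have "ennreal (G D) = ennreal (1 / N) * (\<Sum>q\<in>Q. ennreal (L q D))"
        using N L0 by (simp add: G_def sum_ennreal ennreal_mult'[symmetric])
      then show ?thesis by (simp add: sum_distrib_right mult.assoc)
    qed
    then show ?thesis by (simp add: nn_integral_cmult nn_integral_sum)
  qed
  have LL: "(\<integral>\<^sup>+D. ennreal (L q D * L q' D) \<partial>?J) \<le> ennreal (1 + (if q = q' then exp (2 * real n * \<delta> / \<sigma>\<^sup>2) else 0))"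
    if q: "q \<in> Q" "q' \<in> Q" for q q'
  proof (cases "q = q'")
    case False
    interpret D: prob_space design_law by (rule prob_space_design_law)
    have "f q t * f q' t = 0" for t by (rule disj[OF q False])
    then have "(\<integral>\<^sup>+t. ennreal (exp (f q t * f q' t / \<sigma>\<^sup>2)) \<partial>design_law) = 1"
      using D.emeasure_space_1 by (simp only: div_0 exp_zero ennreal_1 nn_integral_const mult_1)
    with False show ?thesis
      unfolding L_def by (simp add: nn_integral_joint_lr_mult[OF \<sigma> f f])
  next
    case True
    have "(\<integral>\<^sup>+t. ennreal (exp (f q t * f q t / \<sigma>\<^sup>2)) \<partial>design_law) \<le> ennreal (exp (2 * \<delta> / \<sigma>\<^sup>2))"
      using nn_integral_exp_square_design_law[OF f \<sigma> bdd[OF q(1)] \<delta> L2[OF q(1)]] by (simp add: power2_eq_square)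
    then have "(\<integral>\<^sup>+D. ennreal (L q D * L q' D) \<partial>?J) \<le> ennreal (exp (2 * \<delta> / \<sigma>\<^sup>2)) ^ (n div m * m)"
      unfolding L_def True[symmetric] by (subst nn_integral_joint_lr_mult[OF \<sigma> f f]) (intro power_mono, auto)
    also have "\<dots> = ennreal (exp (2 * \<delta> / \<sigma>\<^sup>2 * real (n div m * m)))"
      by (simp add: ennreal_power exp_of_nat_mult[symmetric] mult.commute)
    also have "\<dots> \<le> ennreal (1 + exp (2 * real n * \<delta> / \<sigma>\<^sup>2))"
    proof (intro ennreal_leI)
      have "n div m * m \<le> n" using div_mult_mod_eq[of n m] by linarith
      then have "real (n div m * m) \<le> real n" by (rule of_nat_mono)
      then have "2 * \<delta> / \<sigma>\<^sup>2 * real (n div m * m) \<le> 2 * \<delta> / \<sigma>\<^sup>2 * real n" using \<delta> by (intro mult_left_mono) auto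
      then have "exp (2 * \<delta> / \<sigma>\<^sup>2 * real (n div m * m)) \<le> exp (2 * real n * \<delta> / \<sigma>\<^sup>2)" by (simp add: mult.commute mult.left_commute)
      then show "exp (2 * \<delta> / \<sigma>\<^sup>2 * real (n div m * m)) \<le> 1 + exp (2 * real n * \<delta> / \<sigma>\<^sup>2)" by linarith
    qed
    finally show ?thesis using True by simp
  qed
  have "(\<integral>\<^sup>+D. ennreal (G D) * indicator E D \<partial>?J) \<le> emeasure ?J E + ennreal (1/2)"
  proof (rule J.density_event_le)
    show "(\<integral>\<^sup>+D. ennreal (G D) \<partial>?J) = 1"
      using avg[of "\<lambda>_. 1"] N by (simp add: L1 N_def ennreal_of_nat_eq_real_of_nat ennreal_mult[symmetric])
    have "(\<integral>\<^sup>+D. ennreal ((G D)\<^sup>2) \<partial>?J) = (\<integral>\<^sup>+D. ennreal (1 / N\<^sup>2) * (\<Sum>q\<in>Q. \<Sum>q'\<in>Q. ennreal (L q D * L q' D)) \<partial>?J)"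
    proof (rule nn_integral_cong)
      fix D
      have "(G D)\<^sup>2 = 1 / N\<^sup>2 * (\<Sum>q\<in>Q. \<Sum>q'\<in>Q. L q D * L q' D)"
        by (simp add: G_def power2_eq_square sum_product)
      then show "ennreal ((G D)\<^sup>2) = ennreal (1 / N\<^sup>2) * (\<Sum>q\<in>Q. \<Sum>q'\<in>Q. ennreal (L q D * L q' D))"
        using L0 by (simp add: sum_ennreal sum_nonneg ennreal_mult'[symmetric])
    qed
    also have "\<dots> = ennreal (1 / N\<^sup>2) * (\<Sum>q\<in>Q. \<Sum>q'\<in>Q. \<integral>\<^sup>+D. ennreal (L q D * L q' D) \<partial>?J)"
      by (simp add: nn_integral_cmult nn_integral_sum)
    also have "\<dots> \<le> ennreal (1 / N\<^sup>2) * (\<Sum>q\<in>Q. \<Sum>q'\<in>Q. ennreal (1 + (if q = q' then exp (2 * real n * \<delta> / \<sigma>\<^sup>2) else 0)))"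
      by (intro mult_left_mono sum_mono LL) auto
    also have "\<dots> = ennreal (1 / N\<^sup>2 * (\<Sum>q\<in>Q. \<Sum>q'\<in>Q. 1 + (if q = q' then exp (2 * real n * \<delta> / \<sigma>\<^sup>2) else 0)))"
      by (simp add: sum_ennreal sum_nonneg ennreal_mult'[symmetric] del: ennreal_plus)
    also have "(\<Sum>q\<in>Q. \<Sum>q'\<in>Q. 1 + (if q = q' then exp (2 * real n * \<delta> / \<sigma>\<^sup>2) else 0)) = N * (N + exp (2 * real n * \<delta> / \<sigma>\<^sup>2))"
      using Q by (simp add: sum.distrib N_def algebra_simps)
    \<comment> \<open>Only the diagonal adds to the value \<open>1\<close>. By \<open>small\<close>
      its share is at most \<open>1/4\<close>, which is \<open>\<eta>\<^sup>2\<close> for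
      \<open>\<eta> = 1/2\<close>.\<close>
    also have "ennreal (1 / N\<^sup>2 * (N * (N + exp (2 * real n * \<delta> / \<sigma>\<^sup>2)))) \<le> ennreal (1 + (1/2)\<^sup>2)"
    proof (intro ennreal_leI)
      have "1 / N\<^sup>2 * (N * (N + exp (2 * real n * \<delta> / \<sigma>\<^sup>2))) = 1 + exp (2 * real n * \<delta> / \<sigma>\<^sup>2) / N"
        using N by (simp add: power2_eq_square field_simps)
      also have "\<dots> \<le> 1 + (1/2)\<^sup>2" using small N by (simp add: N_def power2_eq_square field_simps)
      finally show "1 / N\<^sup>2 * (N * (N + exp (2 * real n * \<delta> / \<sigma>\<^sup>2))) \<le> 1 + (1/2)\<^sup>2" .
    qed
    finally show "(\<integral>\<^sup>+D. ennreal ((G D)\<^sup>2) \<partial>?J) \<le> ennreal (1 + (1/2)\<^sup>2)" .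
  qed (auto simp: G0)
  then have mix: "ennreal (1 / N) * (\<Sum>q\<in>Q. emeasure (joint_law \<sigma> n m (f q)) E) \<le> emeasure ?J E + ennreal (1/2)"
    by (simp add: avg PE[OF EJ])
  have fin: "emeasure (joint_law \<sigma> n m (f q)) E = ennreal (measure (joint_law \<sigma> n m (f q)) E)" for q
  proof -
    interpret P: prob_space "joint_law \<sigma> n m (f q)" by (rule prob_space_joint_law[OF f])
    show ?thesis by (rule P.emeasure_eq_measure)
  qed
  define b where "b = measure ?J E + 1/2"
  have rb: "emeasure ?J E + ennreal (1/2) = ennreal b"
    unfolding b_def J.emeasure_eq_measure by (rule ennreal_plus[symmetric]) auto
  have "ennreal (1 / N * (\<Sum>q\<in>Q. measure (joint_law \<sigma> n m (f q)) E)) \<le> ennreal b"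
    using mix N unfolding rb by (simp add: fin sum_ennreal ennreal_mult'[symmetric])
  then have "1 / N * (\<Sum>q\<in>Q. measure (joint_law \<sigma> n m (f q)) E) \<le> b"
    by (subst (asm) ennreal_le_iff) (auto simp: b_def)
  then have le: "(\<Sum>q\<in>Q. measure (joint_law \<sigma> n m (f q)) E) \<le> N * b" using N by (simp add: field_simps)
  \<comment> \<open>The bound for the mixture is a bound on the average over \<open>q\<close>, so
    some bump satisfies it; this bump depends on the event \<open>E\<close>.\<close>
  have "\<exists>q\<in>Q. measure (joint_law \<sigma> n m (f q)) E \<le> b"
  proof (rule ccontr)
    assume "\<not> ?thesis"
    then have "(\<Sum>q\<in>Q. b) < (\<Sum>q\<in>Q. measure (joint_law \<sigma> n m (f q)) E)" using Q by (intro sum_strict_mono) auto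
    with le show False by (simp add: N_def)
  qed
  then obtain q where "q \<in> Q" "measure (joint_law \<sigma> n m (f q)) E \<le> b" by blast
  then show ?thesis
    unfolding rb fin by (intro bexI[of _ q] ennreal_leI)
qed

section \<open>Wavelet bumps\<close>

text \<open>\<open>w\<close> is a finite combination of the functions
  \<open>\<phi> (2 * x - n)\<close>. If \<open>2 * x - n\<close> and \<open>n\<close> both lie
  between \<open>1 - N\<close> and \<open>N\<close>, so does their average \<open>x\<close>; hence
  \<open>w\<close> inherits the support interval of \<open>\<phi>\<close>.\<close>

lemma daubechies_wavelet_props:
  assumes "daubechies_pair N \<phi> w"
  obtains M where "w \<in> borel_measurable borel" "0 < M" "\<And>x. \<bar>w x\<bar> \<le> M"
    "\<And>x. x \<notin> {1 - real N..real N} \<Longrightarrow> w x = 0"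
proof -
  from assms have [measurable]: "\<phi> \<in> borel_measurable borel" and bdd: "bounded (range \<phi>)"
    and supp: "\<And>x. x \<notin> {1 - real N..real N} \<Longrightarrow> \<phi> x = 0"
    by (auto simp: daubechies_pair_def)
  from assms obtain h :: "int \<Rightarrow> real" where
    w: "\<And>x. w x = sqrt 2 * (\<Sum>n\<in>{1 - int N..int N}. ((- 1) powi n) * h (1 - n) * \<phi> (2 * x - of_int n))"
    unfolding daubechies_pair_def by blast
  from bdd obtain b where b: "\<And>x. \<bar>\<phi> x\<bar> \<le> b" by (auto simp: bounded_iff)
  define M where "M = sqrt 2 * (\<Sum>n\<in>{1 - int N..int N}. \<bar>((- 1) powi n) * h (1 - n)\<bar> * b) + 1"
  have b0: "0 \<le> b" using b[of 0] by linarith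
  show ?thesis
  proof (rule that)
    show "w \<in> borel_measurable borel" unfolding w[abs_def] by measurable
    show "0 < M" unfolding M_def using b0 by (intro add_nonneg_pos mult_nonneg_nonneg sum_nonneg) auto
    show "\<bar>w x\<bar> \<le> M" for x
    proof -
      have "\<bar>w x\<bar> = sqrt 2 * \<bar>\<Sum>n\<in>{1 - int N..int N}. ((- 1) powi n) * h (1 - n) * \<phi> (2 * x - of_int n)\<bar>"
        by (simp add: w abs_mult)
      also have "\<dots> \<le> sqrt 2 * (\<Sum>n\<in>{1 - int N..int N}. \<bar>((- 1) powi n) * h (1 - n)\<bar> * b)"
        by (intro mult_left_mono order_trans[OF sum_abs] sum_mono) (auto simp: abs_mult intro!: mult_left_mono b)
      finally show ?thesis by (simp add: M_def)
    qed
    show "w x = 0" if x: "x \<notin> {1 - real N..real N}" for x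
    proof -
      have "\<phi> (2 * x - of_int n) = 0" if n: "n \<in> {1 - int N..int N}" for n
      proof (rule supp)
        have "1 - real N \<le> of_int n" "of_int n \<le> real N"
          using n by (simp_all only: atLeastAtMost_iff) linarith+
        then show "2 * x - of_int n \<notin> {1 - real N..real N}" using x by auto
      qed
      then show ?thesis by (simp add: w)
    qed
  qed
qed

text \<open>The bumps are taken among the wavelets away from both edges, since these are dilated
  translates of a single bounded function.\<close>

lemma cdv_interior_wavelets:
  assumes "cdv_basis N j0 J \<psi>"
  obtains w M where "w \<in> borel_measurable borel" "0 < M" "\<And>x. \<bar>w x\<bar> \<le> M"
    "\<And>x. x \<notin> {1 - real N..real N} \<Longrightarrow> w x = 0"
    "\<And>j k. J \<le> j \<Longrightarrow> N \<le> k \<Longrightarrow> k + N < 2 ^ j \<Longrightarrow> \<psi> j k = (\<lambda>x. 2 powr (real j / 2) * w (2 ^ j * x - real k))"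
proof -
  from assms obtain \<phi> w \<phi>l wl \<phi>r wr where dp: "daubechies_pair N \<phi> w"
    and lev: "\<And>j k. J \<le> j \<Longrightarrow> k < 2 ^ j \<Longrightarrow> \<psi> j k = level_fun N w wl wr j k"
    unfolding cdv_basis_def by blast
  obtain M where M: "w \<in> borel_measurable borel" "0 < M" "\<And>x. \<bar>w x\<bar> \<le> M"
    "\<And>x. x \<notin> {1 - real N..real N} \<Longrightarrow> w x = 0"
    using daubechies_wavelet_props[OF dp] by blast
  show ?thesis
  proof (rule that[OF M])
    fix j k assume "J \<le> j" "N \<le> k" "k + N < 2 ^ j"
    then show "\<psi> j k = (\<lambda>x. 2 powr (real j / 2) * w (2 ^ j * x - real k))"
      using lev[of j k] by (auto simp: level_fun_def fun_eq_iff)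
  qed
qed

text \<open>The step \<open>2 * N\<close> exceeds the length \<open>2 * N - 1\<close> of the support
  interval, which makes the bumps disjoint; the offset \<open>N\<close> skips the left edge
  functions, and the divisor \<open>4 * N\<close> keeps the last bump away from the right edge.
  Beyond the range the zero function keeps the family measurable at every index.\<close>

definition bump :: "nat \<Rightarrow> (nat \<Rightarrow> nat \<Rightarrow> real \<Rightarrow> real) \<Rightarrow> real \<Rightarrow> nat \<Rightarrow> nat \<Rightarrow> real \<Rightarrow> real" where
  "bump N \<psi> d j q = (if q < 2 ^ j div (4 * N) then (\<lambda>x. d * \<psi> j (N + 2 * N * q) x) else (\<lambda>_. 0))"

lemma zero_in_besov_ball:
  assumes "0 < L"
  shows "(\<lambda>_. 0) \<in> besov_ball j0 J \<psi> s L"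
proof -
  have "besov_norm j0 J \<psi> s (\<lambda>_. 0) \<le> 0"
    unfolding besov_norm_def by (intro SUP_least) (auto simp: inner_01_def)
  then have "besov_norm j0 J \<psi> s (\<lambda>_. 0) < ennreal L" using assms by simp
  then show ?thesis by (simp add: besov_ball_def L2_01_def set_integrable_def)
qed

context
  fixes N j0 J :: nat and \<psi> :: "nat \<Rightarrow> nat \<Rightarrow> real \<Rightarrow> real" and w :: "real \<Rightarrow> real" and M :: real and j :: nat
  assumes cdv: "cdv_basis N j0 J \<psi>"
    and w[measurable]: "w \<in> borel_measurable borel" and M: "0 < M" "\<And>x. \<bar>w x\<bar> \<le> M"
    and supp: "\<And>x. x \<notin> {1 - real N..real N} \<Longrightarrow> w x = 0"
    and \<psi>w: "\<And>j k. J \<le> j \<Longrightarrow> N \<le> k \<Longrightarrow> k + N < 2 ^ j \<Longrightarrow> \<psi> j k = (\<lambda>x. 2 powr (real j / 2) * w (2 ^ j * x - real k))"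
    and j: "J \<le> j"
begin

lemma N_pos: "0 < N"
  using cdv by (simp add: cdv_basis_def)

lemma bump_index:
  assumes "q < 2 ^ j div (4 * N)"
  shows "N + 2 * N * q + N < 2 ^ j"
proof -
  have "4 * N * (q + 1) \<le> 4 * N * (2 ^ j div (4 * N))" using assms by (intro mult_left_mono) auto
  also have "\<dots> \<le> 2 ^ j" by simp
  finally have "4 * N * (q + 1) \<le> 2 ^ j" .
  moreover have "N + 2 * N * q + N < 4 * N * (q + 1)" using N_pos by (simp add: algebra_simps)
  ultimately show ?thesis by linarith
qed

lemma bump_eq:
  assumes "q < 2 ^ j div (4 * N)"
  shows "bump N \<psi> d j q = (\<lambda>x. d * (2 powr (real j / 2) * w (2 ^ j * x - real (N + 2 * N * q))))"
  using assms \<psi>w[OF j _ bump_index[OF assms]] by (simp add: bump_def)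

lemma bump_measurable: "bump N \<psi> d j q \<in> borel_measurable borel"
proof (cases "q < 2 ^ j div (4 * N)")
  case True
  show ?thesis unfolding bump_eq[OF True] by measurable
qed (simp add: bump_def)

lemma bump_bound:
  assumes "q < 2 ^ j div (4 * N)" "0 \<le> d"
  shows "\<bar>bump N \<psi> d j q x\<bar> \<le> d * 2 powr (real j / 2) * M"
  using assms M(2) by (simp add: bump_eq abs_mult mult.assoc mult_left_mono)

lemma bump_support:
  assumes "q < 2 ^ j div (4 * N)" "bump N \<psi> d j q x \<noteq> 0"
  shows "2 ^ j * x - real (N + 2 * N * q) \<in> {1 - real N..real N}"
  using assms(2) supp unfolding bump_eq[OF assms(1)] by (metis mult_zero_right)

lemma bump_disjoint:
  assumes q: "q < 2 ^ j div (4 * N)" "q' < 2 ^ j div (4 * N)" "q \<noteq> q'"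
  shows "bump N \<psi> d j q x * bump N \<psi> d j q' x = 0"
proof (rule ccontr)
  assume "\<not> ?thesis"
  then have ne: "bump N \<psi> d j q x \<noteq> 0" "bump N \<psi> d j q' x \<noteq> 0" by auto
  have *: False if "q < q'" "2 ^ j * x - real (N + 2 * N * q) \<in> {1 - real N..real N}"
    "2 ^ j * x - real (N + 2 * N * q') \<in> {1 - real N..real N}" for q q'
  proof -
    have "real (2 * N * q') \<ge> real (2 * N * (q + 1))" using that(1) by (intro of_nat_mono mult_left_mono) auto
    then have "real (2 * N * q') \<ge> real (2 * N * q) + 2 * real N" by (simp add: algebra_simps)
    with that(2,3) show False by auto
  qed
  show False
    using *[of q q'] *[of q' q] bump_support[OF q(1) ne(1)] bump_support[OF q(2) ne(2)] q(3)
    by (meson linorder_neqE_nat)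
qed

lemma psi_index:
  assumes "q < 2 ^ j div (4 * N)"
  shows "(j, N + 2 * N * q) \<in> wavelet_indices j0 J"
  using bump_index[OF assms] j by (auto simp: wavelet_indices_def)

lemma psi_inner:
  assumes "a \<in> wavelet_indices j0 J" "b \<in> wavelet_indices j0 J"
  shows "inner_01 (case a of (j, k) \<Rightarrow> \<psi> j k) (case b of (j, k) \<Rightarrow> \<psi> j k) = (if a = b then 1 else 0)"
  using cdv assms unfolding cdv_basis_def orthonormal_basis_01_def by blast

lemma psi_square:
  assumes q: "q < 2 ^ j div (4 * N)"
  shows "set_integrable lborel {0..1} (\<lambda>x. (\<psi> j (N + 2 * N * q) x)\<^sup>2)"
    and "(LINT x:{0..1}|lborel. (\<psi> j (N + 2 * N * q) x)\<^sup>2) = 1"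
proof -
  show one: "(LINT x:{0..1}|lborel. (\<psi> j (N + 2 * N * q) x)\<^sup>2) = 1"
    using psi_inner[OF psi_index[OF q] psi_index[OF q]] by (simp add: inner_01_def power2_eq_square)
  \<comment> \<open>A nonintegrable function would have integral \<open>0\<close>, not
    \<open>1\<close>.\<close>
  show "set_integrable lborel {0..1} (\<lambda>x. (\<psi> j (N + 2 * N * q) x)\<^sup>2)"
    using one not_integrable_integral_eq unfolding set_integrable_def set_lebesgue_integral_def by fastforce
qed

lemma bump_L2:
  assumes q: "q < 2 ^ j div (4 * N)"
  shows "set_integrable lborel {0..1} (\<lambda>x. (bump N \<psi> d j q x)\<^sup>2)"
    and "(\<integral>\<^sup>+x\<in>{0..1}. ennreal ((bump N \<psi> d j q x)\<^sup>2) \<partial>lborel) = ennreal (d\<^sup>2)"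
proof -
  have eq: "(bump N \<psi> d j q x)\<^sup>2 = d\<^sup>2 * (\<psi> j (N + 2 * N * q) x)\<^sup>2" for x
    using q by (simp add: bump_def power_mult_distrib)
  show int: "set_integrable lborel {0..1} (\<lambda>x. (bump N \<psi> d j q x)\<^sup>2)"
    unfolding eq using psi_square(1)[OF q] by (rule set_integrable_mult_right)
  have "(\<integral>\<^sup>+x\<in>{0..1}. ennreal ((bump N \<psi> d j q x)\<^sup>2) \<partial>lborel)
      = (\<integral>\<^sup>+x. ennreal (indicator {0..1} x *\<^sub>R (bump N \<psi> d j q x)\<^sup>2) \<partial>lborel)"
    by (intro nn_integral_cong) (auto simp: indicator_def)
  also have "\<dots> = ennreal (LINT x:{0..1}|lborel. (bump N \<psi> d j q x)\<^sup>2)"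
    unfolding set_lebesgue_integral_def using int unfolding set_integrable_def
    by (intro nn_integral_eq_integral) auto
  also have "(LINT x:{0..1}|lborel. (bump N \<psi> d j q x)\<^sup>2) = d\<^sup>2"
    unfolding eq using psi_square(2)[OF q] by simp
  finally show "(\<integral>\<^sup>+x\<in>{0..1}. ennreal ((bump N \<psi> d j q x)\<^sup>2) \<partial>lborel) = ennreal (d\<^sup>2)" .
qed

text \<open>By orthonormality the only possibly nonzero coefficient of a bump is \<open>d\<close>,
  at its own index, so the supremum in the Besov norm has a single term to control.\<close>

lemma bump_in_besov_ball:
  assumes q: "q < 2 ^ j div (4 * N)" and d: "0 \<le> d" "2 powr (real j * (s + 1 / 2)) * d < L"
  shows "bump N \<psi> d j q \<in> besov_ball j0 J \<psi> s L"
proof -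
  let ?k = "N + 2 * N * q"
  have b: "bump N \<psi> d j q = (\<lambda>x. d * \<psi> j ?k x)" using q by (simp add: bump_def)
  have "besov_norm j0 J \<psi> s (bump N \<psi> d j q) \<le> ennreal (2 powr (real j * (s + 1 / 2)) * d)"
    unfolding besov_norm_def
  proof (rule SUP_least, safe)
    fix j' k' assume i: "(j', k') \<in> wavelet_indices j0 J"
    have "inner_01 (bump N \<psi> d j q) (\<psi> j' k') = d * inner_01 (\<psi> j ?k) (\<psi> j' k')"
      unfolding b inner_01_def by (simp add: mult.assoc)
    also have "inner_01 (\<psi> j ?k) (\<psi> j' k') = (if (j, ?k) = (j', k') then 1 else 0)"
      using psi_inner[OF psi_index[OF q] i] by simp
    finally show "ennreal (2 powr (real j' * (s + 1 / 2)) * \<bar>inner_01 (bump N \<psi> d j q) (\<psi> j' k')\<bar>)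
        \<le> ennreal (2 powr (real j * (s + 1 / 2)) * d)"
      using d by (auto intro!: ennreal_leI)
  qed
  also have "\<dots> < ennreal L"
    using d by (intro ennreal_lessI) (meson le_less_trans mult_nonneg_nonneg powr_ge_zero, simp)
  finally show ?thesis
    using bump_L2(1)[OF q] by (simp add: besov_ball_def L2_01_def bump_measurable)
qed

text \<open>The bump has mass \<open>d\<^sup>2\<close> on an interval of length less than \<open>2 N / 2 ^ j\<close>.\<close>

lemma bump_sup_norm:
  assumes q: "q < 2 ^ j div (4 * N)" and d: "0 \<le> d"
  shows "ennreal (d * sqrt (2 ^ j / (2 * real N))) \<le> sup_norm_01 (bump N \<psi> d j q)"
proof (cases "sup_norm_01 (bump N \<psi> d j q)")
  case top
  then show ?thesis by simp
next
  case (real c)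
  let ?k = "real (N + 2 * N * q)"
  define I where "I = {(?k + 1 - real N) / 2 ^ j..(?k + real N) / 2 ^ j}"
  have "AE x in restrict_space lborel {0..1}. ennreal \<bar>bump N \<psi> d j q x\<bar> \<le> ennreal c"
    using esssup_AE[of "\<lambda>x. ennreal \<bar>bump N \<psi> d j q x\<bar>" "restrict_space lborel {0..1}"] real(2)
    by (simp add: sup_norm_01_def)
  then have ae: "AE x in lborel. x \<in> {0..1} \<longrightarrow> \<bar>bump N \<psi> d j q x\<bar> \<le> c"
    using real(1) by (subst (asm) AE_restrict_space_iff) auto
  have "ennreal (d\<^sup>2) = (\<integral>\<^sup>+x\<in>{0..1}. ennreal ((bump N \<psi> d j q x)\<^sup>2) \<partial>lborel)"
    by (rule bump_L2(2)[OF q, symmetric])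
  also have "\<dots> \<le> (\<integral>\<^sup>+x. ennreal (c\<^sup>2) * indicator I x \<partial>lborel)"
  proof (rule nn_integral_mono_AE)
    show "AE x in lborel. ennreal ((bump N \<psi> d j q x)\<^sup>2) * indicator {0..1} x \<le> ennreal (c\<^sup>2) * indicator I x"
      using ae
    proof eventually_elim
      case (elim x)
      show ?case
      proof (cases "x \<in> {0..1} \<and> bump N \<psi> d j q x \<noteq> 0")
        case True
        then have "(bump N \<psi> d j q x)\<^sup>2 \<le> c\<^sup>2" using elim by (metis abs_ge_zero power2_abs power_mono)
        moreover have "x \<in> I"
          using bump_support[OF q, of d x] True unfolding I_def
          by (simp only: atLeastAtMost_iff) (simp add: field_simps)
        ultimately show ?thesis using True by (auto intro!: ennreal_leI)
      qed auto
    qed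
  qed
  also have "\<dots> = ennreal (c\<^sup>2) * emeasure lborel I" unfolding I_def by (subst nn_integral_cmult_indicator) auto
  also have "emeasure lborel I = ennreal ((2 * real N - 1) / 2 ^ j)"
    unfolding I_def using N_pos
    by (subst emeasure_lborel_Icc) (auto simp: divide_right_mono diff_divide_distrib[symmetric] algebra_simps)
  also have "ennreal (c\<^sup>2) * \<dots> = ennreal (c\<^sup>2 * ((2 * real N - 1) / 2 ^ j))"
    using N_pos by (intro ennreal_mult[symmetric]) auto
  finally have "d\<^sup>2 \<le> c\<^sup>2 * ((2 * real N - 1) / 2 ^ j)"
    using N_pos by (subst (asm) ennreal_le_iff) auto
  also have "\<dots> \<le> c\<^sup>2 * (2 * real N / 2 ^ j)" by (intro mult_left_mono divide_right_mono) auto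
  finally have "d\<^sup>2 * (2 ^ j / (2 * real N)) \<le> c\<^sup>2" using N_pos by (simp add: field_simps)
  then have "sqrt (d\<^sup>2 * (2 ^ j / (2 * real N))) \<le> sqrt (c\<^sup>2)" by (rule real_sqrt_le_mono)
  moreover have "sqrt (d\<^sup>2 * (2 ^ j / (2 * real N))) = d * sqrt (2 ^ j / (2 * real N))"
    using d by (subst real_sqrt_mult) simp
  ultimately have "d * sqrt (2 ^ j / (2 * real N)) \<le> c" using real(1) by simp
  then show ?thesis using real by (simp add: ennreal_leI)
qed

text \<open>For \<open>x = 2 ^ j / (4 * N)\<close>, which is at least \<open>2\<close>, the floor of
  \<open>x\<close> is at least \<open>x - 1\<close> and hence at least \<open>x / 2\<close>.\<close>

lemma bump_count:
  assumes "8 * N \<le> 2 ^ j"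
  shows "2 ^ j / (8 * real N) \<le> real (2 ^ j div (4 * N))" "0 < 2 ^ j div (4 * N)"
proof -
  have "2 ^ j < 4 * N * (2 ^ j div (4 * N)) + 4 * N"
    using N_pos mod_less_divisor[of "4 * N" "2 ^ j"] mult_div_mod_eq[of "4 * N" "2 ^ j"] by linarith
  then have "real (2 ^ j) < real (4 * N * (2 ^ j div (4 * N)) + 4 * N)" by (simp only: of_nat_less_iff)
  then have "(2 ^ j :: real) < real (4 * N) * (real (2 ^ j div (4 * N)) + 1)" by (simp add: algebra_simps)
  then have "(2 ^ j :: real) / real (4 * N) - 1 \<le> real (2 ^ j div (4 * N))"
    using N_pos by (simp add: field_simps)
  moreover have "1 \<le> (2 ^ j :: real) / (8 * real N)"
    using assms N_pos by (simp add: field_simps) (metis of_nat_le_iff of_nat_mult of_nat_numeral of_nat_power)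
  moreover have "(2 ^ j :: real) / real (4 * N) = 2 * (2 ^ j / (8 * real N))" by simp
  ultimately show a: "2 ^ j / (8 * real N) \<le> real (2 ^ j div (4 * N))" by simp
  show "0 < 2 ^ j div (4 * N)"
    using a \<open>1 \<le> (2 ^ j :: real) / (8 * real N)\<close> by linarith
qed

end

section \<open>Risk bounds at a fixed resolution level\<close>

text \<open>The interface between the wavelets and the statistical argument, in terms of the
  dimension \<open>D = 2 ^ j\<close>. The constants \<open>c\<close> and \<open>M\<close> bound the
  height of a bump from below and from above on the same scale \<open>D powr (- s)\<close>.\<close>

definition bump_family ::
  "(real \<Rightarrow> real) set \<Rightarrow> real \<Rightarrow> real \<Rightarrow> real \<Rightarrow> real \<Rightarrow> real \<Rightarrow> (nat \<Rightarrow> real \<Rightarrow> real) \<Rightarrow> nat \<Rightarrow> bool"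
where
  "bump_family F s L c M D f Q \<longleftrightarrow>
     (\<forall>q. f q \<in> borel_measurable borel) \<and> (\<forall>q<Q. f q \<in> F) \<and>
     (\<forall>q<Q. \<forall>q'<Q. \<forall>x. q \<noteq> q' \<longrightarrow> f q x * f q' x = 0) \<and>
     (\<forall>q<Q. \<forall>x. \<bar>f q x\<bar> \<le> M * D powr (- s)) \<and>
     (\<forall>q<Q. (\<integral>\<^sup>+x\<in>{0..1}. ennreal ((f q x)\<^sup>2) \<partial>lborel) \<le> ennreal (L\<^sup>2 / 4 * D powr (- (2 * s + 1)))) \<and>
     (\<forall>q<Q. ennreal (c * D powr (- s)) \<le> sup_norm_01 (f q))"

lemma bump_familyD:
  assumes "bump_family F s L c M D f Q"
  shows "f q \<in> borel_measurable borel"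
    and "q < Q \<Longrightarrow> f q \<in> F"
    and "q < Q \<Longrightarrow> q' < Q \<Longrightarrow> q \<noteq> q' \<Longrightarrow> f q x * f q' x = 0"
    and "q < Q \<Longrightarrow> \<bar>f q x\<bar> \<le> M * D powr (- s)"
    and "q < Q \<Longrightarrow> (\<integral>\<^sup>+x\<in>{0..1}. ennreal ((f q x)\<^sup>2) \<partial>lborel) \<le> ennreal (L\<^sup>2 / 4 * D powr (- (2 * s + 1)))"
    and "q < Q \<Longrightarrow> ennreal (c * D powr (- s)) \<le> sup_norm_01 (f q)"
  using assms unfolding bump_family_def by blast+

lemma besov_bump_family:
  assumes cdv: "cdv_basis N j0 J \<psi>" and L: "0 < L"
  obtains c M where "0 < c" "0 < M" "0 < N"
    "\<And>j. J \<le> j \<Longrightarrow> 8 * N \<le> 2 ^ j \<Longrightarrow> \<exists>f Q. 0 < Q \<and> 2 ^ j / (8 * real N) \<le> real Q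
      \<and> bump_family (besov_ball j0 J \<psi> s L) s L c M (2 ^ j) f Q"
proof -
  obtain w M where w: "w \<in> borel_measurable borel" "0 < M" "\<And>x. \<bar>w x\<bar> \<le> M"
    "\<And>x. x \<notin> {1 - real N..real N} \<Longrightarrow> w x = 0"
    "\<And>j k. J \<le> j \<Longrightarrow> N \<le> k \<Longrightarrow> k + N < 2 ^ j \<Longrightarrow> \<psi> j k = (\<lambda>x. 2 powr (real j / 2) * w (2 ^ j * x - real k))"
    using cdv_interior_wavelets[OF cdv] by blast
  note ctx = cdv w
  have N: "0 < N" using cdv by (simp add: cdv_basis_def)
  show ?thesis
  proof (rule that[of "L / (2 * sqrt (2 * real N))" "L * M / 2"])
    fix j assume j: "J \<le> j" and j8: "8 * N \<le> 2 ^ j"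
    define D where "D = (2 ^ j :: real)"
    \<comment> \<open>The coefficient sits at half the radius because the ball is defined by a
      strict inequality; this is the origin of \<open>L\<^sup>2 / 4\<close>.\<close>
    define d where "d = L / 2 * D powr (- (s + 1 / 2))"
    have D: "0 < D" by (simp add: D_def)
    have d0: "0 \<le> d" using L by (simp add: d_def)
    have Dj: "2 powr (real j * e) = D powr e" for e
      by (simp add: D_def powr_realpow[symmetric] powr_powr)
    have half: "2 powr (real j / 2) = D powr (1 / 2)" using Dj[of "1/2"] by simp
    have ball: "2 powr (real j * (s + 1 / 2)) * d < L"
      using L D by (simp add: Dj d_def powr_add[symmetric] mult.left_commute[of _ "D powr _"])
    have sup: "L / (2 * sqrt (2 * real N)) * D powr (- s) = d * sqrt (D / (2 * real N))"
      using D N by (simp add: d_def real_sqrt_divide powr_half_sqrt[symmetric] powr_add[symmetric] field_simps)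
    have bnd: "d * 2 powr (real j / 2) * M = L * M / 2 * D powr (- s)"
      using D by (simp add: d_def half powr_add[symmetric] field_simps)
    have "- (s + 1 / 2) + - (s + 1 / 2) = - (2 * s + 1)" by simp
    then have "D powr (- (s + 1 / 2)) * D powr (- (s + 1 / 2)) = D powr (- (2 * s + 1))"
      by (simp only: powr_add[symmetric])
    then have sq: "d\<^sup>2 = L\<^sup>2 / 4 * D powr (- (2 * s + 1))"
      by (simp add: d_def power_mult_distrib power2_eq_square)
    let ?Q = "2 ^ j div (4 * N)"
    show "\<exists>f Q. 0 < Q \<and> 2 ^ j / (8 * real N) \<le> real Q
      \<and> bump_family (besov_ball j0 J \<psi> s L) s L (L / (2 * sqrt (2 * real N))) (L * M / 2) (2 ^ j) f Q"
      unfolding D_def[symmetric] bump_family_def sup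
    proof (intro exI[of _ "bump N \<psi> d j"] exI[of _ ?Q] conjI allI impI)
      show "0 < ?Q" "D / (8 * real N) \<le> real ?Q"
        using bump_count[OF ctx j j8] by (simp_all add: D_def)
      show "bump N \<psi> d j q \<in> borel_measurable borel" for q by (rule bump_measurable[OF ctx j])
      show "bump N \<psi> d j q \<in> besov_ball j0 J \<psi> s L" if "q < ?Q" for q
        by (rule bump_in_besov_ball[OF ctx j that d0 ball])
      show "bump N \<psi> d j q x * bump N \<psi> d j q' x = 0" if "q < ?Q" "q' < ?Q" "q \<noteq> q'" for q q' x
        by (rule bump_disjoint[OF ctx j that])
      show "\<bar>bump N \<psi> d j q x\<bar> \<le> L * M / 2 * D powr (- s)" if "q < ?Q" for q x
        unfolding bnd[symmetric] by (rule bump_bound[OF ctx j that d0])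
      show "(\<integral>\<^sup>+x\<in>{0..1}. ennreal ((bump N \<psi> d j q x)\<^sup>2) \<partial>lborel) \<le> ennreal (L\<^sup>2 / 4 * D powr (- (2 * s + 1)))"
        if "q < ?Q" for q
        using bump_L2(2)[OF ctx j that] by (simp add: sq)
      show "ennreal (d * sqrt (D / (2 * real N))) \<le> sup_norm_01 (bump N \<psi> d j q)" if "q < ?Q" for q
        unfolding D_def by (rule bump_sup_norm[OF ctx j that d0])
    qed
  qed (use L w(2) N in auto)
qed

text \<open>The four smallness conditions have separate purposes. The first bounds
  \<open>a * ln (8 * n)\<close> and makes it unlikely that the score exceeds the cap; the second
  puts enough local design points under a bump for its energy to concentrate; the third bounds the
  information in \<open>B\<close> expected bits; the fourth handles the remainder
  \<open>2 / n\<close> of the entropy bound.\<close>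

lemma minimax_risk_limited:
  assumes cdv: "cdv_basis N j0 J \<psi>" and L: "0 < L" and \<sigma>: "0 < \<sigma>"
  obtains \<kappa> c where "0 < \<kappa>" "0 < c"
    "\<And>n m B j. m dvd n \<Longrightarrow> 0 < m \<Longrightarrow> 2 \<le> n \<Longrightarrow> 0 \<le> B \<Longrightarrow> J \<le> j \<Longrightarrow> 8 * N \<le> 2 ^ j \<Longrightarrow>
      real n / real m * (2 ^ j) powr (- (2 * s + 1)) * ln (8 * real n) \<le> \<kappa> \<Longrightarrow>
      2 ^ j * ln (8 * real n) \<le> \<kappa> * (real n / real m) \<Longrightarrow>
      real n * B * ln (2 * real n) * (2 ^ j) powr (- (2 * s + 2)) \<le> \<kappa> \<Longrightarrow>
      (2 ^ j) powr (- (2 * s + 2)) \<le> \<kappa> \<Longrightarrow>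
      ennreal (c * (2 ^ j) powr (- s)) \<le> minimax_risk \<sigma> n m (\<lambda>_. B) (besov_ball j0 J \<psi> s L)"
proof -
  obtain c M where c: "0 < c" and M: "0 < M" and N: "0 < N"
    and fam: "\<And>j. J \<le> j \<Longrightarrow> 8 * N \<le> 2 ^ j \<Longrightarrow> \<exists>f Q. 0 < Q \<and> 2 ^ j / (8 * real N) \<le> real Q
      \<and> bump_family (besov_ball j0 J \<psi> s L) s L c M (2 ^ j) f Q"
    using besov_bump_family[OF cdv L, of s] by blast
  define C where "C = 4 * (exp 1)\<^sup>2 * L\<^sup>2 / \<sigma>\<^sup>2"
  have C: "0 < C" using L \<sigma> by (simp add: C_def)
  \<comment> \<open>The entries serve the score tail, the energy tail and the information bound, in
    this order. In the last one, \<open>256 = 8 * 32\<close> combines the \<open>8 * N\<close> of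
    the bump count with the \<open>1/32\<close> of the pigeonhole step, and \<open>3\<close>
    collects \<open>\<kappa> + 2 * \<kappa>\<close>.\<close>
  define \<kappa> where "\<kappa> = min (\<sigma>\<^sup>2 / (8 * L\<^sup>2)) (min (L\<^sup>2 / (2 * M\<^sup>2)) (1 / (3 * C * 256 * real N)))"
  have \<kappa>: "0 < \<kappa>" "\<kappa> \<le> \<sigma>\<^sup>2 / (8 * L\<^sup>2)" "\<kappa> \<le> L\<^sup>2 / (2 * M\<^sup>2)" "\<kappa> \<le> 1 / (3 * C * 256 * real N)"
    using L M \<sigma> C N by (auto simp: \<kappa>_def)
  show ?thesis
  proof (rule that[of \<kappa> "c / 8"])
    fix n m :: nat and B :: real and j
    assume dvd: "m dvd n" and m: "0 < m" and n: "2 \<le> n" and B: "0 \<le> B" and j: "J \<le> j" "8 * N \<le> 2 ^ j"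
      and h1: "real n / real m * (2 ^ j) powr (- (2 * s + 1)) * ln (8 * real n) \<le> \<kappa>"
      and h2: "2 ^ j * ln (8 * real n) \<le> \<kappa> * (real n / real m)"
      and h3: "real n * B * ln (2 * real n) * (2 ^ j) powr (- (2 * s + 2)) \<le> \<kappa>"
      and h4: "(2 ^ j) powr (- (2 * s + 2)) \<le> \<kappa>"
    define D where "D = (2 ^ j :: real)"
    have D: "0 < D" by (simp add: D_def)
    obtain f Q where Q: "0 < Q" "D / (8 * real N) \<le> real Q"
      and family: "bump_family (besov_ball j0 J \<psi> s L) s L c M D f Q"
      using fam[OF j] unfolding D_def[symmetric] by blast
    note f = bump_familyD(1)[OF family] and ball = bump_familyD(2)[OF family] and disj = bump_familyD(3)[OF family]
      and bnd = bump_familyD(4)[OF family] and L2 = bump_familyD(5)[OF family] and sup = bump_familyD(6)[OF family]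
    define p where "p = n div m"
    have pn: "real p = real n / real m" using dvd by (simp add: p_def real_of_nat_div)
    have p: "0 < p" using dvd m n unfolding p_def by (auto elim!: dvdE intro: Nat.gr0I)
    define \<delta> where "\<delta> = L\<^sup>2 / 4 * D powr (- (2 * s + 1))"
    define \<beta> where "\<beta> = M * D powr (- s)"
    define a where "a = 4 * real p * \<delta> / \<sigma>\<^sup>2"
    define l where "l = ln (8 * real n)"
    have l: "1 / 2 \<le> l"
    proof -
      have "exp (1 / 2 :: real) \<le> 1 + 1/2 + (1/2)\<^sup>2" by (rule exp_bound) auto
      also have "\<dots> \<le> 8 * real n" using n by (simp add: power2_eq_square)
      finally show ?thesis unfolding l_def using n by (subst ln_ge_iff) auto
    qed
    have \<delta>0: "0 < \<delta>" using L D by (simp add: \<delta>_def)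
    have \<beta>0: "0 < \<beta>" using M D by (simp add: \<beta>_def)
    have a0: "0 < a" using p \<delta>0 \<sigma> by (simp add: a_def)
    have el: "exp (- l) = 1 / (8 * real n)" using n by (simp add: l_def exp_minus inverse_eq_divide)
    have al: "a * l \<le> 1 / 8"
    proof -
      have "a * l = L\<^sup>2 / \<sigma>\<^sup>2 * (real n / real m * D powr (- (2 * s + 1)) * l)"
        by (simp add: a_def \<delta>_def pn mult_ac)
      also have "\<dots> \<le> L\<^sup>2 / \<sigma>\<^sup>2 * \<kappa>" using h1 by (intro mult_left_mono) (auto simp: D_def l_def)
      also have "\<dots> \<le> L\<^sup>2 / \<sigma>\<^sup>2 * (\<sigma>\<^sup>2 / (8 * L\<^sup>2))" using \<kappa>(2) by (intro mult_left_mono) auto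
      also have "\<dots> = 1 / 8" using L \<sigma> by simp
      finally show ?thesis .
    qed
    have t1: "exp (- 2 * real p * \<delta> / \<beta>\<^sup>2) \<le> 1 / (8 * real n)"
    proof -
      have e: "\<delta> / \<beta>\<^sup>2 = L\<^sup>2 / (4 * M\<^sup>2) / D"
      proof -
        have "D powr (- (2 * s + 1)) = (D powr (- s))\<^sup>2 / D"
          using D by (simp add: power2_eq_square powr_add[symmetric] powr_minus powr_add field_simps)
        then show ?thesis using D by (simp add: \<delta>_def \<beta>_def power_mult_distrib)
      qed
      have "l * D \<le> L\<^sup>2 / (2 * M\<^sup>2) * real p"
        using order_trans[OF h2 mult_right_mono[OF \<kappa>(3), of "real n / real m"]] by (simp add: D_def l_def pn mult.commute)
      then have "l \<le> 2 * real p * (\<delta> / \<beta>\<^sup>2)"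
        unfolding e using pos_le_divide_eq[OF D, of l "L\<^sup>2 / (2 * M\<^sup>2) * real p"] by (simp add: mult_ac)
      then have "exp (- 2 * real p * \<delta> / \<beta>\<^sup>2) \<le> exp (- l)" by simp
      then show ?thesis by (simp only: el)
    qed
    \<comment> \<open>\<open>l \<le> 1 / (8 * a)\<close> gives
      \<open>3 * l \<le> 3 / (8 * a)\<close>, and \<open>1 / 2 \<le> l\<close> absorbs the summand
      \<open>1 / 2\<close>.\<close>
    have t2: "exp (1 / 2 - 3 / (8 * a)) \<le> 1 / (8 * real n)"
    proof -
      have "l \<le> 1 / (8 * a)" using al a0 by (simp add: field_simps)
      then have "1 / 2 - 3 / (8 * a) \<le> - l" using l by (simp add: field_simps)
      then have "exp (1 / 2 - 3 / (8 * a)) \<le> exp (- l)" by simp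
      then show ?thesis by (simp only: el)
    qed
    \<comment> \<open>Two tails of size \<open>1 / (8 * n)\<close> for each of at most
      \<open>n\<close> machines add up to \<open>1 / 4\<close>; hence the \<open>8\<close> inside
      the logarithm.\<close>
    have tail: "real m * (exp (- 2 * real p * \<delta> / \<beta>\<^sup>2) + exp (1 / 2 - 3 / (8 * a))) \<le> 1 / 4"
    proof -
      have mn: "real m \<le> real n" using dvd n by (intro of_nat_mono dvd_imp_le) auto
      have "real m * (exp (- 2 * real p * \<delta> / \<beta>\<^sup>2) + exp (1 / 2 - 3 / (8 * a)))
          \<le> real n * (1 / (8 * real n) + 1 / (8 * real n))"
        by (intro mult_mono add_mono t1 t2 mn) auto
      also have "\<dots> = 1 / 4" using n by simp
      finally show ?thesis .
    qed
    \<comment> \<open>\<open>a\<close> is proportional to \<open>n / m\<close>, so the factor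
      \<open>m\<close> cancels and the total sample size remains. One power of \<open>D\<close> is
      split off from \<open>D powr (- (2 * s + 1))\<close> and balanced against the number of
      bumps.\<close>
    have info: "real m * (4 * ((exp 1)\<^sup>2 * a) * (B * ln (2 * real n) + 2 / real n)) \<le> real (card {..<Q}) / 32"
    proof -
      define T where "T = D powr (- (2 * s + 2))"
      have "1 + - (2 * s + 2) = - (2 * s + 1)" by simp
      then have T: "D powr (- (2 * s + 1)) = D * T"
        using powr_mult_base[OF less_imp_le[OF D], of "- (2 * s + 2)"] by (simp only: T_def)
      have ae: "a = L\<^sup>2 / \<sigma>\<^sup>2 * (real n / real m) * (D * T)" unfolding a_def \<delta>_def pn T by (simp add: mult_ac)
      have ne: "real n * (B * ln (2 * real n) + 2 / real n) = real n * B * ln (2 * real n) + 2"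
        using n by (simp add: distrib_left)
      have "real m * (4 * ((exp 1)\<^sup>2 * a) * (B * ln (2 * real n) + 2 / real n))
          = C * D * T * (real n * (B * ln (2 * real n) + 2 / real n))"
        using m by (simp add: ae C_def)
      also have "\<dots> = C * D * (real n * B * ln (2 * real n) * T + 2 * T)"
        unfolding ne by (simp add: algebra_simps)
      also have "\<dots> \<le> C * D * (\<kappa> + 2 * \<kappa>)"
        using h3 h4 C D by (intro mult_left_mono add_mono) (auto simp: T_def D_def)
      also have "\<dots> \<le> C * D * (3 * (1 / (3 * C * 256 * real N)))"
        using \<kappa>(4) C D by (intro mult_left_mono) auto
      also have "\<dots> = D / (8 * real N) / 32" using C by simp
      also have "\<dots> \<le> real (card {..<Q}) / 32" using Q(2) by (intro divide_right_mono) auto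
      finally show ?thesis .
    qed
    have "ennreal ((c / 2 * D powr (- s)) / 4) \<le> minimax_risk \<sigma> n m (\<lambda>_. B) (besov_ball j0 J \<psi> s L)"
    proof (rule minimax_risk_ge[where Q="{..<Q}" and f=f])
      show "ennreal (2 * (c / 2 * D powr (- s))) \<le> sup_norm_01 (f q)" if "q \<in> {..<Q}" for q
        using sup[of q] that by simp
      fix Y :: "nat \<Rightarrow> (nat \<Rightarrow> real \<times> real) \<Rightarrow> bool list" and A
      assume Y: "\<And>i. i \<in> {1..m} \<Longrightarrow> Y i \<in> (\<Pi>\<^sub>M l\<in>{1..n div m}. borel) \<rightarrow>\<^sub>M count_space UNIV"
        and len: "\<And>i. i \<in> {1..m} \<Longrightarrow> (\<integral>\<^sup>+ D. of_nat (length (Y i (D i))) \<partial>joint_law \<sigma> n m (\<lambda>_. 0)) \<le> ennreal B"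
      show "\<exists>q\<in>{..<Q}. emeasure (joint_law \<sigma> n m (f q)) {D\<in>space (data_space n m). messages m Y D \<in> A}
         \<le> emeasure (joint_law \<sigma> n m (\<lambda>_. 0)) {D\<in>space (data_space n m). messages m Y D \<in> A} + ennreal (1/2)"
        by (rule limited_messages_close[OF \<sigma> n _ _ _ f _ \<beta>0 _ \<delta>0 _ B a_def[unfolded p_def] tail[unfolded p_def] info Y len])
           (use p Q disj bnd L2 in \<open>auto simp: p_def \<beta>_def \<delta>_def lessThan_empty_iff\<close>)
    qed (use c ball f zero_in_besov_ball[OF L] in auto)
    then show "ennreal (c / 8 * (2 ^ j) powr (- s)) \<le> minimax_risk \<sigma> n m (\<lambda>_. B) (besov_ball j0 J \<psi> s L)"
      by (simp add: D_def)
  qed (use \<kappa> c in auto)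
qed

text \<open>Up to constants in the exponent, the last condition says that the diagonal term
  \<open>exp (n * d\<^sup>2)\<close> of the second moment is small against the number of
  bumps.\<close>

lemma minimax_risk_unlimited:
  assumes cdv: "cdv_basis N j0 J \<psi>" and L: "0 < L" and \<sigma>: "0 < \<sigma>"
  obtains \<kappa> c where "0 < \<kappa>" "0 < c"
    "\<And>n m B j. J \<le> j \<Longrightarrow> 8 * N \<le> 2 ^ j \<Longrightarrow> (2 ^ j) powr (- s) \<le> \<kappa> \<Longrightarrow>
      exp (real n * (2 ^ j) powr (- (2 * s + 1)) / \<kappa>) \<le> \<kappa> * 2 ^ j \<Longrightarrow>
      ennreal (c * (2 ^ j) powr (- s)) \<le> minimax_risk \<sigma> n m (\<lambda>_. B) (besov_ball j0 J \<psi> s L)"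
proof -
  obtain c M where c: "0 < c" and M: "0 < M" and N: "0 < N"
    and fam: "\<And>j. J \<le> j \<Longrightarrow> 8 * N \<le> 2 ^ j \<Longrightarrow> \<exists>f Q. 0 < Q \<and> 2 ^ j / (8 * real N) \<le> real Q
      \<and> bump_family (besov_ball j0 J \<psi> s L) s L c M (2 ^ j) f Q"
    using besov_bump_family[OF cdv L, of s] by blast
  \<comment> \<open>\<open>\<sigma> / M\<close> keeps the bumps below \<open>\<sigma>\<close>, as
    the exponential moment bound requires; \<open>2 * \<sigma>\<^sup>2 / L\<^sup>2\<close> rescales
    the exponent; \<open>32 * N\<close> is the \<open>8 * N\<close> of the bump count times the
    \<open>4\<close> in \<open>small\<close>.\<close>
  define \<kappa> where "\<kappa> = min (\<sigma> / M) (min (2 * \<sigma>\<^sup>2 / L\<^sup>2) (1 / (32 * real N)))"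
  have \<kappa>: "0 < \<kappa>" "\<kappa> \<le> \<sigma> / M" "\<kappa> \<le> 2 * \<sigma>\<^sup>2 / L\<^sup>2" "\<kappa> \<le> 1 / (32 * real N)"
    using L M \<sigma> N by (auto simp: \<kappa>_def)
  show ?thesis
  proof (rule that[of \<kappa> "c / 8"])
    fix n m :: nat and B :: real and j
    assume j: "J \<le> j" "8 * N \<le> 2 ^ j" and h1: "(2 ^ j) powr (- s) \<le> \<kappa>"
      and h2: "exp (real n * (2 ^ j) powr (- (2 * s + 1)) / \<kappa>) \<le> \<kappa> * 2 ^ j"
    define D where "D = (2 ^ j :: real)"
    have D: "0 < D" by (simp add: D_def)
    obtain f Q where Q: "0 < Q" "D / (8 * real N) \<le> real Q"
      and family: "bump_family (besov_ball j0 J \<psi> s L) s L c M D f Q"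
      using fam[OF j] unfolding D_def[symmetric] by blast
    note f = bump_familyD(1)[OF family] and ball = bump_familyD(2)[OF family] and disj = bump_familyD(3)[OF family]
      and bnd = bump_familyD(4)[OF family] and L2 = bump_familyD(5)[OF family] and sup = bump_familyD(6)[OF family]
    define \<delta> where "\<delta> = L\<^sup>2 / 4 * D powr (- (2 * s + 1))"
    have \<delta>0: "0 \<le> \<delta>" by (simp add: \<delta>_def)
    have "M * D powr (- s) \<le> M * (\<sigma> / M)"
      using h1 \<kappa>(2) M by (intro mult_left_mono) (auto simp: D_def)
    then have \<beta>: "M * D powr (- s) \<le> \<sigma>" using M by simp
    have small: "exp (2 * real n * \<delta> / \<sigma>\<^sup>2) \<le> real (card {..<Q}) / 4"
    proof -
      have "2 * real n * \<delta> / \<sigma>\<^sup>2 = real n * D powr (- (2 * s + 1)) / (2 * \<sigma>\<^sup>2 / L\<^sup>2)"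
        using L \<sigma> by (simp add: \<delta>_def field_simps)
      also have "\<dots> \<le> real n * D powr (- (2 * s + 1)) / \<kappa>"
        using \<kappa> by (intro divide_left_mono) (auto simp: L less_imp_neq intro!: mult_pos_pos divide_pos_pos)
      finally have "exp (2 * real n * \<delta> / \<sigma>\<^sup>2) \<le> \<kappa> * D" using h2 by (simp add: D_def) (meson exp_le_cancel_iff order_trans)
      also have "\<dots> \<le> 1 / (32 * real N) * D" using \<kappa>(4) D by (intro mult_right_mono) auto
      also have "\<dots> = D / (8 * real N) / 4" by simp
      also have "\<dots> \<le> real (card {..<Q}) / 4" using Q(2) by (intro divide_right_mono) auto
      finally show ?thesis .
    qed
    have "ennreal ((c / 2 * D powr (- s)) / 4) \<le> minimax_risk \<sigma> n m (\<lambda>_. B) (besov_ball j0 J \<psi> s L)"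
    proof (rule minimax_risk_ge[where Q="{..<Q}" and f=f])
      show "ennreal (2 * (c / 2 * D powr (- s))) \<le> sup_norm_01 (f q)" if "q \<in> {..<Q}" for q
        using sup[of q] that by simp
      fix Y :: "nat \<Rightarrow> (nat \<Rightarrow> real \<times> real) \<Rightarrow> bool list" and A
      assume Y: "\<And>i. i \<in> {1..m} \<Longrightarrow> Y i \<in> (\<Pi>\<^sub>M l\<in>{1..n div m}. borel) \<rightarrow>\<^sub>M count_space UNIV"
      show "\<exists>q\<in>{..<Q}. emeasure (joint_law \<sigma> n m (f q)) {D\<in>space (data_space n m). messages m Y D \<in> A}
         \<le> emeasure (joint_law \<sigma> n m (\<lambda>_. 0)) {D\<in>space (data_space n m). messages m Y D \<in> A} + ennreal (1/2)"
      proof (rule mixture_close[OF \<sigma> _ _ f _ _ \<delta>0 _ small sets_message_event[OF Y]])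
        show "\<bar>f q x\<bar> \<le> \<sigma>" if "q \<in> {..<Q}" for q x using bnd[of q x] \<beta> that by simp
      qed (use Q disj L2 in \<open>auto simp: \<delta>_def lessThan_empty_iff\<close>)
    qed (use c ball f zero_in_besov_ball[OF L] in auto)
    then show "ennreal (c / 8 * (2 ^ j) powr (- s)) \<le> minimax_risk \<sigma> n m (\<lambda>_. B) (besov_ball j0 J \<psi> s L)"
      by (simp add: D_def)
  qed (use \<kappa> c in auto)
qed

section \<open>Rates\<close>

lemma exists_dyadic:
  fixes x :: real
  assumes "1 \<le> x"
  shows "\<exists>j. x \<le> 2 ^ j \<and> (2 :: real) ^ j \<le> 2 * x"
proof -
  obtain j0 where "x < 2 ^ j0" using real_arch_pow[of 2 x] by auto
  define j where "j = (LEAST j. x \<le> (2 :: real) ^ j)"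
  have j: "x \<le> 2 ^ j" unfolding j_def by (rule LeastI[where k=j0]) (use \<open>x < 2 ^ j0\<close> in simp)
  have "(2 :: real) ^ j \<le> 2 * x"
  proof (cases j)
    case 0
    then show ?thesis using assms by simp
  next
    case (Suc i)
    then have "\<not> x \<le> 2 ^ i" unfolding j_def by (intro not_less_Least) auto
    then show ?thesis using Suc by simp
  qed
  with j show ?thesis by blast
qed

lemma ln_le_log2:
  assumes "1 \<le> x"
  shows "ln x \<le> log 2 x"
proof -
  have "ln x * ln 2 \<le> ln x * 1" using assms ln2_le_25_over_36 by (intro mult_left_mono) auto
  then show ?thesis by (simp add: log_def field_simps)
qed

text \<open>\<open>D\<close> turns the information condition into an equality, and the lower limit
  for \<open>B\<close> is what makes this \<open>D\<close> satisfy the condition on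
  \<open>n / m\<close> as well. If \<open>B\<close> equals its upper limit, \<open>D\<close> is
  \<open>(n / l) powr (1 / (1 + 2 * s))\<close>, the resolution of the unconstrained regime: this
  explains the power \<open>3 + 4 * s\<close> of the logarithm. The rate is
  \<open>D powr (- s)\<close> in disguise.\<close>

lemma mid_regime_exponents:
  fixes n l m B s :: real
  assumes pos: "0 < n" "0 < l" "0 < m" "0 < B" "0 < s"
    and le: "(n * l / m powr (2 + 2 * s)) powr (1 / (1 + 2 * s)) \<le> B"
  defines "D \<equiv> (n * B * l) powr (1 / (2 + 2 * s))"
  shows "0 < D" and "n / m * l \<le> D powr (2 * s + 1)"
    and "n * B * l \<le> D powr (2 * s + 2)"
    and "(n powr (1 / (1 + 2 * s)) / (B * l powr ((3 + 4 * s) / (1 + 2 * s)))) powr (s / (2 + 2 * s))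
        * (n / l) powr (- (s / (1 + 2 * s))) = D powr (- s)"
    and "B < (n / l powr (3 + 4 * s)) powr (1 / (1 + 2 * s)) \<Longrightarrow> 1 \<le> l \<Longrightarrow> D \<le> n powr (1 / (1 + 2 * s))"
proof -
  \<comment> \<open>In logarithmic coordinates every claim is linear in \<open>x\<close>,
    \<open>y\<close>, \<open>u\<close>, \<open>b\<close>, with coefficients depending on
    \<open>s\<close>.\<close>
  obtain x y u b where e: "n = exp x" "l = exp y" "m = exp u" "B = exp b"
    using pos by (metis exp_ln)
  have s: "0 < 1 + 2 * s" "0 < 2 + 2 * s" using pos by auto
  have D: "D = exp ((x + b + y) / (2 + 2 * s))"
    by (simp add: D_def e exp_add[symmetric] exp_powr_real)
  then show "0 < D" by simp
  have "(x + y - u * (2 + 2 * s)) / (1 + 2 * s) \<le> b"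
    using le by (simp add: e exp_add[symmetric] exp_diff[symmetric] exp_powr_real)
  then have 1: "x + y - u * (2 + 2 * s) \<le> b * (1 + 2 * s)" using s by (simp add: divide_le_eq)
  have "(x - u + y) * (2 + 2 * s) \<le> (x + b + y) * (2 * s + 1)"
    using 1 by (simp add: algebra_simps)
  then have "x - u + y \<le> (x + b + y) / (2 + 2 * s) * (2 * s + 1)"
    using s by (simp add: le_divide_eq)
  then show "n / m * l \<le> D powr (2 * s + 1)"
    by (simp add: D e exp_add[symmetric] exp_diff[symmetric] exp_powr_real)
  show "n * B * l \<le> D powr (2 * s + 2)"
    using s by (simp add: D e exp_add[symmetric] exp_powr_real add.commute[of _ 2])
  have "(x / (1 + 2 * s) - (b + y * ((3 + 4 * s) / (1 + 2 * s)))) * (s / (2 + 2 * s)) + (x - y) * - (s / (1 + 2 * s))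
      = (x + b + y) / (2 + 2 * s) * - s"
  proof -
    \<comment> \<open>Naming the two inverses turns the identity into a polynomial one with two side
      relations.\<close>
    define \<alpha> \<gamma> where "\<alpha> = 1 / (1 + 2 * s)" and "\<gamma> = 1 / (2 + 2 * s)"
    have "\<alpha> * (1 + 2 * s) = 1" "\<gamma> * (2 + 2 * s) = 1" using s by (auto simp: \<alpha>_def \<gamma>_def)
    then have "(x * \<alpha> - (b + y * ((3 + 4 * s) * \<alpha>))) * (s * \<gamma>) + (x - y) * - (s * \<alpha>) = (x + b + y) * \<gamma> * - s"
      by algebra
    then show ?thesis by (simp add: \<alpha>_def \<gamma>_def)
  qed
  then show "(n powr (1 / (1 + 2 * s)) / (B * l powr ((3 + 4 * s) / (1 + 2 * s)))) powr (s / (2 + 2 * s))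
        * (n / l) powr (- (s / (1 + 2 * s))) = D powr (- s)"
    by (simp add: D e exp_add[symmetric] exp_diff[symmetric] exp_powr_real)
  assume "B < (n / l powr (3 + 4 * s)) powr (1 / (1 + 2 * s))" "1 \<le> l"
  then have 2: "b < (x - y * (3 + 4 * s)) / (1 + 2 * s)" and y: "0 \<le> y"
    by (simp_all add: e exp_diff[symmetric] exp_powr_real)
  have "b * (1 + 2 * s) < x - y * (3 + 4 * s)" using 2 s by (simp add: less_divide_eq)
  moreover have "0 \<le> y * (2 + 2 * s)" using y s by (intro mult_nonneg_nonneg) auto
  ultimately have "(x + b + y) * (1 + 2 * s) \<le> x * (2 + 2 * s)" by (simp add: algebra_simps)
  then have "(x + b + y) / (2 + 2 * s) \<le> x / (1 + 2 * s)" using s by (simp add: divide_simps mult.commute)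
  then show "D \<le> n powr (1 / (1 + 2 * s))" by (simp add: D e exp_powr_real)
qed

text \<open>Here \<open>D\<close> makes the condition on \<open>n / m\<close> an equality, and the
  information condition follows because \<open>B\<close> is below the boundary. The lower bound on
  the number of machines enters through \<open>l \<le> m\<close>, which keeps \<open>D\<close> at
  most \<open>n powr (1 / (1 + 2 * s))\<close>.\<close>

lemma low_regime_exponents:
  fixes n l m B s :: real
  assumes pos: "0 < n" "0 < l" "0 < m" "0 < B" "0 < s"
    and less: "B < (n * l / m powr (2 + 2 * s)) powr (1 / (1 + 2 * s))"
  defines "D \<equiv> (n * l / m) powr (1 / (1 + 2 * s))"
  shows "0 < D" and "n / m * l \<le> D powr (2 * s + 1)"
    and "n * B * l \<le> D powr (2 * s + 2)"
    and "(n * l / m) powr (- (s / (1 + 2 * s))) = D powr (- s)"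
    and "l \<le> m \<Longrightarrow> D \<le> n powr (1 / (1 + 2 * s))"
proof -
  obtain x y u b where e: "n = exp x" "l = exp y" "m = exp u" "B = exp b"
    using pos by (metis exp_ln)
  have s: "0 < 1 + 2 * s" using pos by auto
  have D: "D = exp ((x + y - u) / (1 + 2 * s))"
    by (simp add: D_def e exp_add[symmetric] exp_diff[symmetric] exp_powr_real)
  then show "0 < D" by simp
  show "n / m * l \<le> D powr (2 * s + 1)"
    using s by (simp add: D e exp_add[symmetric] exp_diff[symmetric] exp_powr_real add.commute[of "2 * s"])
  have "b < (x + y - u * (2 + 2 * s)) / (1 + 2 * s)"
    using less by (simp add: e exp_add[symmetric] exp_diff[symmetric] exp_powr_real)
  then have "b * (1 + 2 * s) < x + y - u * (2 + 2 * s)" using s by (simp add: less_divide_eq)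
  then have "(x + b + y) * (1 + 2 * s) \<le> (x + y - u) * (2 * s + 2)" by (simp add: algebra_simps)
  then have "x + b + y \<le> (x + y - u) / (1 + 2 * s) * (2 * s + 2)" using s by (simp add: le_divide_eq)
  then show "n * B * l \<le> D powr (2 * s + 2)"
    by (simp add: D e exp_add[symmetric] exp_powr_real)
  show "(n * l / m) powr (- (s / (1 + 2 * s))) = D powr (- s)"
    by (simp add: D e exp_add[symmetric] exp_diff[symmetric] exp_powr_real)
  assume "l \<le> m"
  then show "D \<le> n powr (1 / (1 + 2 * s))"
    using s by (simp add: D e exp_powr_real divide_right_mono)
qed

lemma mult_powr_minus_le:
  fixes x :: real
  assumes "0 < x" "a \<le> b * x powr r"
  shows "a * x powr (- r) \<le> b"
  using assms by (simp add: powr_minus divide_inverse[symmetric] divide_le_eq)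

lemma powr_le_powr_imp_le:
  fixes x y :: real
  assumes "0 < r" "0 \<le> y" "x powr r \<le> y powr r"
  shows "x \<le> y"
  using assms powr_less_mono2[of r y x] by (meson linorder_not_le)

lemma powr_scaled_le:
  fixes \<Lambda> :: real
  assumes "0 < \<Lambda>" "0 < D0" "\<Lambda> * D0 \<le> D" "0 \<le> r"
  shows "D powr (- r) \<le> \<Lambda> powr (- r) * D0 powr (- r)"
proof -
  have "D powr (- r) \<le> (\<Lambda> * D0) powr (- r)" using assms by (intro powr_mono2') auto
  then show ?thesis using assms by (simp add: powr_mult)
qed

section \<open>From resolution levels to rates in the sample size\<close>

text \<open>The ideal resolution \<open>D0\<close> is enlarged by a constant
  \<open>\<Lambda>\<close> and rounded up to a power of two, which changes the rate by a constant
  only. \<open>m\<close>, \<open>B\<close> and \<open>D0\<close> are quantified inside the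
  eventuality, so the threshold for \<open>n\<close> is uniform in them.\<close>

lemma limited_rate:
  assumes cdv: "cdv_basis N j0 J \<psi>" and L: "0 < L" and \<sigma>: "0 < \<sigma>" and s: "0 < s" and K: "0 < K"
  shows "\<exists>C>0. \<forall>\<^sub>F n in sequentially. \<forall>m B D0. m dvd n \<longrightarrow> 0 < m \<longrightarrow> 0 \<le> B \<longrightarrow> 0 < D0 \<longrightarrow>
    real m \<le> K * (real n powr (2 * s / (1 + 2 * s)) / (ln (real n))\<^sup>2) \<longrightarrow>
    real n / real m * log 2 (real n) \<le> D0 powr (2 * s + 1) \<longrightarrow>
    real n * B * log 2 (real n) \<le> D0 powr (2 * s + 2) \<longrightarrow>
    D0 \<le> real n powr (1 / (1 + 2 * s)) \<longrightarrow>
    ennreal (C * D0 powr (- s)) \<le> minimax_risk \<sigma> n m (\<lambda>_. B) (besov_ball j0 J \<psi> s L)"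
proof -
  obtain \<kappa> c where \<kappa>: "0 < \<kappa>" and c: "0 < c" and risk:
    "\<And>n m B j. m dvd n \<Longrightarrow> 0 < m \<Longrightarrow> 2 \<le> n \<Longrightarrow> 0 \<le> B \<Longrightarrow> J \<le> j \<Longrightarrow> 8 * N \<le> 2 ^ j \<Longrightarrow>
      real n / real m * (2 ^ j) powr (- (2 * s + 1)) * ln (8 * real n) \<le> \<kappa> \<Longrightarrow>
      2 ^ j * ln (8 * real n) \<le> \<kappa> * (real n / real m) \<Longrightarrow>
      real n * B * ln (2 * real n) * (2 ^ j) powr (- (2 * s + 2)) \<le> \<kappa> \<Longrightarrow>
      (2 ^ j) powr (- (2 * s + 2)) \<le> \<kappa> \<Longrightarrow>
      ennreal (c * (2 ^ j) powr (- s)) \<le> minimax_risk \<sigma> n m (\<lambda>_. B) (besov_ball j0 J \<psi> s L)"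
    using minimax_risk_limited[OF cdv L \<sigma>, of s] by blast
  \<comment> \<open>The \<open>2\<close> comes from \<open>ln (8 * n) \<le> 2 * ln n\<close>.
    Enlarging the resolution by \<open>\<Lambda>\<close> brings the first and the third condition of
    the fixed-level bound below \<open>\<kappa>\<close>.\<close>
  define \<Lambda> where "\<Lambda> = max 1 ((2 / \<kappa>) powr (1 / (2 * s + 1)))"
  have \<Lambda>1: "1 \<le> \<Lambda>" by (simp add: \<Lambda>_def)
  have "2 / \<kappa> = ((2 / \<kappa>) powr (1 / (2 * s + 1))) powr (2 * s + 1)" using s \<kappa> by (simp add: powr_powr)
  also have "\<dots> \<le> \<Lambda> powr (2 * s + 1)" using s by (intro powr_mono2) (auto simp: \<Lambda>_def)
  finally have \<Lambda>2: "2 * \<Lambda> powr (- (2 * s + 1)) \<le> \<kappa>"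
    using \<kappa> \<Lambda>1 by (intro mult_powr_minus_le) (auto simp: divide_le_eq mult.commute)
  have \<Lambda>3: "2 * \<Lambda> powr (- (2 * s + 2)) \<le> \<kappa>"
    using powr_mono[of "- (2 * s + 2)" "- (2 * s + 1)" \<Lambda>] \<Lambda>1 \<Lambda>2 by simp
  \<comment> \<open>Resolutions above \<open>X\<close> have an admissible level \<open>j\<close> and
    satisfy the fourth condition of the fixed-level bound.\<close>
  define X where "X = max (2 ^ J) (max (8 * real N) (max 1 ((1 / \<kappa>) powr (1 / (2 * s + 2)))))"
  have X: "2 ^ J \<le> X" "8 * real N \<le> X" "1 \<le> X" "(1 / \<kappa>) powr (1 / (2 * s + 2)) \<le> X"
    by (auto simp: X_def)
  define C where "C = c * (2 * \<Lambda>) powr (- s)"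
  have "C > 0" using c \<Lambda>1 by (simp add: C_def)
  have lnn: "filterlim (\<lambda>n. ln (real n)) at_top sequentially"
    by (rule filterlim_compose[OF ln_at_top filterlim_real_sequentially])
  have ev1: "\<forall>\<^sub>F n in sequentially. 4 * \<Lambda> * K / \<kappa> \<le> ln (real n)"
    and ev2: "\<forall>\<^sub>F n in sequentially. sqrt (K * X powr (2 * s + 1)) \<le> ln (real n)"
    and ev4: "\<forall>\<^sub>F n in sequentially. 1 \<le> ln (real n)"
    using lnn by (auto simp: filterlim_at_top)
  have ev3: "\<forall>\<^sub>F n in sequentially. 8 \<le> n" by (rule eventually_ge_at_top)
  show ?thesis
  proof (intro exI[of _ C] conjI \<open>C > 0\<close>, use ev1 ev2 ev3 ev4 in eventually_elim, intro allI impI)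
    fix n m :: nat and B D0 :: real
    assume n: "4 * \<Lambda> * K / \<kappa> \<le> ln (real n)" "sqrt (K * X powr (2 * s + 1)) \<le> ln (real n)" "8 \<le> n" "1 \<le> ln (real n)"
      and m: "m dvd n" "0 < m" and B: "0 \<le> B" and D0: "0 < D0"
      and mK: "real m \<le> K * (real n powr (2 * s / (1 + 2 * s)) / (ln (real n))\<^sup>2)"
      and h1: "real n / real m * log 2 (real n) \<le> D0 powr (2 * s + 1)"
      and h2: "real n * B * log 2 (real n) \<le> D0 powr (2 * s + 2)"
      and h3: "D0 \<le> real n powr (1 / (1 + 2 * s))"
    define p where "p = real n / real m"
    have n0: "0 < real n" using n(3) by simp
    have p0: "0 < p" using n0 m by (simp add: p_def)
    have lnlog: "ln (real n) \<le> log 2 (real n)" using n(3) by (intro ln_le_log2) auto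
    have ln8: "ln (8 * real n) \<le> 2 * ln (real n)" "ln (2 * real n) \<le> 2 * ln (real n)"
      using n(3) by (auto simp: ln_mult)
    have pbig: "real n powr (1 / (1 + 2 * s)) * (ln (real n))\<^sup>2 / K \<le> p"
    proof -
      have "real n powr (1 / (1 + 2 * s)) * real n powr (2 * s / (1 + 2 * s)) = real n"
        using s n0 by (simp add: powr_add[symmetric] add_divide_distrib[symmetric])
      then have "real n powr (1 / (1 + 2 * s)) * (ln (real n))\<^sup>2 / K * real m
          \<le> real n powr (1 / (1 + 2 * s)) * (ln (real n))\<^sup>2 / K * (K * (real n powr (2 * s / (1 + 2 * s)) / (ln (real n))\<^sup>2))"
        using K by (intro mult_left_mono mK) auto
      also have "\<dots> = real n powr (1 / (1 + 2 * s)) * real n powr (2 * s / (1 + 2 * s))"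
        using K n(4) by simp
      also have "\<dots> = real n" by fact
      finally show ?thesis using m by (simp add: p_def le_divide_eq)
    qed
    \<comment> \<open>The bound on \<open>m\<close> alone drives the resolution to infinity:
      \<open>n / m\<close> is at least \<open>(ln n)\<^sup>2 / K\<close>, and
      \<open>D0 powr (2 * s + 1)\<close> is at least \<open>n / m\<close>.\<close>
    have D0X: "X \<le> D0"
    proof -
      have "K * X powr (2 * s + 1) \<le> (ln (real n))\<^sup>2"
        using n(2,4) K by (metis real_sqrt_le_iff real_sqrt_abs abs_of_nonneg order_trans zero_le_one)
      then have "X powr (2 * s + 1) \<le> 1 * (ln (real n))\<^sup>2 / K" using K by (simp add: field_simps)
      also have "\<dots> \<le> real n powr (1 / (1 + 2 * s)) * (ln (real n))\<^sup>2 / K"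
        using K n(3) s by (intro divide_right_mono mult_right_mono ge_one_powr_ge_zero) auto
      also have "\<dots> \<le> p * 1" using pbig by simp
      also have "\<dots> \<le> p * log 2 (real n)" using p0 n(4) lnlog by (intro mult_left_mono) auto
      also have "\<dots> \<le> D0 powr (2 * s + 1)" using h1 by (simp add: p_def)
      finally show ?thesis by (rule powr_le_powr_imp_le[rotated 2]) (use s D0 in auto)
    qed
    have "1 \<le> \<Lambda> * D0" using \<Lambda>1 D0X X(3) mult_mono[of 1 \<Lambda> 1 D0] by simp
    from exists_dyadic[OF this] obtain j
      where j: "\<Lambda> * D0 \<le> 2 ^ j" "(2 :: real) ^ j \<le> 2 * (\<Lambda> * D0)" by blast
    define D where "D = (2 ^ j :: real)"
    have D: "\<Lambda> * D0 \<le> D" "D \<le> 2 * (\<Lambda> * D0)" "0 < D" unfolding D_def by (fact j | simp)+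
    have DX: "X \<le> D"
      using D(1) D0X mult_right_mono[OF \<Lambda>1, of D0] D0 by linarith
    have pw: "D powr (- r) \<le> \<Lambda> powr (- r) * D0 powr (- r)" if "0 \<le> r" for r
      using powr_scaled_le[of \<Lambda> D0 D r] \<Lambda>1 D0 D(1) that by simp
    have canc: "D0 powr r * D0 powr (- r) = 1" for r using D0 by (simp add: powr_minus)
    have "ennreal (C * D0 powr (- s)) \<le> ennreal (c * D powr (- s))"
    proof (rule ennreal_leI)
      have "(2 * (\<Lambda> * D0)) powr (- s) \<le> D powr (- s)" using D s by (intro powr_mono2') auto
      moreover have "(2 * (\<Lambda> * D0)) powr (- s) = (2 * \<Lambda>) powr (- s) * D0 powr (- s)"
        using \<Lambda>1 D0 by (subst powr_mult[symmetric]) (auto simp: mult.assoc)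
      ultimately show "C * D0 powr (- s) \<le> c * D powr (- s)" using c by (simp add: C_def mult.assoc)
    qed
    also have "\<dots> \<le> minimax_risk \<sigma> n m (\<lambda>_. B) (besov_ball j0 J \<psi> s L)"
      unfolding D_def
    proof (rule risk[OF m])
      show "2 \<le> n" using n(3) by simp
      show "0 \<le> B" by fact
      show "J \<le> j" using order_trans[OF X(1) DX] by (simp add: D_def)
      show "8 * N \<le> 2 ^ j"
      proof -
        have "real (8 * N) \<le> real (2 ^ j)" using order_trans[OF X(2) DX] by (simp add: D_def)
        then show ?thesis by (simp only: of_nat_le_iff)
      qed
      have "p * D powr (- (2 * s + 1)) * ln (8 * real n) = (p * ln (8 * real n)) * D powr (- (2 * s + 1))" by simp
      also have "\<dots> \<le> (2 * D0 powr (2 * s + 1)) * (\<Lambda> powr (- (2 * s + 1)) * D0 powr (- (2 * s + 1)))"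
      proof (rule mult_mono[OF _ pw])
        have "p * ln (8 * real n) \<le> p * (2 * log 2 (real n))" using ln8 lnlog p0 by (intro mult_left_mono) auto
        then show "p * ln (8 * real n) \<le> 2 * D0 powr (2 * s + 1)"
          using h1 unfolding p_def[symmetric] by simp
      qed (use s in auto)
      also have "\<dots> = 2 * \<Lambda> powr (- (2 * s + 1)) * (D0 powr (2 * s + 1) * D0 powr (- (2 * s + 1)))" by simp
      also have "\<dots> \<le> \<kappa>" unfolding canc using \<Lambda>2 by simp
      finally show "real n / real m * (2 ^ j) powr (- (2 * s + 1)) * ln (8 * real n) \<le> \<kappa>" by (simp add: p_def D_def)
      \<comment> \<open>\<open>n / m\<close> exceeds the largest allowed \<open>D0\<close> by the
        factor \<open>(ln n)\<^sup>2 / K\<close>. One logarithm pays for \<open>ln (8 * n)\<close>,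
        the other absorbs the constants.\<close>
      have "D * ln (8 * real n) \<le> (2 * (\<Lambda> * D0)) * (2 * ln (real n))"
        using D ln8 D0 \<Lambda>1 n(3) by (intro mult_mono) auto
      also have "\<dots> = (4 * \<Lambda> * K / \<kappa>) * ln (real n) * (D0 * \<kappa> / K)" using K \<kappa> by simp
      also have "\<dots> \<le> ln (real n) * ln (real n) * (D0 * \<kappa> / K)"
        using n D0 K \<kappa> by (intro mult_right_mono) auto
      also have "\<dots> \<le> \<kappa> * (real n powr (1 / (1 + 2 * s)) * (ln (real n))\<^sup>2 / K)"
        using mult_left_mono[OF h3, of "\<kappa> * (ln (real n))\<^sup>2 / K"] \<kappa> K by (simp add: power2_eq_square mult_ac)
      also have "\<dots> \<le> \<kappa> * p" using pbig \<kappa> by (intro mult_left_mono) auto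
      finally show "2 ^ j * ln (8 * real n) \<le> \<kappa> * (real n / real m)" by (simp add: p_def D_def)
      have "real n * B * ln (2 * real n) * D powr (- (2 * s + 2))
         \<le> (2 * D0 powr (2 * s + 2)) * (\<Lambda> powr (- (2 * s + 2)) * D0 powr (- (2 * s + 2)))"
      proof (rule mult_mono[OF _ pw])
        have "real n * B * ln (2 * real n) \<le> real n * B * (2 * log 2 (real n))" using ln8 lnlog B n0 by (intro mult_left_mono) auto
        then show "real n * B * ln (2 * real n) \<le> 2 * D0 powr (2 * s + 2)" using h2 by simp
      qed (use s in auto)
      also have "\<dots> = 2 * \<Lambda> powr (- (2 * s + 2)) * (D0 powr (2 * s + 2) * D0 powr (- (2 * s + 2)))" by simp
      also have "\<dots> \<le> \<kappa>" unfolding canc using \<Lambda>3 by simp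
      finally show "real n * B * ln (2 * real n) * (2 ^ j) powr (- (2 * s + 2)) \<le> \<kappa>" by (simp add: D_def)
      have "1 / \<kappa> = ((1 / \<kappa>) powr (1 / (2 * s + 2))) powr (2 * s + 2)" using s \<kappa> by (simp add: powr_powr)
      also have "\<dots> \<le> D powr (2 * s + 2)" using order_trans[OF X(4) DX] s by (intro powr_mono2) auto
      finally show "(2 ^ j) powr (- (2 * s + 2)) \<le> \<kappa>"
        unfolding D_def[symmetric] powr_minus using D(3) \<kappa> by (simp add: field_simps)
    qed
    finally show "ennreal (C * D0 powr (- s)) \<le> minimax_risk \<sigma> n m (\<lambda>_. B) (besov_ball j0 J \<psi> s L)" .
  qed
qed

text \<open>The exponent of the second moment is tuned to \<open>(g / 2) * ln n\<close>, half of
  what the number of bumps, about \<open>n powr g\<close> up to logarithms, would allow. The surplus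
  \<open>sqrt n powr g\<close> swallows the logarithm and the constant
  \<open>\<kappa>\<close>.\<close>

lemma unlimited_rate:
  assumes cdv: "cdv_basis N j0 J \<psi>" and L: "0 < L" and \<sigma>: "0 < \<sigma>" and s: "0 < s"
  shows "\<exists>C>0. \<forall>\<^sub>F n in sequentially. \<forall>m B.
    ennreal (C * (real n / log 2 (real n)) powr (- (s / (1 + 2 * s)))) \<le> minimax_risk \<sigma> n m (\<lambda>_. B) (besov_ball j0 J \<psi> s L)"
proof -
  obtain \<kappa> c where \<kappa>: "0 < \<kappa>" and c: "0 < c" and risk:
    "\<And>n m B j. J \<le> j \<Longrightarrow> 8 * N \<le> 2 ^ j \<Longrightarrow> (2 ^ j) powr (- s) \<le> \<kappa> \<Longrightarrow>
      exp (real n * (2 ^ j) powr (- (2 * s + 1)) / \<kappa>) \<le> \<kappa> * 2 ^ j \<Longrightarrow>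
      ennreal (c * (2 ^ j) powr (- s)) \<le> minimax_risk \<sigma> n m (\<lambda>_. B) (besov_ball j0 J \<psi> s L)"
    using minimax_risk_unlimited[OF cdv L \<sigma>, of s] by blast
  define g where "g = 1 / (1 + 2 * s)"
  have g: "0 < g" using s by (simp add: g_def)
  have gs: "g * (2 * s + 1) = 1" using s by (simp add: g_def)
  \<comment> \<open>Chosen so that \<open>n * D powr (- (2 * s + 1)) / \<kappa>\<close> becomes at
    most \<open>(g / 2) * ln n\<close>; the \<open>ln 2\<close> converts the binary logarithm in
    \<open>D0\<close>.\<close>
  define V where "V = 2 / (g * \<kappa> * ln 2)"
  have V: "0 < V" using g \<kappa> by (simp add: V_def)
  define \<Lambda> where "\<Lambda> = max 1 (V powr g)"
  have \<Lambda>1: "1 \<le> \<Lambda>" by (simp add: \<Lambda>_def)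
  have "V = (V powr g) powr (2 * s + 1)" using V by (simp add: powr_powr gs)
  also have "\<dots> \<le> \<Lambda> powr (2 * s + 1)" using s by (intro powr_mono2) (auto simp: \<Lambda>_def)
  finally have \<Lambda>2: "\<Lambda> powr (- (2 * s + 1)) \<le> 1 / V"
    using V \<Lambda>1 mult_powr_minus_le[of \<Lambda> 1 "1 / V" "2 * s + 1"] by (simp add: le_divide_eq)
  define X where "X = max (2 ^ J) (max (8 * real N) (max 1 ((1 / \<kappa>) powr (1 / s))))"
  have X: "2 ^ J \<le> X" "8 * real N \<le> X" "1 \<le> X" "(1 / \<kappa>) powr (1 / s) \<le> X"
    by (auto simp: X_def)
  define C where "C = c * (2 * \<Lambda>) powr (- s)"
  have "C > 0" using c \<Lambda>1 by (simp add: C_def)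
  have ev1: "\<forall>\<^sub>F n in sequentially. X powr (2 * s + 1) \<le> real n / log 2 (real n)"
  proof -
    have "filterlim (\<lambda>n. real n / log 2 (real n)) at_top sequentially" by real_asymp
    then show ?thesis by (simp add: filterlim_at_top)
  qed
  have ev2: "\<forall>\<^sub>F n in sequentially. (1 / \<kappa>) powr (2 * s + 1) \<le> sqrt (real n) / log 2 (real n)"
  proof -
    have "filterlim (\<lambda>n. sqrt (real n) / log 2 (real n)) at_top sequentially" by real_asymp
    then show ?thesis by (simp add: filterlim_at_top)
  qed
  have ev3: "\<forall>\<^sub>F n in sequentially. 2 \<le> n" by (rule eventually_ge_at_top)
  show ?thesis
  proof (intro exI[of _ C] conjI \<open>C > 0\<close>, use ev1 ev2 ev3 in eventually_elim, intro allI)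
    fix n m :: nat and B :: real
    assume n: "X powr (2 * s + 1) \<le> real n / log 2 (real n)"
      "(1 / \<kappa>) powr (2 * s + 1) \<le> sqrt (real n) / log 2 (real n)" "2 \<le> n"
    define l where "l = log 2 (real n)"
    have l: "0 < l" using n(3) by (simp add: l_def)
    have n0: "0 < real n" using n(3) by simp
    define D0 where "D0 = (real n / l) powr g"
    have D0: "0 < D0" using n0 l by (simp add: D0_def)
    have D0e: "D0 powr (2 * s + 1) = real n / l" using n0 l by (simp add: D0_def powr_powr gs)
    have D0X: "X \<le> D0"
    proof -
      have "X powr (2 * s + 1) \<le> D0 powr (2 * s + 1)" using n(1) by (simp add: D0e l_def)
      then show ?thesis by (rule powr_le_powr_imp_le[rotated 2]) (use s D0 in auto)
    qed
    have "1 \<le> \<Lambda> * D0" using \<Lambda>1 D0X X(3) mult_mono[of 1 \<Lambda> 1 D0] by simp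
    from exists_dyadic[OF this] obtain j
      where j: "\<Lambda> * D0 \<le> 2 ^ j" "(2 :: real) ^ j \<le> 2 * (\<Lambda> * D0)" by blast
    define D where "D = (2 ^ j :: real)"
    have D: "\<Lambda> * D0 \<le> D" "D \<le> 2 * (\<Lambda> * D0)" "0 < D" unfolding D_def by (fact j | simp)+
    have D0D: "D0 \<le> D" using D(1) mult_right_mono[OF \<Lambda>1, of D0] D0 by linarith
    have DX: "X \<le> D" using D0X D0D by simp
    have "ennreal (C * (real n / log 2 (real n)) powr (- (s / (1 + 2 * s)))) = ennreal (C * D0 powr (- s))"
      by (simp add: D0_def powr_powr l_def g_def)
    also have "\<dots> \<le> ennreal (c * D powr (- s))"
    proof (rule ennreal_leI)
      have "(2 * (\<Lambda> * D0)) powr (- s) \<le> D powr (- s)" using D s by (intro powr_mono2') auto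
      moreover have "(2 * (\<Lambda> * D0)) powr (- s) = (2 * \<Lambda>) powr (- s) * D0 powr (- s)"
        using \<Lambda>1 D0 by (subst powr_mult[symmetric]) (auto simp: mult.assoc)
      ultimately show "C * D0 powr (- s) \<le> c * D powr (- s)" using c by (simp add: C_def mult.assoc)
    qed
    also have "\<dots> \<le> minimax_risk \<sigma> n m (\<lambda>_. B) (besov_ball j0 J \<psi> s L)"
      unfolding D_def
    proof (rule risk)
      show "J \<le> j" using order_trans[OF X(1) DX] by (simp add: D_def)
      show "8 * N \<le> 2 ^ j"
      proof -
        have "real (8 * N) \<le> real (2 ^ j)" using order_trans[OF X(2) DX] by (simp add: D_def)
        then show ?thesis by (simp only: of_nat_le_iff)
      qed
      have "1 / \<kappa> = ((1 / \<kappa>) powr (1 / s)) powr s" using s \<kappa> by (simp add: powr_powr)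
      also have "\<dots> \<le> D powr s" using order_trans[OF X(4) DX] s by (intro powr_mono2) auto
      finally show "(2 ^ j) powr (- s) \<le> \<kappa>"
        unfolding D_def[symmetric] powr_minus using D(3) \<kappa> by (simp add: field_simps)
      have "real n * D powr (- (2 * s + 1)) / \<kappa> \<le> real n * (1 / V * (l / real n)) / \<kappa>"
      proof (intro divide_right_mono mult_left_mono)
        have "D powr (- (2 * s + 1)) \<le> \<Lambda> powr (- (2 * s + 1)) * D0 powr (- (2 * s + 1))"
          using powr_scaled_le[of \<Lambda> D0 D "2 * s + 1"] \<Lambda>1 D0 D(1) s by simp
        also have "D0 powr (- (2 * s + 1)) = l / real n" by (simp only: powr_minus D0e) simp
        also have "\<Lambda> powr (- (2 * s + 1)) * (l / real n) \<le> 1 / V * (l / real n)"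
          using \<Lambda>2 l n0 by (intro mult_right_mono) auto
        finally show "D powr (- (2 * s + 1)) \<le> 1 / V * (l / real n)" .
      qed (use \<kappa> in auto)
      also have "\<dots> = g / 2 * ln (real n)"
        using \<kappa> g n0 by (simp add: V_def l_def log_def)
      finally have "exp (real n * D powr (- (2 * s + 1)) / \<kappa>) \<le> exp (g / 2 * ln (real n))" by simp
      also have "\<dots> = sqrt (real n) powr g"
        using n0 by (simp add: powr_half_sqrt[symmetric] powr_powr powr_def)
      also have "\<dots> = \<kappa> * ((1 / \<kappa>) * sqrt (real n) powr g)" using \<kappa> by simp
      also have "\<dots> = \<kappa> * (((1 / \<kappa>) powr (2 * s + 1) * sqrt (real n)) powr g)"
        using \<kappa> gs n0 by (simp add: powr_mult powr_powr mult.commute[of _ g])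
      also have "\<dots> \<le> \<kappa> * D0"
        unfolding D0_def
      proof (intro mult_left_mono powr_mono2)
        have "(1 / \<kappa>) powr (2 * s + 1) * sqrt (real n) \<le> sqrt (real n) / l * sqrt (real n)"
          using n(2) by (intro mult_right_mono) (auto simp: l_def)
        then show "(1 / \<kappa>) powr (2 * s + 1) * sqrt (real n) \<le> real n / l" by simp
      qed (use \<kappa> g in auto)
      also have "\<dots> \<le> \<kappa> * D" using D0D \<kappa> by simp
      finally show "exp (real n * (2 ^ j) powr (- (2 * s + 1)) / \<kappa>) \<le> \<kappa> * 2 ^ j" by (simp add: D_def)
    qed
    finally show "ennreal (C * (real n / log 2 (real n)) powr (- (s / (1 + 2 * s))))
      \<le> minimax_risk \<sigma> n m (\<lambda>_. B) (besov_ball j0 J \<psi> s L)" .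
  qed
qed

text \<open>\<open>K\<close> is the implied constant in the growth condition on \<open>m\<close>.
  \<open>C\<close> is fixed before the sequences, and the regime is decided for each
  \<open>n\<close> separately inside the eventuality, so that \<open>m\<close> and \<open>B\<close>
  may switch between regimes.\<close>

theorem corollary2p7:
  fixes s L \<sigma> K :: real
    and N J j0 :: nat
    and \<psi> :: "nat \<Rightarrow> nat \<Rightarrow> real \<Rightarrow> real"
  assumes "0 < s" and "0 < L" and "0 < \<sigma>" and "0 < K"
    and "s < real N"
    and "cdv_basis N j0 J \<psi>"
  shows "\<exists>C>0. \<forall>(m :: nat \<Rightarrow> nat) (B :: nat \<Rightarrow> real). \<forall>\<^sub>F n in sequentially.
    m n dvd n \<and> 0 < B n \<and> log 2 (real n) \<le> real (m n) \<and>
    real (m n) \<le> K * (real n powr (2 * s / (1 + 2 * s)) / (ln (real n))\<^sup>2) \<longrightarrow>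
    (let R = minimax_risk \<sigma> n (m n) (\<lambda>i. B n) (besov_ball j0 J \<psi> s L) in
      (B n \<ge> (real n / log 2 (real n) powr (3 + 4 * s)) powr (1 / (1 + 2 * s)) \<longrightarrow>
         R \<ge> ennreal (C * (real n / log 2 (real n)) powr (- (s / (1 + 2 * s))))) \<and>
      ((real n * log 2 (real n) / real (m n) powr (2 + 2 * s)) powr (1 / (1 + 2 * s)) \<le> B n \<and>
       B n < (real n / log 2 (real n) powr (3 + 4 * s)) powr (1 / (1 + 2 * s)) \<longrightarrow>
         R \<ge> ennreal (C *
           ((real n powr (1 / (1 + 2 * s)) /
               (B n * log 2 (real n) powr ((3 + 4 * s) / (1 + 2 * s)))) powr (s / (2 + 2 * s)) *
            (real n / log 2 (real n)) powr (- (s / (1 + 2 * s)))))) \<and>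
      ((real n * log 2 (real n) / real (m n) powr (2 + 2 * s)) powr (1 / (1 + 2 * s)) > B n \<longrightarrow>
         R \<ge> ennreal (C *
           (real n * log 2 (real n) / real (m n)) powr (- (s / (1 + 2 * s))))))"
proof -
  obtain C1 where C1: "0 < C1" and lim: "\<forall>\<^sub>F n in sequentially. \<forall>m B D0. m dvd n \<longrightarrow> 0 < m \<longrightarrow> 0 \<le> B \<longrightarrow> 0 < D0 \<longrightarrow>
    real m \<le> K * (real n powr (2 * s / (1 + 2 * s)) / (ln (real n))\<^sup>2) \<longrightarrow>
    real n / real m * log 2 (real n) \<le> D0 powr (2 * s + 1) \<longrightarrow>
    real n * B * log 2 (real n) \<le> D0 powr (2 * s + 2) \<longrightarrow>
    D0 \<le> real n powr (1 / (1 + 2 * s)) \<longrightarrow>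
    ennreal (C1 * D0 powr (- s)) \<le> minimax_risk \<sigma> n m (\<lambda>_. B) (besov_ball j0 J \<psi> s L)"
    using limited_rate[OF assms(6,2,3,1,4)] by blast
  obtain C2 where C2: "0 < C2" and unl: "\<forall>\<^sub>F n in sequentially. \<forall>m B.
    ennreal (C2 * (real n / log 2 (real n)) powr (- (s / (1 + 2 * s)))) \<le> minimax_risk \<sigma> n m (\<lambda>_. B) (besov_ball j0 J \<psi> s L)"
    using unlimited_rate[OF assms(6,2,3,1)] by blast
  define C where "C = min C1 C2"
  have C: "0 < C" "C \<le> C1" "C \<le> C2" using C1 C2 by (auto simp: C_def)
  have big: "\<forall>\<^sub>F n in sequentially. 2 \<le> n" by (rule eventually_ge_at_top)
  show ?thesis
  proof (intro exI[of _ C] conjI C(1) allI, use lim unl big in eventually_elim)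
    case (elim m B n)
    let ?R = "minimax_risk \<sigma> n (m n) (\<lambda>i. B n) (besov_ball j0 J \<psi> s L)"
    let ?l = "log 2 (real n)"
    show ?case
      unfolding Let_def
    proof (intro impI conjI; (elim conjE)?)
      assume h: "m n dvd n" "0 < B n" "?l \<le> real (m n)"
        "real (m n) \<le> K * (real n powr (2 * s / (1 + 2 * s)) / (ln (real n))\<^sup>2)"
      have l: "1 \<le> ?l" using elim(3) by simp
      then have m0: "0 < m n" using h(3) by (cases "m n") auto
      have pos: "0 < real n" "0 < ?l" "0 < real (m n)" "0 < B n" "0 < s"
        using elim(3) l m0 h(2) assms(1) by auto
      have CC: "ennreal (C * D powr e) \<le> ennreal (C1 * D powr e)" "ennreal (C * D powr e) \<le> ennreal (C2 * D powr e)"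
        for D e :: real
        using C by (auto intro!: ennreal_leI mult_right_mono)
      have lim': "ennreal (C * D powr (- s)) \<le> ?R"
        if "0 < D" "real n / real (m n) * ?l \<le> D powr (2 * s + 1)" "real n * B n * ?l \<le> D powr (2 * s + 2)"
          "D \<le> real n powr (1 / (1 + 2 * s))" for D
        using elim(1) h m0 that by (intro order_trans[OF CC(1)]) (auto intro: less_imp_le)
      {
        show "ennreal (C * (real n / ?l) powr (- (s / (1 + 2 * s)))) \<le> ?R"
          using elim(2) by (intro order_trans[OF CC(2)]) blast
      next
        assume "(real n * ?l / real (m n) powr (2 + 2 * s)) powr (1 / (1 + 2 * s)) \<le> B n"
          and up: "B n < (real n / ?l powr (3 + 4 * s)) powr (1 / (1 + 2 * s))"
        note e = mid_regime_exponents[OF pos this(1)]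
        show "ennreal (C * ((real n powr (1 / (1 + 2 * s)) / (B n * ?l powr ((3 + 4 * s) / (1 + 2 * s)))) powr (s / (2 + 2 * s)) *
          (real n / ?l) powr (- (s / (1 + 2 * s))))) \<le> ?R"
          unfolding e(4) by (rule lim'[OF e(1-3) e(5)[OF up l]])
      next
        assume "B n < (real n * ?l / real (m n) powr (2 + 2 * s)) powr (1 / (1 + 2 * s))"
        note e = low_regime_exponents[OF pos this]
        show "ennreal (C * (real n * ?l / real (m n)) powr (- (s / (1 + 2 * s)))) \<le> ?R"
          unfolding e(4) by (rule lim'[OF e(1-3) e(5)[OF h(3)]])
      }
    qed
  qed
qed

end
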